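(* Let $\{\boldsymbol u_\eta\}$ be a uniformly bounded sequence in $\mathcal H(\mathrm{div},\Omega)$. Then there exist a subsequence $\{\boldsymbol u_{\eta_k}\}$ and functions $\boldsymbol u_0\in\mathcal H(\mathrm{div},\Omega,\mathcal H_\sharp(\mathrm{div}_{\mathbf R_0},Y^m))$ and $\mathrm{div}_{\mathbf R}\,\boldsymbol u_1\in L^2(\Omega,L^2_\sharp(Y^m))$ such that, as $\eta_k\to0$, in the sense of weak two-scale convergence for the matrix $\mathbf R$, $$\boldsymbol u_{\eta_k}\rightharpoonup\boldsymbol u_0(\boldsymbol x,\boldsymbol y),\qquad \mathrm{div}\,\boldsymbol u_{\eta_k}\rightharpoonup\mathrm{div}\,\boldsymbol u(\boldsymbol x)+\mathrm{div}_{\mathbf R}\,\boldsymbol u_1(\boldsymbol x,\boldsymbol y),$$ where $\boldsymbol u(\boldsymbol x)=\int_{Y^m}\boldsymbol u_0(\boldsymbol x,\boldsymbol y)\,d\boldsymbol y$.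
   Context: $\Omega\subset\mathbb{R}^3$ is a bounded open set with Lipschitz boundary; $\eta>0$ is a parameter tending to $0$. $\mathbf R$ is a real matrix with $m$ rows and $3$ columns, $m>3$, satisfying $\mathbf R^T\boldsymbol k\neq\boldsymbol 0$ for all $\boldsymbol k\in\mathbb{Z}^m\setminus\{\boldsymbol 0\}$. $Y^m=]0,1[^m$; the subscript $\sharp$ denotes $Y^m$-periodicity in $\boldsymbol y$. $\mathcal H(\mathrm{div},\Omega)=\{\boldsymbol u\in L^2(\Omega;\mathbb{R}^3):\mathrm{div}\,\boldsymbol u\in L^2(\Omega)\}$. Weak two-scale convergence for $\mathbf R$: $(u_\eta)\subset L^2(\Omega)$ converges to $u_0\in L^2(\Omega\times Y^m)$ if $\lim_{\eta\to0}\int_\Omega u_\eta(\boldsymbol x)\varphi(\boldsymbol x,\mathbf R\boldsymbol x/\eta)\,d\boldsymbol x=\int\!\!\int_{\Omega\times Y^m}u_0\varphi\,d\boldsymbol x\,d\boldsymbol y$ for every $\varphi\in L^2(\Omega,C_\sharp(Y^m))$ (componentwise for vector fields). Operator: $\mathrm{div}_{\mathbf R}\,\boldsymbol u=(\mathbf R^T\nabla_{\boldsymbol y})\cdot\boldsymbol u$. An element of $L^2_\sharp(Y^m)$ is written $\mathrm{div}_{\mathbf R}\,\boldsymbol v$ if its Fourier coefficients are $2\pi i\,\mathbf R^T\boldsymbol k\cdot\boldsymbol v_{\boldsymbol k}$ for some $\boldsymbol v_{\boldsymbol k}\in\mathbb{C}^3$, $\boldsymbol k\in\mathbb{Z}^m$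 ($\boldsymbol v$ itself need not be in $L^2$); for functions of $(\boldsymbol x,\boldsymbol y)$ this is understood for a.e. $\boldsymbol x$. $\mathcal H_\sharp(\mathrm{div}_{\mathbf R_0},Y^m)=\{\boldsymbol u\in L^2_\sharp(Y^m;\mathbb{R}^3):\mathrm{div}_{\mathbf R}\,\boldsymbol u=0\}$. The notation $\boldsymbol u_0\in\mathcal H(\mathrm{div},\Omega,\mathcal H_\sharp(\mathrm{div}_{\mathbf R_0},Y^m))$ means that $\boldsymbol u_0\in L^2(\Omega;\mathcal H_\sharp(\mathrm{div}_{\mathbf R_0},Y^m))$ and that its average $\int_{Y^m}\boldsymbol u_0(\cdot,\boldsymbol y)\,d\boldsymbol y$ belongs to $\mathcal H(\mathrm{div},\Omega)$. *)

theory Defs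
  imports "HOL-Analysis.Analysis"
begin

section \<open>Square-integrable functions and weak divergence\<close>

text \<open>Elements of function spaces are represented by functions (not by classes modulo null sets).\<close>

definition L2_on :: "'a::euclidean_space set \<Rightarrow> ('a \<Rightarrow> 'b::real_normed_vector) set" where
  "L2_on S = {f \<in> borel_measurable (lebesgue_on S).
                integrable (lebesgue_on S) (\<lambda>x. (norm (f x))\<^sup>2)}"

primrec times_continuously_differentiable ::
    "nat \<Rightarrow> ('a::real_normed_vector \<Rightarrow> 'b::real_normed_vector) \<Rightarrow> bool" where
  "times_continuously_differentiable 0 f \<longleftrightarrow> continuous_on UNIV f"
| "times_continuously_differentiable (Suc n) f \<longleftrightarrow>
     (\<forall>x. f differentiable at x) \<and>
     (\<forall>v. times_continuously_differentiable n (\<lambda>x. frechet_derivative f (at x) v))"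

definition test_functions :: "'a::euclidean_space set \<Rightarrow> ('a \<Rightarrow> real) set" where
  "test_functions S = {\<psi>. (\<forall>n. times_continuously_differentiable n \<psi>) \<and>
                           compact (closure {x. \<psi> x \<noteq> 0}) \<and> closure {x. \<psi> x \<noteq> 0} \<subseteq> S}"

definition grad :: "(real^'n \<Rightarrow> real) \<Rightarrow> real^'n \<Rightarrow> real^'n" where
  "grad \<psi> x = (\<chi> i. frechet_derivative \<psi> (at x) (axis i 1))"

definition has_weak_div :: "(real^'n) set \<Rightarrow> (real^'n \<Rightarrow> real^'n) \<Rightarrow> (real^'n \<Rightarrow> real) \<Rightarrow> bool" where
  "has_weak_div \<Omega> u g \<longleftrightarrow>
     (\<forall>\<psi>\<in>test_functions \<Omega>.
        (LINT x|lebesgue_on \<Omega>. u x \<bullet> grad \<psi> x) = - (LINT x|lebesgue_on \<Omega>. g x * \<psi> x))"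

definition H_div :: "(real^'n) set \<Rightarrow> (real^'n \<Rightarrow> real^'n) set" where
  "H_div \<Omega> = {u \<in> L2_on \<Omega>. \<exists>g\<in>L2_on \<Omega>. has_weak_div \<Omega> u g}"

text \<open>A representative of the weak divergence, which is unique up to null sets.\<close>

definition weak_div :: "(real^'n) set \<Rightarrow> (real^'n \<Rightarrow> real^'n) \<Rightarrow> real^'n \<Rightarrow> real" where
  "weak_div \<Omega> u = (SOME g. g \<in> L2_on \<Omega> \<and> has_weak_div \<Omega> u g)"

definition H_div_norm :: "(real^'n) set \<Rightarrow> (real^'n \<Rightarrow> real^'n) \<Rightarrow> real" where
  "H_div_norm \<Omega> u = sqrt ((LINT x|lebesgue_on \<Omega>. (norm (u x))\<^sup>2)
                          + (LINT x|lebesgue_on \<Omega>. (weak_div \<Omega> u x)\<^sup>2))"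

section \<open>Lipschitz boundary\<close>

text \<open>Near each boundary point and in suitable orthonormal coordinates, the set is the strict
  epigraph of a Lipschitz function of the first two coordinates. Translations of the coordinate
  system are absorbed into that function.\<close>

definition lipschitz_boundary :: "(real^3) set \<Rightarrow> bool" where
  "lipschitz_boundary \<Omega> \<longleftrightarrow>
     (\<forall>p\<in>frontier \<Omega>. \<exists>r>0. \<exists>T::real^3 \<Rightarrow> real^3. \<exists>\<gamma>::real \<times> real \<Rightarrow> real. \<exists>L.
        orthogonal_transformation T \<and> L-lipschitz_on UNIV \<gamma> \<and>
        \<Omega> \<inter> ball p r = {x \<in> ball p r. \<gamma> (T x $ 1, T x $ 2) < T x $ 3})"

section \<open>Periodic functions on the unit cell\<close>

definition real_vec :: "int^'m \<Rightarrow> real^'m" where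
  "real_vec k = (\<chi> i. real_of_int (k $ i))"

definition cell :: "(real^'m) set" where
  "cell = box 0 (\<chi> i. 1)"

definition periodic :: "(real^'m \<Rightarrow> 'b) \<Rightarrow> bool" where
  "periodic f \<longleftrightarrow> (\<forall>k y. f (y + real_vec k) = f y)"

definition L2_per :: "(real^'m \<Rightarrow> 'b::real_normed_vector) set" where
  "L2_per = {f. periodic f \<and> f \<in> L2_on cell}"

definition C_per :: "((real^'m) \<Rightarrow>\<^sub>C real) set" where
  "C_per = {f. periodic (apply_bcontfun f)}"

text \<open>For a closed subspace \<open>X\<close> of the periodic square-integrable functions, the Bochner space
  of square-integrable maps from \<open>\<Omega>\<close> to \<open>X\<close> is identified, as usual, with the jointly measurable
  square-integrable functions on \<open>\<Omega> \<times> cell\<close> almost all of whose sections lie in \<open>X\<close>.\<close>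

definition L2_valued :: "(real^3) set \<Rightarrow> (real^'m \<Rightarrow> 'b::real_normed_vector) set
    \<Rightarrow> (real^3 \<Rightarrow> real^'m \<Rightarrow> 'b) set" where
  "L2_valued \<Omega> X = {f. (\<lambda>(x, y). f x y) \<in> L2_on (\<Omega> \<times> cell) \<and>
                       (AE x in lebesgue_on \<Omega>. f x \<in> X)}"

definition cell_mean :: "(real^3 \<Rightarrow> real^'m \<Rightarrow> real^3) \<Rightarrow> real^3 \<Rightarrow> real^3" where
  "cell_mean u x = (LINT y|lebesgue_on cell. u x y)"

section \<open>The operator \<open>div\<^sub>R\<close>\<close>

definition fourier_coeff :: "(real^'m \<Rightarrow> real) \<Rightarrow> int^'m \<Rightarrow> complex" where
  "fourier_coeff f k =
     (LINT y|lebesgue_on cell. complex_of_real (f y) * cis (- 2 * pi * (real_vec k \<bullet> y)))"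

definition fourier_coeff_vec :: "(real^'m \<Rightarrow> real^3) \<Rightarrow> int^'m \<Rightarrow> complex^3" where
  "fourier_coeff_vec u k = (\<chi> j. fourier_coeff (\<lambda>y. u y $ j) k)"

text \<open>\<open>has_div_R R v g\<close> says that \<open>g = div\<^sub>R v\<close>. The field \<open>v\<close> is given only by its
  family of Fourier coefficients, on which no summability is imposed, so that it need not
  be square integrable.\<close>

definition has_div_R :: "real^3^'m \<Rightarrow> (int^'m \<Rightarrow> complex^3) \<Rightarrow> (real^'m \<Rightarrow> real) \<Rightarrow> bool" where
  "has_div_R R v g \<longleftrightarrow>
     (\<forall>k. fourier_coeff g k =
        2 * complex_of_real pi * \<i> *
          (\<Sum>j\<in>UNIV. complex_of_real ((transpose R *v real_vec k) $ j) * v k $ j))"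

definition H_per_div_R0 :: "real^3^'m \<Rightarrow> (real^'m \<Rightarrow> real^3) set" where
  "H_per_div_R0 R = {u \<in> L2_per. has_div_R R (fourier_coeff_vec u) (\<lambda>y. 0)}"

definition H_div_valued :: "(real^3) set \<Rightarrow> real^3^'m \<Rightarrow> (real^3 \<Rightarrow> real^'m \<Rightarrow> real^3) set" where
  "H_div_valued \<Omega> R = {u \<in> L2_valued \<Omega> (H_per_div_R0 R). cell_mean u \<in> H_div \<Omega>}"

section \<open>Weak two-scale convergence for a matrix\<close>

text \<open>Since \<open>C_per\<close> is separable, Borel measurability of \<open>\<phi>\<close> together with \<open>\<phi> x \<in> C_per\<close> for
  almost every \<open>x\<close> is strong measurability, so \<open>\<phi>\<close> below ranges over the Bochner space of
  square-integrable maps from \<open>\<Omega>\<close> to \<open>C_per\<close>.\<close>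

definition weak_two_scale ::
    "(real^3) set \<Rightarrow> real^3^'m \<Rightarrow> (nat \<Rightarrow> real) \<Rightarrow>
     (nat \<Rightarrow> real^3 \<Rightarrow> real) \<Rightarrow> (real^3 \<Rightarrow> real^'m \<Rightarrow> real) \<Rightarrow> bool" where
  "weak_two_scale \<Omega> R \<eta> u u0 \<longleftrightarrow>
     (\<forall>n. u n \<in> L2_on \<Omega>) \<and> (\<lambda>(x, y). u0 x y) \<in> L2_on (\<Omega> \<times> cell) \<and>
     (\<forall>\<phi>::real^3 \<Rightarrow> ((real^'m) \<Rightarrow>\<^sub>C real).
        \<phi> \<in> L2_on \<Omega> \<longrightarrow> (AE x in lebesgue_on \<Omega>. \<phi> x \<in> C_per) \<longrightarrow>
        (\<lambda>n. LINT x|lebesgue_on \<Omega>. u n x * apply_bcontfun (\<phi> x) ((1 / \<eta> n) *\<^sub>R (R *v x)))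
          \<longlonglongrightarrow> (LINT (x, y)|lebesgue_on (\<Omega> \<times> cell). u0 x y * apply_bcontfun (\<phi> x) y))"

definition weak_two_scale_vec ::
    "(real^3) set \<Rightarrow> real^3^'m \<Rightarrow> (nat \<Rightarrow> real) \<Rightarrow>
     (nat \<Rightarrow> real^3 \<Rightarrow> real^3) \<Rightarrow> (real^3 \<Rightarrow> real^'m \<Rightarrow> real^3) \<Rightarrow> bool" where
  "weak_two_scale_vec \<Omega> R \<eta> u u0 \<longleftrightarrow>
     (\<forall>j. weak_two_scale \<Omega> R \<eta> (\<lambda>n x. u n x $ j) (\<lambda>x y. u0 x y $ j))"

end

theory Submission
  imports Defs
begin

text \<open>
  Let \<open>\<phi>\<^sub>\<eta>\<close> stand for \<open>x \<mapsto> \<phi>(x, R x / \<eta>)\<close>. If \<open>v\<^sub>\<eta>\<close> is bounded in \<open>L\<^sup>2(\<Omega>)\<close>, the numbers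
  \<open>\<integral> v\<^sub>\<eta> \<phi>\<^sub>\<eta>\<close> converge along a subsequence for each \<open>\<phi>\<close> of a countable family whose closed
  span contains all test functions. The limit is linear in \<open>\<phi>\<close>, and it is bounded by the norm of
  \<open>\<phi>\<close> in \<open>L\<^sup>2(\<Omega> \<times> Y)\<close>, because \<open>\<integral> \<phi>\<^sub>\<eta>\<^sup>2\<close> tends to \<open>\<integral>\<integral> \<phi>\<^sup>2\<close>. The Riesz representation theorem
  then yields the two-scale limit (\<open>two_scale_compactness\<close>).

  The convergence of the averages (\<open>mean_value_C_per\<close>) is where the matrix enters. Trigonometric
  polynomials are uniformly dense among the continuous periodic functions (\<open>trig_polys_dense\<close>), and a
  wave of frequency \<open>k \<noteq> 0\<close> becomes a wave of frequency \<open>R\<^sup>T k / \<eta>\<close> in \<open>x\<close>. As \<open>R\<^sup>T k \<noteq> 0\<close>, this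
  frequency tends to infinity, so the Riemann--Lebesgue lemma (\<open>Riemann_Lebesgue_set\<close>) sends its
  integral to \<open>0\<close>, which is also its mean over the cell.

  Applied to the components of \<open>u\<^sub>\<eta>\<close> and to \<open>div u\<^sub>\<eta>\<close>, this gives limits \<open>u\<^sub>0\<close> and \<open>G\<close>. They are
  related by the definition of the weak divergence. The test function
  \<open>\<psi>(x) cos(2 \<pi> k \<bullet> R x / \<eta> + c)\<close> has a gradient of size \<open>1/\<eta>\<close> in the direction of \<open>R\<^sup>T k\<close>. After
  multiplication by \<open>\<eta>\<close> all other terms vanish in the limit, so the Fourier coefficients of \<open>u\<^sub>0\<close>
  are orthogonal to \<open>R\<^sup>T k\<close> (\<open>orthogonal_to_waves\<close>): this is \<open>div\<^sub>R u\<^sub>0 = 0\<close>. The test function \<open>\<psi>(x)\<close>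
  shows that the mean \<open>u\<close> of \<open>u\<^sub>0\<close> over the cell has as its divergence the mean of \<open>G\<close>
  (\<open>mean_field_has_weak_div\<close>).

  Hence \<open>G - div u\<close> has mean zero over the cell. Any such function is of the form \<open>div\<^sub>R u\<^sub>1\<close>: if its
  Fourier coefficients are \<open>c\<^sub>k\<close>, the vectors \<open>c\<^sub>k R\<^sup>T k / (2 \<pi> \<i> |R\<^sup>T k|\<^sup>2)\<close> with \<open>k \<noteq> 0\<close> serve as
  coefficients of \<open>u\<^sub>1\<close>. The numbers \<open>|R\<^sup>T k|\<close> have no positive lower bound as soon as \<open>R\<close> has more
  rows than columns, so these coefficients need not be square summable.
\<close>

section \<open>Square-integrable functions\<close>

definition square_integrable :: "'a measure \<Rightarrow> ('a \<Rightarrow> real) \<Rightarrow> bool" where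
  "square_integrable M f \<longleftrightarrow> f \<in> borel_measurable M \<and> integrable M (\<lambda>x. (f x)\<^sup>2)"

lemma square_integrableI:
  "f \<in> borel_measurable M \<Longrightarrow> integrable M (\<lambda>x. (f x)\<^sup>2) \<Longrightarrow> square_integrable M f"
  by (simp add: square_integrable_def)

lemma square_integrableD:
  assumes "square_integrable M f"
  shows "f \<in> borel_measurable M" "integrable M (\<lambda>x. (f x)\<^sup>2)"
  using assms by (auto simp: square_integrable_def)

lemma square_integrable_mult:
  assumes f: "square_integrable M f" and g: "square_integrable M g"
  shows "integrable M (\<lambda>x. f x * g x)"
proof (rule Bochner_Integration.integrable_bound)
  show "integrable M (\<lambda>x. (f x)\<^sup>2 + (g x)\<^sup>2)"
    using f g by (auto simp: square_integrable_def)
  show "(\<lambda>x. f x * g x) \<in> borel_measurable M"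
    using f g by (auto simp: square_integrable_def)
  have "\<bar>a * b\<bar> \<le> a\<^sup>2 + b\<^sup>2" for a b :: real
  proof -
    have "2 * (\<bar>a\<bar> * \<bar>b\<bar>) \<le> a\<^sup>2 + b\<^sup>2" "0 \<le> \<bar>a\<bar> * \<bar>b\<bar>"
      using sum_squares_bound[of "\<bar>a\<bar>" "\<bar>b\<bar>"] by (simp_all add: mult.assoc)
    then show ?thesis unfolding abs_mult by linarith
  qed
  then show "AE x in M. norm (f x * g x) \<le> norm ((f x)\<^sup>2 + (g x)\<^sup>2)"
    by (intro AE_I2) simp
qed

lemma square_integrable_add:
  assumes f: "square_integrable M f" and g: "square_integrable M g"
  shows "square_integrable M (\<lambda>x. f x + g x)"
proof (rule square_integrableI)
  show "(\<lambda>x. f x + g x) \<in> borel_measurable M"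
    using f g by (auto simp: square_integrable_def)
  have "integrable M (\<lambda>x. (f x)\<^sup>2 + (g x)\<^sup>2 + 2 * (f x * g x))"
    using square_integrable_mult[OF f g] f g by (auto simp: square_integrable_def)
  then show "integrable M (\<lambda>x. (f x + g x)\<^sup>2)"
    by (simp add: power2_sum mult.assoc)
qed

lemma square_integrable_scale:
  "square_integrable M f \<Longrightarrow> square_integrable M (\<lambda>x. c * f x)"
  by (auto simp: square_integrable_def power_mult_distrib)

lemma square_integrable_diff:
  assumes f: "square_integrable M f" and g: "square_integrable M g"
  shows "square_integrable M (\<lambda>x. f x - g x)"
  using square_integrable_add[OF f square_integrable_scale[OF g, of "-1"]] by simp

lemma square_integrable_bound:
  assumes "square_integrable M g" "f \<in> borel_measurable M" "AE x in M. \<bar>f x\<bar> \<le> \<bar>g x\<bar>"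
  shows "square_integrable M f"
proof (rule square_integrableI)
  show "integrable M (\<lambda>x. (f x)\<^sup>2)"
    by (rule Bochner_Integration.integrable_bound[OF square_integrableD(2)[OF assms(1)]])
      (use assms(2,3) in \<open>auto elim!: eventually_mono simp: abs_le_square_iff\<close>)
qed (use assms in auto)

text \<open>The quadratic \<open>s \<mapsto> \<integral> (f + s g)\<^sup>2\<close> is nonnegative, so its discriminant is not positive.\<close>

lemma Cauchy_Schwarz_integral:
  assumes f: "square_integrable M f" and g: "square_integrable M g"
  shows "(\<integral>x. f x * g x \<partial>M)\<^sup>2 \<le> (\<integral>x. (f x)\<^sup>2 \<partial>M) * (\<integral>x. (g x)\<^sup>2 \<partial>M)"
proof -
  define a b c where "a = (\<integral>x. (f x)\<^sup>2 \<partial>M)" and "b = (\<integral>x. f x * g x \<partial>M)"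
    and "c = (\<integral>x. (g x)\<^sup>2 \<partial>M)"
  have fg: "integrable M (\<lambda>x. f x * g x)" by (rule square_integrable_mult[OF f g])
  have quad: "0 \<le> a + 2 * s * b + s\<^sup>2 * c" for s
  proof -
    have "0 \<le> (\<integral>x. (f x + s * g x)\<^sup>2 \<partial>M)" by simp
    also have "\<dots> = (\<integral>x. (f x)\<^sup>2 + (2 * s) * (f x * g x) + s\<^sup>2 * (g x)\<^sup>2 \<partial>M)"
      by (simp add: power2_sum power_mult_distrib algebra_simps)
    also have "\<dots> = a + 2 * s * b + s\<^sup>2 * c"
      using f g fg by (simp add: square_integrable_def a_def b_def c_def)
    finally show ?thesis .
  qed
  have c0: "0 \<le> c" by (simp add: c_def)
  show ?thesis
  proof (cases "c = 0")
    case True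
    have "b = 0"
    proof (rule ccontr)
      assume "b \<noteq> 0"
      have "0 \<le> a + 2 * (- (a + 1) / (2 * b)) * b" using quad[of "- (a + 1) / (2 * b)"] True by simp
      with \<open>b \<noteq> 0\<close> show False by (simp add: field_simps)
    qed
    then show ?thesis using True by (simp add: b_def c_def a_def)
  next
    case False
    then have c: "c > 0" using c0 by simp
    have "0 \<le> (a + 2 * (- b / c) * b + (- b / c)\<^sup>2 * c) * c" using quad[of "- b / c"] c by simp
    also have "\<dots> = a * c - b\<^sup>2" using c by (simp add: field_simps power2_eq_square)
    finally show ?thesis by (simp add: a_def b_def c_def)
  qed
qed

lemma abs_integral_le_sqrt:
  assumes f: "square_integrable M f" and g: "square_integrable M g"
    and "(\<integral>x. (f x)\<^sup>2 \<partial>M) \<le> A" and "(\<integral>x. (g x)\<^sup>2 \<partial>M) \<le> B"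
  shows "\<bar>\<integral>x. f x * g x \<partial>M\<bar> \<le> sqrt (A * B)"
proof -
  have "(\<integral>x. f x * g x \<partial>M)\<^sup>2 \<le> (\<integral>x. (f x)\<^sup>2 \<partial>M) * (\<integral>x. (g x)\<^sup>2 \<partial>M)"
    by (rule Cauchy_Schwarz_integral[OF f g])
  also have "\<dots> \<le> A * B"
  proof (rule mult_mono[OF assms(3,4)])
    have "0 \<le> (\<integral>x. (f x)\<^sup>2 \<partial>M)" by simp
    then show "0 \<le> A" using assms(3) by linarith
  qed simp
  finally show ?thesis using real_le_rsqrt by fastforce
qed

text \<open>The elementary bound \<open>|d| \<le> a d\<^sup>2 + 1/a\<close> with the weight \<open>a = 2\<^sup>n\<close> replaces a Cauchy--Schwarz estimate for series.\<close>

lemma summable_from_weighted_squares: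
  fixes d :: "nat \<Rightarrow> real"
  assumes "summable (\<lambda>n. 2^n * (d n)\<^sup>2)"
  shows "summable (\<lambda>n. \<bar>d n\<bar>)"
proof (rule summable_comparison_test')
  show "summable (\<lambda>n. 2^n * (d n)\<^sup>2 + (1/2)^n)"
    using assms by (intro summable_add) (auto intro: summable_geometric)
  fix n
  have *: "\<bar>x\<bar> \<le> a * x\<^sup>2 + 1/a" if "a > 0" for a x :: real
  proof -
    have "0 \<le> (a * \<bar>x\<bar> - 1)\<^sup>2 + a * \<bar>x\<bar>" using that by simp
    also have "\<dots> = a * (a * x\<^sup>2 + 1/a - \<bar>x\<bar>)"
      using that by (simp add: power2_eq_square field_simps)
    finally show ?thesis using that by (simp add: zero_le_mult_iff)
  qed
  from *[of "2^n" "d n"] show "norm \<bar>d n\<bar> \<le> 2^n * (d n)\<^sup>2 + (1/2)^n" by (simp add: power_one_over)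
qed

text \<open>The Riesz--Fischer argument. The rate \<open>8\<^sup>-\<^sup>n\<close> leaves room for the weight \<open>2\<^sup>n\<close>: the series of
  \<open>2\<^sup>n |f\<^sub>n\<^sub>+\<^sub>1 - f\<^sub>n|\<^sup>2\<close> has a finite integral, hence converges almost everywhere, and so do the
  functions themselves. Twice the tail of the weighted series from \<open>k\<close> on dominates \<open>|f\<^sub>n - f\<^sub>k|\<^sup>2\<close> for all \<open>n \<ge> k\<close>, and Fatou's
  lemma passes this bound to the limit.\<close>

lemma L2_complete:
  fixes f :: "nat \<Rightarrow> 'a \<Rightarrow> real"
  assumes f: "\<And>n. square_integrable M (f n)"
    and fast: "\<And>n. (\<integral>x. (f (Suc n) x - f n x)\<^sup>2 \<partial>M) \<le> (1/8)^n"
  obtains w where "square_integrable M w" "(\<lambda>n. \<integral>x. (w x - f n x)\<^sup>2 \<partial>M) \<longlonglongrightarrow> 0"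
proof -
  define d where "d n x = f (Suc n) x - f n x" for n x
  have [measurable]: "f n \<in> borel_measurable M" for n using f by (auto simp: square_integrable_def)
  have d_si: "square_integrable M (d n)" for n
    unfolding d_def by (intro square_integrable_diff f)
  then have [measurable]: "d n \<in> borel_measurable M" for n by (auto simp: square_integrable_def)
  define S where "S x = (\<Sum>n. ennreal (2^n * (d n x)\<^sup>2))" for x
  have tail: "(\<integral>\<^sup>+x. (\<Sum>n. ennreal (2^(n+k) * (d (n+k) x)\<^sup>2)) \<partial>M) \<le> ennreal (2 * (1/4)^k)" for k
  proof -
    have "(\<integral>\<^sup>+x. (\<Sum>n. ennreal (2^(n+k) * (d (n+k) x)\<^sup>2)) \<partial>M)
        = (\<Sum>n. \<integral>\<^sup>+x. ennreal (2^(n+k) * (d (n+k) x)\<^sup>2) \<partial>M)"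
      by (rule nn_integral_suminf) measurable
    also have "\<dots> \<le> (\<Sum>n. ennreal ((1/4)^k * (1/4)^n))"
    proof (intro suminf_le allI)
      fix n
      have "(\<integral>\<^sup>+x. ennreal (2^(n+k) * (d (n+k) x)\<^sup>2) \<partial>M) = ennreal (\<integral>x. 2^(n+k) * (d (n+k) x)\<^sup>2 \<partial>M)"
        using d_si by (intro nn_integral_eq_integral) (auto simp: square_integrable_def)
      also have "(\<integral>x. 2^(n+k) * (d (n+k) x)\<^sup>2 \<partial>M) = 2^(n+k) * (\<integral>x. (d (n+k) x)\<^sup>2 \<partial>M)" by simp
      also have "\<dots> \<le> 2^(n+k) * (1/8)^(n+k)"
        using fast by (auto simp: d_def)
      also have "\<dots> = (1/4)^(n+k)" unfolding power_mult_distrib[symmetric] by simp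
      finally show "(\<integral>\<^sup>+x. ennreal (2^(n+k) * (d (n+k) x)\<^sup>2) \<partial>M) \<le> ennreal ((1/4)^k * (1/4)^n)"
        by (simp add: power_add mult.commute ennreal_leI)
    qed auto
    also have "\<dots> = ennreal (\<Sum>n. (1/4)^k * (1/4)^n)"
      by (intro suminf_ennreal2 summable_mult) (auto intro: summable_geometric)
    also have "(\<Sum>n. (1/4)^k * (1/4)^n) = (1/4)^k * (4/3::real)"
      by (subst suminf_mult) (auto simp: suminf_geometric intro: summable_geometric)
    finally have "(\<integral>\<^sup>+x. (\<Sum>n. ennreal (2^(n+k) * (d (n+k) x)\<^sup>2)) \<partial>M) \<le> ennreal ((1/4)^k * (4/3))" .
    also have "\<dots> \<le> ennreal (2 * (1/4)^k)" by (rule ennreal_leI) simp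
    finally show ?thesis .
  qed
  have "(\<integral>\<^sup>+x. S x \<partial>M) < \<infinity>"
    using tail[of 0] unfolding S_def
    by (auto intro: le_less_trans)
  then have "AE x in M. S x \<noteq> \<infinity>"
    by (intro nn_integral_noteq_infinite) (auto simp: S_def)
  then have conv: "AE x in M. summable (\<lambda>n. \<bar>d n x\<bar>)"
  proof eventually_elim
    case (elim x)
    then have "summable (\<lambda>n. 2^n * (d n x)\<^sup>2)"
      unfolding S_def by (intro summable_suminf_not_top) auto
    then show ?case by (rule summable_from_weighted_squares)
  qed
  define w where "w x = lim (\<lambda>n. f n x)" for x
  have [measurable]: "w \<in> borel_measurable M" unfolding w_def by measurable
  have lim: "AE x in M. (\<lambda>n. f n x) \<longlonglongrightarrow> w x"
    using conv
  proof eventually_elim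
    case (elim x)
    then have "summable (\<lambda>n. d n x)" by (rule summable_rabs_cancel)
    then have "(\<lambda>n. \<Sum>i<n. d i x) \<longlonglongrightarrow> suminf (\<lambda>n. d n x)" by (rule summable_LIMSEQ)
    moreover have "(\<Sum>i<n. d i x) = f n x - f 0 x" for n by (induction n) (auto simp: d_def)
    ultimately have "(\<lambda>n. f n x - f 0 x + f 0 x) \<longlonglongrightarrow> suminf (\<lambda>n. d n x) + f 0 x"
      by (intro tendsto_add) auto
    then show ?case by (auto simp: w_def convergent_def convergent_LIMSEQ_iff[symmetric] )
  qed
  have L2dist: "(\<integral>\<^sup>+x. ennreal ((f n x - f k x)\<^sup>2) \<partial>M) \<le> ennreal (4 * (1/4)^k)" if "k \<le> n" for n k
  proof -
    have "(f n x - f k x)\<^sup>2 \<le> 2 * (\<Sum>i<n-k. 2^(i+k) * (d (i+k) x)\<^sup>2)" for x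
    proof -
      have "(\<Sum>i<j. d (i+k) x) = f (j+k) x - f k x" for j by (induction j) (auto simp: d_def)
      from this[of "n-k"] have "f n x - f k x = (\<Sum>i<n-k. d (i+k) x)" using that by simp
      also have "\<dots> = (\<Sum>i<n-k. (1/sqrt(2^(i+k))) * (sqrt (2^(i+k)) * d (i+k) x))" by simp
      finally have "(f n x - f k x)\<^sup>2 = (\<Sum>i<n-k. (1/sqrt(2^(i+k))) * (sqrt (2^(i+k)) * d (i+k) x))\<^sup>2" by simp
      also have "\<dots> \<le> (\<Sum>i<n-k. (1/sqrt(2^(i+k)))\<^sup>2) * (\<Sum>i<n-k. (sqrt (2^(i+k)) * d (i+k) x)\<^sup>2)"
        by (rule Cauchy_Schwarz_ineq_sum)
      also have "(\<Sum>i<n-k. (1/sqrt(2^(i+k)))\<^sup>2) = (\<Sum>i<n-k. (1/2)^(i+k))"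
        by (simp add: power_divide power_one_over)
      also have "(\<Sum>i<n-k. (sqrt (2^(i+k)) * d (i+k) x)\<^sup>2) = (\<Sum>i<n-k. 2^(i+k) * (d (i+k) x)\<^sup>2)"
        by (simp add: power_mult_distrib)
      also have "(\<Sum>i<n-k. (1/2)^(i+k)) * (\<Sum>i<n-k. 2^(i+k) * (d (i+k) x)\<^sup>2)
          \<le> 2 * (\<Sum>i<n-k. 2^(i+k) * (d (i+k) x)\<^sup>2)"
      proof (intro mult_right_mono sum_nonneg)
        have "(\<Sum>i<n-k. (1/2)^(i+k)) \<le> (\<Sum>i<n-k. (1/2::real)^i)"
          by (intro sum_mono power_decreasing) auto
        also have "\<dots> \<le> suminf (\<lambda>i. (1/2)^i)"
          by (intro sum_le_suminf) (auto intro: summable_geometric)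
        also have "\<dots> = 2" by (simp add: suminf_geometric)
        finally show "(\<Sum>i<n-k. (1/2::real)^(i+k)) \<le> 2" .
      qed auto
      finally show ?thesis .
    qed
    then have "(\<integral>\<^sup>+x. ennreal ((f n x - f k x)\<^sup>2) \<partial>M)
        \<le> (\<integral>\<^sup>+x. 2 * (\<Sum>i. ennreal (2^(i+k) * (d (i+k) x)\<^sup>2)) \<partial>M)"
    proof (intro nn_integral_mono)
      fix x
      assume *: "\<And>x. (f n x - f k x)\<^sup>2 \<le> 2 * (\<Sum>i<n-k. 2^(i+k) * (d (i+k) x)\<^sup>2)"
      have "ennreal ((f n x - f k x)\<^sup>2) \<le> ennreal (2 * (\<Sum>i<n-k. 2^(i+k) * (d (i+k) x)\<^sup>2))"
        using * by (rule ennreal_leI)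
      also have "\<dots> = 2 * (\<Sum>i<n-k. ennreal (2^(i+k) * (d (i+k) x)\<^sup>2))"
        by (subst ennreal_mult) (auto intro: sum_nonneg simp: sum_ennreal)
      also have "\<dots> \<le> 2 * (\<Sum>i. ennreal (2^(i+k) * (d (i+k) x)\<^sup>2))"
        by (intro mult_left_mono sum_le_suminf) auto
      finally show "ennreal ((f n x - f k x)\<^sup>2) \<le> \<dots>" .
    qed
    also have "\<dots> = 2 * (\<integral>\<^sup>+x. (\<Sum>i. ennreal (2^(i+k) * (d (i+k) x)\<^sup>2)) \<partial>M)"
      by (rule nn_integral_cmult) measurable
    also have "\<dots> \<le> 2 * ennreal (2 * (1/4)^k)" by (intro mult_left_mono tail) auto
    also have "\<dots> = ennreal (4 * (1/4)^k)" 
      by (subst ennreal_numeral[symmetric], subst ennreal_mult[symmetric]) auto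
    finally show ?thesis .
  qed
  have Fatou: "(\<integral>\<^sup>+x. ennreal ((w x - f k x)\<^sup>2) \<partial>M) \<le> ennreal (4 * (1/4)^k)" for k
  proof -
    have "(\<integral>\<^sup>+x. ennreal ((w x - f k x)\<^sup>2) \<partial>M) = (\<integral>\<^sup>+x. liminf (\<lambda>n. ennreal ((f n x - f k x)\<^sup>2)) \<partial>M)"
    proof (rule nn_integral_cong_AE, use lim in eventually_elim)
      case (elim x)
      have "(\<lambda>n. ennreal ((f n x - f k x)\<^sup>2)) \<longlonglongrightarrow> ennreal ((w x - f k x)\<^sup>2)"
        using elim by (intro tendsto_ennrealI tendsto_intros)
      then show ?case by (metis lim_imp_Liminf sequentially_bot)
    qed
    also have "\<dots> \<le> liminf (\<lambda>n. \<integral>\<^sup>+x. ennreal ((f n x - f k x)\<^sup>2) \<partial>M)"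
      by (rule nn_integral_liminf) measurable
    also have "\<dots> \<le> liminf (\<lambda>n. ennreal (4 * (1/4)^k))"
      by (intro Liminf_mono) (use L2dist in \<open>auto simp: eventually_sequentially intro!: exI[of _ k]\<close>)
    also have "\<dots> = ennreal (4 * (1/4)^k)" by (simp add: Liminf_const)
    finally show ?thesis .
  qed
  have int: "integrable M (\<lambda>x. (w x - f k x)\<^sup>2)" for k
    using Fatou[of k] by (intro integrableI_bounded) (auto intro: le_less_trans)
  have bnd: "(\<integral>x. (w x - f k x)\<^sup>2 \<partial>M) \<le> 4 * (1/4)^k" for k
    using Fatou[of k] nn_integral_eq_integral[OF int[of k]] by simp
  have "square_integrable M (\<lambda>x. (w x - f 0 x) + f 0 x)"
    using int[of 0] by (intro square_integrable_add f) (auto simp: square_integrable_def)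
  then have "square_integrable M w" by simp
  moreover have "(\<lambda>n. \<integral>x. (w x - f n x)\<^sup>2 \<partial>M) \<longlonglongrightarrow> 0"
  proof (rule tendsto_sandwich[OF _ _ tendsto_const])
    have "(\<lambda>k. 4 * (1/4::real)^k) \<longlonglongrightarrow> 4 * 0"
      by (intro tendsto_mult tendsto_const LIMSEQ_realpow_zero) auto
    then show "(\<lambda>k. 4 * (1/4::real)^k) \<longlonglongrightarrow> 0" by simp
  qed (use bnd in auto)
  ultimately show ?thesis using that by blast
qed

text \<open>The representing function minimises \<open>|f|\<^sup>2 - 2 L f\<close>. A minimising sequence taken from the subspace
  is a Cauchy sequence by the parallelogram identity, and vanishing of the first variation at its limit
  is the representation formula. The limit lies in the closure of the subspace.\<close>

theorem Riesz_representation_on_subspace: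
  fixes V :: "('a \<Rightarrow> real) set" and L :: "('a \<Rightarrow> real) \<Rightarrow> real"
  assumes V: "\<And>f. f \<in> V \<Longrightarrow> square_integrable M f"
    and zero: "(\<lambda>x. 0) \<in> V"
    and add: "\<And>f g. f \<in> V \<Longrightarrow> g \<in> V \<Longrightarrow> (\<lambda>x. f x + g x) \<in> V"
    and scale: "\<And>f c. f \<in> V \<Longrightarrow> (\<lambda>x. c * f x) \<in> V"
    and L_add: "\<And>f g. f \<in> V \<Longrightarrow> g \<in> V \<Longrightarrow> L (\<lambda>x. f x + g x) = L f + L g"
    and L_scale: "\<And>f c. f \<in> V \<Longrightarrow> L (\<lambda>x. c * f x) = c * L f"
    and L_bound: "\<And>f. f \<in> V \<Longrightarrow> (L f)\<^sup>2 \<le> C * (\<integral>x. (f x)\<^sup>2 \<partial>M)"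
  obtains w where "square_integrable M w" "\<And>f. f \<in> V \<Longrightarrow> (\<integral>x. w x * f x \<partial>M) = L f"
proof -
  define N where "N f = (\<integral>x. (f x)\<^sup>2 \<partial>M)" for f :: "'a \<Rightarrow> real"
  define J where "J f = N f - 2 * L f" for f
  define I where "I = Inf (J ` V)"
  have N0: "0 \<le> N f" for f by (simp add: N_def)
  have Jlow: "- \<bar>C\<bar> \<le> J f" if "f \<in> V" for f
  proof -
    have "(L f)\<^sup>2 \<le> \<bar>C\<bar> * N f"
      by (rule order.trans[OF L_bound[OF that]]) (auto simp: N_def intro!: mult_right_mono)
    also have "\<dots> \<le> ((\<bar>C\<bar> + N f)/2)\<^sup>2"
      using arith_geo_mean_sqrt[of "\<bar>C\<bar>" "N f"] N0[of f] 
      by (metis abs_ge_zero mult_nonneg_nonneg real_sqrt_ge_zero real_sqrt_pow2 power_mono)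
    finally have "\<bar>L f\<bar> \<le> \<bar>(\<bar>C\<bar> + N f)/2\<bar>" by (simp only: abs_le_square_iff)
    then show ?thesis using N0[of f] by (simp add: J_def)
  qed
  have bdd: "bdd_below (J ` V)" by (rule bdd_belowI[of _ "- \<bar>C\<bar>"]) (use Jlow in auto)
  have Ile: "I \<le> J f" if "f \<in> V" for f unfolding I_def using bdd that by (auto intro: cInf_lower)
  have "\<exists>f\<in>V. J f < I + (1/8)^n / 8" for n
  proof -
    have "Inf (J ` V) < I + (1/8)^n / 8" by (simp add: I_def)
    then show ?thesis using cInf_lessD[of "J ` V"] zero by blast
  qed
  then obtain f where f: "\<And>n. f n \<in> V" and Jf: "\<And>n. J (f n) < I + (1/8)^n / 8" by metis
  \<comment> \<open>The parallelogram identity turns a minimising sequence into a Cauchy sequence.\<close>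
  have fast: "(\<integral>x. (f (Suc n) x - f n x)\<^sup>2 \<partial>M) \<le> (1/8)^n" for n
  proof -
    let ?a = "f (Suc n)" and ?b = "f n"
    define m where "m = (\<lambda>x. (1/2) * (?a x + ?b x))"
    have mV: "m \<in> V" unfolding m_def by (intro scale add f)
    have Lm: "L m = (L ?a + L ?b) / 2"
      unfolding m_def L_scale[OF add[OF f f]] L_add[OF f f] by simp
    have si: "square_integrable M ?a" "square_integrable M ?b" using V f by auto
    have ab: "integrable M (\<lambda>x. ?a x * ?b x)" by (rule square_integrable_mult[OF si])
    have e1: "(\<integral>x. (?a x - ?b x)\<^sup>2 \<partial>M) = N ?a + N ?b - 2 * (\<integral>x. ?a x * ?b x \<partial>M)"
    proof -
      have "(\<integral>x. (?a x - ?b x)\<^sup>2 \<partial>M) = (\<integral>x. (?a x)\<^sup>2 + (?b x)\<^sup>2 - 2 * (?a x * ?b x) \<partial>M)"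
        by (simp add: power2_diff mult.assoc)
      then show ?thesis using si ab by (simp add: square_integrable_def N_def)
    qed
    have e2: "N m = (N ?a + N ?b + 2 * (\<integral>x. ?a x * ?b x \<partial>M)) / 4"
    proof -
      have "N m = (\<integral>x. (1/4) * ((?a x)\<^sup>2 + (?b x)\<^sup>2 + 2 * (?a x * ?b x)) \<partial>M)"
        unfolding N_def m_def by (intro Bochner_Integration.integral_cong) (auto simp: power2_eq_square algebra_simps)
      then show ?thesis using si ab by (simp add: square_integrable_def N_def)
    qed
    have "(\<integral>x. (?a x - ?b x)\<^sup>2 \<partial>M) = 2 * J ?a + 2 * J ?b - 4 * J m"
      unfolding e1 J_def e2 Lm by (simp add: field_simps)
    also have "\<dots> \<le> 2 * (I + (1/8)^Suc n / 8) + 2 * (I + (1/8)^n/8) - 4 * I"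
      by (intro diff_mono add_mono mult_left_mono order.strict_implies_order[OF Jf] Ile[OF mV]) auto
    also have "\<dots> \<le> (1/8)^n" by (simp add: field_simps)
    finally show ?thesis .
  qed
  obtain w where w: "square_integrable M w" and lim: "(\<lambda>n. \<integral>x. (w x - f n x)\<^sup>2 \<partial>M) \<longlonglongrightarrow> 0"
    using L2_complete[of M f] V f fast by blast
  have "(\<integral>x. w x * g x \<partial>M) = L g" if g: "g \<in> V" for g
  proof -
    have gsi: "square_integrable M g" using V g by blast
    define ip where "ip h = (\<integral>x. h x * g x \<partial>M)" for h
    have conv: "(\<lambda>n. ip (f n)) \<longlonglongrightarrow> ip w"
    proof (rule LIM_zero_cancel, rule Lim_null_comparison)
      show "(\<lambda>n. sqrt ((\<integral>x. (w x - f n x)\<^sup>2 \<partial>M) * N g)) \<longlonglongrightarrow> 0"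
        using tendsto_real_sqrt[OF tendsto_mult_left_zero[OF lim, of "N g"]] by simp
      show "\<forall>\<^sub>F n in sequentially. norm (ip (f n) - ip w) \<le> sqrt ((\<integral>x. (w x - f n x)\<^sup>2 \<partial>M) * N g)"
      proof (intro always_eventually allI)
        fix n
        have "ip w - ip (f n) = (\<integral>x. (w x - f n x) * g x \<partial>M)"
          unfolding ip_def using square_integrable_mult[OF w gsi] square_integrable_mult[OF V[OF f] gsi, of n]
          by (simp add: left_diff_distrib)
        then show "norm (ip (f n) - ip w) \<le> sqrt ((\<integral>x. (w x - f n x)\<^sup>2 \<partial>M) * N g)"
          using abs_integral_le_sqrt[OF square_integrable_diff[OF w V[OF f]] gsi order.refl order.refl, of n]
          by (simp add: N_def abs_minus_commute)
      qed
    qed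
    have var: "0 \<le> 2 * s * (ip w - L g) + s\<^sup>2 * N g" for s
    proof -
      have "- ((1/8)^n / 8) \<le> 2 * s * (ip (f n) - L g) + s\<^sup>2 * N g" for n
      proof -
        define h where "h = (\<lambda>x. f n x + s * g x)"
        have hV: "h \<in> V" unfolding h_def by (intro add scale f g)
        have Lh: "L h = L (f n) + s * L g" unfolding h_def by (simp add: L_add L_scale f g scale)
        have "N h = (\<integral>x. (f n x)\<^sup>2 + (2 * s) * (f n x * g x) + s\<^sup>2 * (g x)\<^sup>2 \<partial>M)"
          unfolding N_def h_def by (intro Bochner_Integration.integral_cong) (auto simp: power2_eq_square algebra_simps)
        also have "\<dots> = N (f n) + 2 * s * ip (f n) + s\<^sup>2 * N g"
          using V[OF f] gsi square_integrable_mult[OF V[OF f] gsi, of n]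
          by (simp add: square_integrable_def N_def ip_def)
        finally have "J h = J (f n) + 2 * s * (ip (f n) - L g) + s\<^sup>2 * N g"
          by (simp add: J_def Lh algebra_simps)
        then show ?thesis using Ile[OF hV] Jf[of n] by linarith
      qed
      moreover have "(\<lambda>n. 2 * s * (ip (f n) - L g) + s\<^sup>2 * N g) \<longlonglongrightarrow> 2 * s * (ip w - L g) + s\<^sup>2 * N g"
        by (intro tendsto_intros conv)
      moreover have "(\<lambda>n. - ((1/8::real)^n / 8)) \<longlonglongrightarrow> - (0 / 8)"
        by (intro tendsto_intros LIMSEQ_realpow_zero) auto
      ultimately show ?thesis using LIMSEQ_le[of "\<lambda>n. - ((1/8::real)^n / 8)" "- (0/8)"] by auto
    qed
    define b where "b = ip w - L g"
    have "b = 0"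
    proof (rule ccontr)
      assume "b \<noteq> 0"
      define t where "t = 1 / (1 + N g)"
      have t: "t > 0" "t * N g \<le> 1" using N0[of g] by (auto simp: t_def field_simps)
      have "0 \<le> 2 * (- t * b) * b + (- t * b)\<^sup>2 * N g" using var[of "- t * b"] unfolding b_def .
      also have "\<dots> = t * b\<^sup>2 * (t * N g - 2)" by (simp add: power2_eq_square algebra_simps)
      also have "\<dots> < 0" using t \<open>b \<noteq> 0\<close> by (intro mult_pos_neg) auto
      finally show False by simp
    qed
    then show ?thesis by (simp add: b_def ip_def)
  qed
  with w show ?thesis using that by blast
qed


section \<open>Approximation by boxes and the Riemann--Lebesgue lemma\<close>

text \<open>The closed box, and not only the open one, has to lie in \<open>\<Omega>\<close>: the smooth approximations of the
  indicator of the box are then compactly supported in \<open>\<Omega>\<close>.\<close>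

definition rational_boxes_in :: "(real^'n) set \<Rightarrow> (real^'n) set set" where
  "rational_boxes_in \<Omega> = {box a b | a b. (\<forall>i. a $ i \<in> \<rat>) \<and> (\<forall>i. b $ i \<in> \<rat>) \<and> cbox a b \<subseteq> \<Omega>}"

lemma countable_rational_boxes_in:
  fixes \<Omega> :: "(real^'n) set"
  shows "countable (rational_boxes_in \<Omega>)"
proof -
  define v :: "rat^'n \<Rightarrow> real^'n" where "v q = (\<chi> i. of_rat (q $ i))" for q
  have "\<exists>q. a = v q" if "\<forall>i. a $ i \<in> \<rat>" for a
  proof -
    from that have "\<forall>i. \<exists>q. a $ i = of_rat q" by (auto simp: Rats_def)
    then obtain q where "\<And>i. a $ i = of_rat (q i)" by metis
    then show ?thesis by (intro exI[of _ "\<chi> i. q i"]) (simp add: v_def vec_eq_iff)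
  qed
  then have "rational_boxes_in \<Omega> \<subseteq> (\<lambda>(p, q). box (v p) (v q)) ` UNIV"
    unfolding rational_boxes_in_def by (auto simp: image_iff) metis
  then show ?thesis by (rule countable_subset) (intro countable_image countableI_type)
qed

lemma open_eq_Union_rational_boxes:
  assumes "open \<Omega>"
  shows "\<Omega> = \<Union>(rational_boxes_in \<Omega>)"
proof
  show "\<Union>(rational_boxes_in \<Omega>) \<subseteq> \<Omega>"
    unfolding rational_boxes_in_def using box_subset_cbox by fastforce
  show "\<Omega> \<subseteq> \<Union>(rational_boxes_in \<Omega>)"
  proof
    fix x assume "x \<in> \<Omega>"
    then obtain e where e: "e > 0" "cball x e \<subseteq> \<Omega>" using assms open_contains_cball by blast
    obtain a b where ab: "\<forall>i\<in>Basis. a \<bullet> i \<in> \<rat> \<and> b \<bullet> i \<in> \<rat>" "x \<in> box a b" "box a b \<subseteq> ball x e"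
      using rational_boxes[OF e(1)] by blast
    have "cbox a b = closure (box a b)" using ab(2) by (intro closure_box[symmetric]) auto
    also have "\<dots> \<subseteq> closure (ball x e)" by (intro closure_mono ab)
    also have "\<dots> \<subseteq> \<Omega>" using e by simp
    finally have "cbox a b \<subseteq> \<Omega>" .
    moreover have "a $ i \<in> \<rat>" "b $ i \<in> \<rat>" for i
      using ab(1) by (auto simp: Basis_vec_def inner_axis)
    ultimately have "box a b \<in> rational_boxes_in \<Omega>" unfolding rational_boxes_in_def by blast
    then show "x \<in> \<Union>(rational_boxes_in \<Omega>)" using ab(2) by blast
  qed
qed

definition box_unions :: "(real^'n) set \<Rightarrow> (real^'n) set set" where
  "box_unions \<Omega> = {\<Union>F | F. finite F \<and> F \<subseteq> rational_boxes_in \<Omega>}"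

lemma countable_box_unions: "countable (box_unions \<Omega>)"
proof -
  have "box_unions \<Omega> = Union ` {F. finite F \<and> F \<subseteq> rational_boxes_in \<Omega>}"
    by (auto simp: box_unions_def)
  then show ?thesis
    using countable_Collect_finite_subset[OF countable_rational_boxes_in[of \<Omega>]] by simp
qed

lemma box_unionsD:
  assumes "A \<in> box_unions \<Omega>"
  shows "open A" "A \<subseteq> \<Omega>" "bounded A" "A \<in> sets borel" "A \<in> lmeasurable"
proof -
  obtain F where F: "A = \<Union>F" "finite F" "F \<subseteq> rational_boxes_in \<Omega>"
    using assms by (auto simp: box_unions_def)
  have each: "\<exists>a b. S = box a b \<and> cbox a b \<subseteq> \<Omega>" if "S \<in> F" for S
    using F(3) that unfolding rational_boxes_in_def by blast
  show "open A" unfolding F(1) by (intro open_Union ballI) (use each in force)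
  show "A \<subseteq> \<Omega>" unfolding F(1) by (intro Union_least) (use each box_subset_cbox in fastforce)
  show b: "bounded A" unfolding F(1) using F(2) by (intro bounded_Union ballI) (use each in force)+
  show "A \<in> sets borel" using \<open>open A\<close> by auto
  show "A \<in> lmeasurable" using \<open>open A\<close> b by (auto intro: lmeasurable_open)
qed

lemma box_unions_increasing:
  assumes "open U" "U \<noteq> {}"
  obtains B :: "nat \<Rightarrow> (real^'n) set" where "\<And>n. B n \<in> box_unions U" "incseq B" "(\<Union>n. B n) = U"
proof -
  have ne: "rational_boxes_in U \<noteq> {}" using open_eq_Union_rational_boxes[OF assms(1)] assms(2) by auto
  define g where "g = from_nat_into (rational_boxes_in U)"
  have rg: "range g = rational_boxes_in U"
    unfolding g_def by (rule range_from_nat_into[OF ne countable_rational_boxes_in])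
  define B where "B n = \<Union>(g ` {..n})" for n
  have "B n \<in> box_unions U" for n
    unfolding box_unions_def B_def using rg by blast
  moreover have "incseq B" unfolding incseq_def B_def by (intro allI impI Union_mono image_mono) auto
  moreover have "(\<Union>n. B n) = U"
  proof -
    have "B n \<subseteq> \<Union>(range g)" "g n \<subseteq> B n" for n unfolding B_def by blast+
    then have "(\<Union>n. B n) = \<Union>(range g)" by blast
    also have "\<dots> = U" unfolding rg by (rule open_eq_Union_rational_boxes[OF assms(1), symmetric])
    finally show ?thesis .
  qed
  ultimately show ?thesis using that by blast
qed

lemma box_unions_mono:
  assumes "U \<subseteq> \<Omega>"
  shows "box_unions U \<subseteq> box_unions \<Omega>"
proof -
  have "rational_boxes_in U \<subseteq> rational_boxes_in \<Omega>"
    unfolding rational_boxes_in_def by (intro Collect_mono) (use assms in \<open>metis order.trans\<close>)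
  then show ?thesis unfolding box_unions_def by (intro Collect_mono) (metis order.trans)
qed

lemma lmeasurable_outer_open_measure:
  assumes "A \<in> lmeasurable" "e > 0"
  obtains T where "open T" "A \<subseteq> T" "T \<in> lmeasurable" "measure lebesgue (T - A) < e"
proof -
  obtain T where T: "open T" "A \<subseteq> T" "T - A \<in> lmeasurable" "emeasure lebesgue (T - A) < ennreal e"
    using sets_lebesgue_outer_open[OF fmeasurableD[OF assms(1)] assms(2)] by blast
  show ?thesis
    using that[OF T(1,2) fmeasurable_Diff_D[OF T(3) assms(1) T(2)]] T(3,4) assms(2)
    by (simp add: emeasure_eq_measure2 ennreal_less_iff)
qed

lemma lmeasurable_inner_closed_measure:
  assumes "A \<in> lmeasurable" "e > 0"
  obtains K where "closed K" "K \<subseteq> A" "K \<in> lmeasurable" "measure lebesgue (A - K) < e"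
proof -
  obtain K where K: "closed K" "K \<subseteq> A" "A - K \<in> lmeasurable" "emeasure lebesgue (A - K) < ennreal e"
    using sets_lebesgue_inner_closed[OF fmeasurableD[OF assms(1)] assms(2)] by blast
  have "K \<in> lmeasurable"
    by (rule fmeasurableI2[OF assms(1) K(2)]) (use K(1) in auto)
  then show ?thesis
    using that[OF K(1,2)] K(3,4) assms(2) by (simp add: emeasure_eq_measure2 ennreal_less_iff)
qed

text \<open>Outer regularity gives an open set between \<open>A\<close> and \<open>\<Omega>\<close> of almost the same measure, and an open
  set is the increasing union of countably many finite unions of boxes.\<close>

lemma box_unions_dense:
  fixes \<Omega> :: "(real^'n) set"
  assumes "open \<Omega>" "A \<in> lmeasurable" "A \<subseteq> \<Omega>" "e > 0"
  obtains B where "B \<in> box_unions \<Omega>" "measure lebesgue ((A - B) \<union> (B - A)) < e"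
proof -
  obtain T where T: "open T" "A \<subseteq> T" "T \<in> lmeasurable" "measure lebesgue (T - A) < e/2"
    using lmeasurable_outer_open_measure[OF assms(2), of "e/2"] assms(4) by auto
  define U where "U = T \<inter> \<Omega>"
  have U: "open U" "A \<subseteq> U" "U \<subseteq> \<Omega>" "U \<in> lmeasurable"
    using T assms by (auto simp: U_def intro!: fmeasurable_Int_fmeasurable)
  show ?thesis
  proof (cases "U = {}")
    case True
    then have "A = {}" using U by auto
    moreover have "{} \<in> box_unions \<Omega>" by (auto simp: box_unions_def intro!: exI[of _ "{}"])
    ultimately show ?thesis using that[of "{}"] assms(4) by simp
  next
    case False
    obtain B where B: "\<And>n. B n \<in> box_unions U" "incseq B" "(\<Union>n. B n) = U"
      using box_unions_increasing[OF U(1) False] by blast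
    have "(\<lambda>n. measure lebesgue (B n)) \<longlonglongrightarrow> measure lebesgue (\<Union>n. B n)"
    proof (rule Lim_measure_incseq[OF _ B(2)])
      show "range B \<subseteq> sets lebesgue" using box_unionsD(5)[OF B(1)] by auto
      show "emeasure lebesgue (\<Union> (range B)) \<noteq> \<infinity>" unfolding B(3) using U(4) by (auto simp: fmeasurable_def)
    qed
    then have "\<forall>\<^sub>F n in sequentially. dist (measure lebesgue (B n)) (measure lebesgue U) < e/2"
      unfolding B(3) using assms(4) by (intro tendstoD) auto
    then obtain n where n: "dist (measure lebesgue (B n)) (measure lebesgue U) < e/2"
      unfolding eventually_sequentially by blast
    have BU: "B n \<subseteq> U" using box_unionsD(2)[OF B(1)] .
    have Bm: "B n \<in> lmeasurable" using box_unionsD(5)[OF B(1)] .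
    have "measure lebesgue (U - B n) = measure lebesgue U - measure lebesgue (B n)"
      by (rule measurable_measure_Diff[OF U(4) _ BU]) (use Bm in auto)
    then have 1: "measure lebesgue (U - B n) < e/2" using n unfolding dist_real_def by linarith
    have "measure lebesgue ((A - B n) \<union> (B n - A)) \<le> measure lebesgue ((U - B n) \<union> (T - A))"
      using U T BU Bm assms by (intro measure_mono_fmeasurable) (auto intro!: fmeasurable.Un fmeasurable_Diff simp: U_def)
    also have "\<dots> \<le> measure lebesgue (U - B n) + measure lebesgue (T - A)"
      using U T Bm assms by (intro measure_Un_le) (auto intro!: sets.Diff)
    also have "\<dots> < e" using 1 T(4) by simp
    finally show ?thesis using that[of "B n"] B(1) box_unions_mono[OF U(3)] by blast
  qed
qed

lemma lebesgue_integral_translate: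
  fixes f :: "'a::euclidean_space \<Rightarrow> 'b::{banach, second_countable_topology}"
  assumes "f \<in> borel_measurable borel"
  shows "(\<integral>x. f (x + h) \<partial>lborel) = (\<integral>x. f x \<partial>lborel)"
proof -
  have "(\<integral>x. f x \<partial>lborel) = (\<integral>x. f x \<partial>distr lborel borel ((+) h))" by (simp add: lborel_distr_plus)
  also have "\<dots> = (\<integral>x. f (h + x) \<partial>lborel)" using assms by (intro integral_distr) auto
  finally show ?thesis by (simp add: add.commute)
qed

lemma lborel_integrable_translate:
  fixes f :: "'a::euclidean_space \<Rightarrow> 'b::{banach, second_countable_topology}"
  assumes "integrable lborel f"
  shows "integrable lborel (\<lambda>x. f (x + h))"
proof -
  have "integrable (distr lborel borel ((+) h)) f" using assms by (simp add: lborel_distr_plus)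
  then have "integrable lborel (\<lambda>x. f (h + x))" by (rule integrable_distr[rotated]) auto
  then show ?thesis by (simp add: add.commute)
qed

text \<open>Half a period of the oscillation is a short vector \<open>h\<close> when the frequency is large. Translation by
  \<open>h\<close> changes the sign of the integral over a compact set \<open>K\<close>, so twice this integral is at most the
  measure of the symmetric difference of \<open>K\<close> and its translate. Both lie in a fixed open
  neighbourhood of \<open>K\<close> which is only slightly larger than \<open>K\<close>.\<close>

lemma Riemann_Lebesgue_set:
  fixes A :: "'a::euclidean_space set" and \<xi> :: "nat \<Rightarrow> 'a"
  assumes A: "A \<in> sets borel" "bounded A" and \<xi>: "filterlim (\<lambda>n. norm (\<xi> n)) at_top sequentially"
  shows "(\<lambda>n. \<integral>x. indicator A x *\<^sub>R cis (\<xi> n \<bullet> x) \<partial>lborel) \<longlonglongrightarrow> 0"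
proof (rule LIMSEQ_I)
  fix e :: real assume e: "e > 0"
  have Am: "A \<in> lmeasurable" using A by (auto intro: bounded_set_imp_lmeasurable)
  have [measurable]: "A \<in> sets borel" by (rule A)
  obtain T where T: "open T" "A \<subseteq> T" "T \<in> lmeasurable" "measure lebesgue (T - A) < e/4"
    using lmeasurable_outer_open_measure[OF Am, of "e/4"] e by auto
  obtain K where K: "closed K" "K \<subseteq> A" "K \<in> lmeasurable" "measure lebesgue (A - K) < e/4"
    using lmeasurable_inner_closed_measure[OF Am, of "e/4"] e by auto
  have Kc: "compact K" using K A(2) by (meson bounded_subset compact_eq_bounded_closed)
  obtain d where d: "d > 0" "(\<Union>x\<in>K. ball x d) \<subseteq> T"
    using compact_subset_open_imp_ball_epsilon_subset[OF Kc T(1)] K(2) T(2) by blast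
  have Kb [measurable]: "K \<in> sets borel" using K(1) by auto
  have Tb [measurable]: "T \<in> sets borel" using T(1) by auto
  have fin: "emeasure lborel T < \<infinity>" "emeasure lborel K < \<infinity>" "emeasure lborel A < \<infinity>"
    using T(3) K(3) Am Tb Kb A by (auto simp: fmeasurable_def emeasure_completion)
  have int: "integrable lborel (indicator T :: 'a \<Rightarrow> real)" "integrable lborel (indicator K :: 'a \<Rightarrow> real)"
    "integrable lborel (indicator A :: 'a \<Rightarrow> real)"
    using fin by (auto simp: integrable_indicator_iff)
  have TK: "measure lborel (T - K) < e/2"
  proof -
    have "measure lborel (T - K) = measure lebesgue ((T - A) \<union> (A - K))"
      using T(2) K(2) by (simp add: measure_completion Un_Diff_cancel2 Diff_Un) (intro arg_cong[of _ _ "measure lborel"], auto)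
    also have "\<dots> \<le> measure lebesgue (T - A) + measure lebesgue (A - K)"
      using T K Am by (intro measure_Un_le) (auto intro!: sets.Diff)
    finally show ?thesis using T K by simp
  qed
  have TKe: "measure lborel (T - K) = measure lborel T - measure lborel K"
    by (rule measure_Diff) (use fin T(2) K(2) in auto)
  have AK: "measure lborel A - measure lborel K < e/4"
  proof -
    have "measure lborel A - measure lborel K = measure lborel (A - K)"
      by (rule measure_Diff[symmetric]) (use fin K(2) A in auto)
    then show ?thesis using K(4) by (simp add: measure_completion)
  qed
  have "\<forall>\<^sub>F n in sequentially. norm (\<xi> n) > pi / d"
    using \<xi> by (simp add: filterlim_at_top_dense)
  then obtain n0 where n0: "\<And>n. n \<ge> n0 \<Longrightarrow> norm (\<xi> n) > pi / d" by (auto simp: eventually_sequentially)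
  have "norm (\<integral>x. indicator A x *\<^sub>R cis (\<xi> n \<bullet> x) \<partial>lborel) < e" if n: "n \<ge> n0" for n
  proof -
    define z where "z = \<xi> n"
    have z: "norm z > pi / d" using n0[OF n] by (simp add: z_def)
    moreover have "pi / d > 0" using d(1) by simp
    ultimately have z0: "norm z > 0" by linarith
    \<comment> \<open>Half a period in the direction of the frequency: the phase changes by exactly \<open>\<pi>\<close>.\<close>
    define h where "h = (pi / (norm z)\<^sup>2) *\<^sub>R z"
    have zh: "z \<bullet> h = pi" using z0 by (simp add: h_def power2_norm_eq_inner)
    have "norm h = pi / norm z" using z0 by (simp add: h_def power2_eq_square)
    also have "\<dots> < d" using z z0 d(1) by (simp add: field_simps)
    finally have h: "norm h < d" .
    have inT: "x \<in> T" if "x + h \<in> K" for x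
    proof -
      have "x \<in> ball (x + h) d" using h by (simp add: dist_norm)
      then show ?thesis using d(2) that by blast
    qed
    have icis: "integrable lborel (\<lambda>x. indicator S (x + a) *\<^sub>R cis (z \<bullet> x))"
      if "S \<in> sets borel" "integrable lborel (\<lambda>x. indicator S (x + a) :: real)" for S a
    proof (rule Bochner_Integration.integrable_bound[OF that(2)])
      show "(\<lambda>x. indicator S (x + a) *\<^sub>R cis (z \<bullet> x)) \<in> borel_measurable lborel"
        using that(1) by (intro borel_measurable_scaleR measurable_compose[OF _ borel_measurable_indicator]
          borel_measurable_continuous_onI) (auto intro!: continuous_intros borel_measurable_continuous_onI)
    qed auto
    have intKh: "integrable lborel (\<lambda>x. indicator K (x + h) :: real)"
      by (rule lborel_integrable_translate[OF int(2)])
    have Kh: "(\<integral>x. indicator K (x + h) \<partial>lborel) = measure lborel K"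
      using lebesgue_integral_translate[of "indicator K :: 'a \<Rightarrow> real" h] Kb by simp
    define IK where "IK = (\<integral>x. indicator K x *\<^sub>R cis (z \<bullet> x) \<partial>lborel)"
    \<comment> \<open>Shifting by half a period flips the sign of the oscillating factor.\<close>
    have shift: "IK = - (\<integral>x. indicator K (x + h) *\<^sub>R cis (z \<bullet> x) \<partial>lborel)"
    proof -
      have "IK = (\<integral>x. indicator K (x + h) *\<^sub>R cis (z \<bullet> (x + h)) \<partial>lborel)"
        unfolding IK_def
      proof (rule lebesgue_integral_translate[symmetric], rule borel_measurable_scaleR)
        show "(\<lambda>x. cis (z \<bullet> x)) \<in> borel_measurable borel"
          by (intro borel_measurable_continuous_onI continuous_intros)
      qed (use Kb in simp)
      also have "\<dots> = (\<integral>x. - (indicator K (x + h) *\<^sub>R cis (z \<bullet> x)) \<partial>lborel)"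
        by (intro Bochner_Integration.integral_cong refl)
          (simp add: inner_add_right zh complex_eq_iff)
      finally show ?thesis by simp
    qed
    have "2 * IK = (\<integral>x. (indicator K x - indicator K (x + h)) *\<^sub>R cis (z \<bullet> x) \<partial>lborel)"
      using icis[OF Kb, of 0] icis[OF Kb intKh] int(2) shift IK_def by (simp add: scaleR_left_diff_distrib)
    then have "2 * norm IK = norm (\<integral>x. (indicator K x - indicator K (x + h)) *\<^sub>R cis (z \<bullet> x) \<partial>lborel)"
      by (metis norm_mult norm_numeral)
    also have "\<dots> \<le> (\<integral>x. (indicator T x - indicator K x) + (indicator T x - indicator K (x + h)) \<partial>lborel)"
    proof (rule Bochner_Integration.integral_norm_bound_integral)
      show "integrable lborel (\<lambda>x. (indicator K x - indicator K (x + h)) *\<^sub>R cis (z \<bullet> x))"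
        using icis[OF Kb, of 0] icis[OF Kb intKh] int(2) by (simp add: scaleR_left_diff_distrib)
      show "integrable lborel (\<lambda>x. (indicator T x - indicator K x) + (indicator T x - indicator K (x + h)) :: real)"
        using int intKh by auto
      show "norm ((indicator K x - indicator K (x + h)) *\<^sub>R cis (z \<bullet> x))
          \<le> (indicator T x - indicator K x) + (indicator T x - indicator K (x + h))" for x
        using inT[of x] K(2) T(2) by (auto simp: indicator_def)
    qed
    also have "\<dots> = 2 * measure lborel (T - K)"
      using int intKh Kh Tb Kb TKe by simp
    finally have IK: "norm IK < e/2" using TK by simp
    have "(\<integral>x. indicator A x *\<^sub>R cis (z \<bullet> x) \<partial>lborel) - IK
        = (\<integral>x. (indicator A x - indicator K x) *\<^sub>R cis (z \<bullet> x) \<partial>lborel)"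
      using icis[OF Kb, of 0] icis[OF A(1), of 0] int IK_def by (simp add: scaleR_left_diff_distrib)
    also have "norm \<dots> \<le> (\<integral>x. indicator A x - indicator K x \<partial>lborel)"
    proof (rule Bochner_Integration.integral_norm_bound_integral)
      show "integrable lborel (\<lambda>x. (indicator A x - indicator K x) *\<^sub>R cis (z \<bullet> x))"
        using icis[OF Kb, of 0] icis[OF A(1), of 0] int by (simp add: scaleR_left_diff_distrib)
      show "integrable lborel (\<lambda>x. indicator A x - indicator K x :: real)" using int by simp
    qed (use K(2) in \<open>auto simp: indicator_def\<close>)
    also have "\<dots> = measure lborel A - measure lborel K" using int by simp
    finally have "norm ((\<integral>x. indicator A x *\<^sub>R cis (z \<bullet> x) \<partial>lborel) - IK) < e/4" using AK by simp
    then show ?thesis using IK e norm_triangle_sub[of "\<integral>x. indicator A x *\<^sub>R cis (z \<bullet> x) \<partial>lborel" IK]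
      by (simp add: z_def)
  qed
  then show "\<exists>no. \<forall>n\<ge>no. norm ((\<integral>x. indicator A x *\<^sub>R cis (\<xi> n \<bullet> x) \<partial>lborel) - 0) < e" by auto
qed


section \<open>Smooth test functions and the fundamental lemma of the calculus of variations\<close>

text \<open>The functions \<open>p(1/t) exp(-1/t)\<close> on \<open>t > 0\<close>, extended by \<open>0\<close>. The polynomial makes the family closed
  under differentiation; the constant polynomial \<open>1\<close> gives the standard smooth cut-off.\<close>

definition cutoff :: "real poly \<Rightarrow> real \<Rightarrow> real" where
  "cutoff p t = (if t > 0 then poly p (1/t) * exp (- (1/t)) else 0)"

lemma tendsto_poly_exp_at_top: "((\<lambda>s. poly p s * exp (- s)) \<longlongrightarrow> (0::real)) at_top"
proof -
  have "((\<lambda>s. \<Sum>i\<le>degree p. coeff p i * (s ^ i / exp s)) \<longlongrightarrow> (\<Sum>i\<le>degree p. coeff p i * 0)) at_top"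
    by (intro tendsto_sum tendsto_mult tendsto_const tendsto_power_div_exp_0)
  then show ?thesis
    by (simp add: poly_altdef sum_distrib_right exp_minus divide_inverse mult.assoc)
qed

lemma cutoff_tendsto_0: "(cutoff p \<longlongrightarrow> 0) (at 0)"
proof (rule filterlim_split_at)
  have "\<forall>\<^sub>F t in at_left 0. (0::real) = cutoff p t"
    by (auto simp: eventually_at_filter cutoff_def)
  then show "(cutoff p \<longlongrightarrow> 0) (at_left 0)" by (rule Lim_transform_eventually[OF tendsto_const])
  have "((\<lambda>t. poly p (inverse t) * exp (- inverse t)) \<longlongrightarrow> 0) (at_right 0)"
    by (rule filterlim_compose[OF tendsto_poly_exp_at_top filterlim_inverse_at_top_right])
  moreover have "\<forall>\<^sub>F t in at_right 0. poly p (inverse t) * exp (- inverse t) = cutoff p t"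
    by (auto simp: eventually_at_filter cutoff_def inverse_eq_divide)
  ultimately show "(cutoff p \<longlongrightarrow> 0) (at_right 0)" by (rule Lim_transform_eventually)
qed

text \<open>For \<open>t > 0\<close> the derivative of \<open>p(1/t) exp(-1/t)\<close> is \<open>(p - p')(1/t) exp(-1/t) / t\<^sup>2\<close>. At \<open>0\<close> the
  difference quotient is the cutoff for the polynomial \<open>X p\<close>, which tends to \<open>0\<close>.\<close>

lemma cutoff_has_derivative:
  "(cutoff p has_real_derivative cutoff (monom 1 2 * (p - pderiv p)) t) (at t)"
proof -
  consider "t > 0" | "t < 0" | "t = 0" by linarith
  then show ?thesis
  proof cases
    case 1
    have "((\<lambda>t. poly p (1/t) * exp (- (1/t))) has_real_derivative cutoff (monom 1 2 * (p - pderiv p)) t) (at t)"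
      using 1
      by (auto intro!: derivative_eq_intros poly_DERIV[THEN DERIV_chain2]
          simp: cutoff_def poly_monom field_simps power2_eq_square)
    then show ?thesis
      by (rule has_field_derivative_transform_within_open[of _ _ _ "{0<..}"]) (use 1 in \<open>auto simp: cutoff_def\<close>)
  next
    case 2
    have "((\<lambda>t. 0) has_real_derivative cutoff (monom 1 2 * (p - pderiv p)) t) (at t)"
      using 2 by (simp add: cutoff_def)
    then show ?thesis
      by (rule has_field_derivative_transform_within_open[of _ _ _ "{..<0}"]) (use 2 in \<open>auto simp: cutoff_def\<close>)
  next
    case 3
    have "(\<lambda>h. (cutoff p (0 + h) - cutoff p 0) / h) = cutoff (pCons 0 p)"
      by (auto simp: cutoff_def fun_eq_iff)
    then show ?thesis
      using cutoff_tendsto_0[of "pCons 0 p"] 3 by (simp add: DERIV_def cutoff_def)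
  qed
qed

text \<open>A concrete supply of smooth functions. Being infinitely differentiable is coinductive in nature; it
  holds for every member of a class which consists of differentiable functions and is closed under
  directional derivatives. Sines are covered by the shift \<open>b\<close> in the cosine.\<close>

inductive_set smooth_class :: "('a::euclidean_space \<Rightarrow> real) set" where
  const: "(\<lambda>x. c) \<in> smooth_class"
| cutoff: "(\<lambda>x. cutoff p (a \<bullet> x + b)) \<in> smooth_class"
| trig: "(\<lambda>x. cos (a \<bullet> x + b)) \<in> smooth_class"
| add: "f \<in> smooth_class \<Longrightarrow> g \<in> smooth_class \<Longrightarrow> (\<lambda>x. f x + g x) \<in> smooth_class"
| mult: "f \<in> smooth_class \<Longrightarrow> g \<in> smooth_class \<Longrightarrow> (\<lambda>x. f x * g x) \<in> smooth_class"

lemma smooth_class_prod: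
  "(\<And>i. i \<in> I \<Longrightarrow> f i \<in> smooth_class) \<Longrightarrow> (\<lambda>x. \<Prod>i\<in>I. f i x) \<in> smooth_class"
  by (induction I rule: infinite_finite_induct) (auto intro: smooth_class.intros)

lemma smooth_class_has_derivative:
  fixes f :: "'a::euclidean_space \<Rightarrow> real"
  assumes "f \<in> smooth_class"
  shows "\<exists>D. (\<forall>x. (f has_derivative D x) (at x)) \<and> (\<forall>v. (\<lambda>x. D x v) \<in> smooth_class)"
  using assms
proof (induction rule: smooth_class.induct)
  case (const c)
  show ?case by (intro exI[of _ "\<lambda>x v. 0"]) (auto intro: smooth_class.const)
next
  case (cutoff p a b)
  show ?case
  proof (intro exI[of _ "\<lambda>x v. (a \<bullet> v) * cutoff (monom 1 2 * (p - pderiv p)) (a \<bullet> x + b)"] conjI allI)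
    fix x
    have "((\<lambda>x. a \<bullet> x + b) has_derivative (\<lambda>v. a \<bullet> v)) (at x)"
      by (auto intro!: derivative_eq_intros)
    then show "((\<lambda>x. cutoff p (a \<bullet> x + b)) has_derivative
        (\<lambda>v. (a \<bullet> v) * cutoff (monom 1 2 * (p - pderiv p)) (a \<bullet> x + b))) (at x)"
      using has_derivative_compose[OF _ cutoff_has_derivative[unfolded has_field_derivative_def]]
      by (simp add: mult.commute)
  qed (intro smooth_class.intros)
next
  case (trig a b)
  show ?case
  proof (intro exI[of _ "\<lambda>x v. (a \<bullet> v) * cos (a \<bullet> x + (b + pi/2))"] conjI allI)
    fix x
    have "sin (a \<bullet> x + b) = - cos (a \<bullet> x + (b + pi/2))" using minus_sin_cos_eq[of "a \<bullet> x + b"] by (simp add: add.assoc)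
    then show "((\<lambda>x. cos (a \<bullet> x + b)) has_derivative (\<lambda>v. (a \<bullet> v) * cos (a \<bullet> x + (b + pi/2)))) (at x)"
      by (auto intro!: derivative_eq_intros)
  qed (intro smooth_class.intros)
next
  case (add f g)
  then obtain D E where "\<And>x. (f has_derivative D x) (at x)" "\<And>v. (\<lambda>x. D x v) \<in> smooth_class"
    "\<And>x. (g has_derivative E x) (at x)" "\<And>v. (\<lambda>x. E x v) \<in> smooth_class" by blast
  then show ?case
    by (intro exI[of _ "\<lambda>x v. D x v + E x v"] conjI allI smooth_class.intros has_derivative_add)
next
  case (mult f g)
  then obtain D E where D: "\<And>x. (f has_derivative D x) (at x)" "\<And>v. (\<lambda>x. D x v) \<in> smooth_class"
    and E: "\<And>x. (g has_derivative E x) (at x)" "\<And>v. (\<lambda>x. E x v) \<in> smooth_class" by blast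
  show ?case
    by (intro exI[of _ "\<lambda>x v. f x * E x v + D x v * g x"] conjI allI has_derivative_mult D E)
      (intro smooth_class.intros D E mult.hyps)
qed

lemma smooth_class_times_differentiable:
  "f \<in> smooth_class \<Longrightarrow> times_continuously_differentiable n f"
proof (induction n arbitrary: f)
  case 0
  obtain D where "\<And>x. (f has_derivative D x) (at x)" using smooth_class_has_derivative[OF 0] by blast
  then have "isCont f x" for x by (rule has_derivative_continuous)
  then show ?case by (simp add: continuous_at_imp_continuous_on)
next
  case (Suc n)
  obtain D where D: "\<And>x. (f has_derivative D x) (at x)" "\<And>v. (\<lambda>x. D x v) \<in> smooth_class"
    using smooth_class_has_derivative[OF Suc.prems] by blast
  have "frechet_derivative f (at x) = D x" for x using frechet_derivative_at[OF D(1)] by simp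
  then show ?case using D Suc.IH by (auto simp: differentiable_def)
qed

lemma smooth_class_cutoff_coord:
  "(\<lambda>x::real^'n. cutoff p (c * (x $ i - d))) \<in> smooth_class" 
  "(\<lambda>x::real^'n. cutoff p (c * (d - x $ i))) \<in> smooth_class"
proof -
  have e: "x $ i = axis i 1 \<bullet> x" for x :: "real^'n" by (simp add: inner_axis')
  have "(\<lambda>x::real^'n. cutoff p ((c *\<^sub>R axis i 1) \<bullet> x + (- c * d))) \<in> smooth_class" by (rule smooth_class.cutoff)
  then show "(\<lambda>x::real^'n. cutoff p (c * (x $ i - d))) \<in> smooth_class"
    unfolding e by (simp add: algebra_simps)
  have "(\<lambda>x::real^'n. cutoff p ((- c *\<^sub>R axis i 1) \<bullet> x + c * d)) \<in> smooth_class" by (rule smooth_class.cutoff)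
  then show "(\<lambda>x::real^'n. cutoff p (c * (d - x $ i))) \<in> smooth_class"
    unfolding e by (simp add: algebra_simps)
qed

text \<open>Compressing the argument of the cut-off by the factor \<open>n + 1\<close> amounts to taking the root of that order
  of its values. This keeps the support and sends all positive values to \<open>1\<close>.\<close>

definition box_bump :: "nat \<Rightarrow> real^'n \<Rightarrow> real^'n \<Rightarrow> real^'n \<Rightarrow> real" where
  "box_bump n a b x = (\<Prod>i\<in>UNIV. cutoff 1 (real (Suc n) * (x $ i - a $ i)) * cutoff 1 (real (Suc n) * (b $ i - x $ i)))"

lemma box_bump_smooth: "box_bump n a b \<in> smooth_class"
  unfolding box_bump_def [abs_def]
  by (intro smooth_class_prod smooth_class.mult smooth_class_cutoff_coord)

lemma cutoff_1_bounds: "0 \<le> cutoff 1 t" "cutoff 1 t \<le> 1" "cutoff 1 t \<noteq> 0 \<longleftrightarrow> t > 0"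
  by (auto simp: cutoff_def)

lemma cutoff_1_tendsto: "(\<lambda>n. cutoff 1 (real (Suc n) * t)) \<longlonglongrightarrow> (if t > 0 then 1 else 0)"
proof (cases "t > 0")
  case True
  have "(\<lambda>n. exp (- (1/t) * inverse (real (Suc n)))) \<longlonglongrightarrow> exp (- (1/t) * 0)"
    by (intro tendsto_intros LIMSEQ_inverse_real_of_nat)
  moreover have "cutoff 1 (real (Suc n) * t) = exp (- (1/t) * inverse (real (Suc n)))" for n
  proof -
    have "0 < real (Suc n) * t" using True by (intro mult_pos_pos) auto
    then show ?thesis using True by (simp add: cutoff_def divide_simps del: of_nat_Suc)
  qed
  ultimately show ?thesis using True by simp
next
  case False
  then have "cutoff 1 (real (Suc n) * t) = 0" for n
    unfolding cutoff_def using mult_nonneg_nonpos[of "real (Suc n)" t] by auto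
  then show ?thesis using False by simp
qed

lemma box_bump_bounds: "0 \<le> box_bump n a b x" "box_bump n a b x \<le> 1"
  unfolding box_bump_def
  by (auto intro!: prod_nonneg prod_le_1 mult_le_one simp: cutoff_1_bounds)

lemma box_bump_nonzero: "box_bump n a b x \<noteq> 0 \<Longrightarrow> x \<in> box a b"
  by (auto simp: box_bump_def mem_box_cart cutoff_1_bounds zero_less_mult_iff)

lemma box_bump_tendsto: "(\<lambda>n. box_bump n a b x) \<longlonglongrightarrow> indicator (box a b) x"
proof -
  have "(\<lambda>n. box_bump n a b x) \<longlonglongrightarrow>
      (\<Prod>i\<in>UNIV. (if x $ i - a $ i > 0 then 1 else 0) * (if b $ i - x $ i > 0 then 1 else 0))"
    unfolding box_bump_def by (intro tendsto_prod tendsto_mult cutoff_1_tendsto)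
  also have "(\<Prod>i\<in>UNIV. (if x $ i - a $ i > 0 then 1 else 0) * (if b $ i - x $ i > 0 then 1 else 0))
      = (indicator (box a b) x :: real)"
  proof (cases "x \<in> box a b")
    case True
    then show ?thesis by (auto simp: mem_box_cart intro!: prod.neutral)
  next
    case False
    then obtain i where "\<not> (x $ i - a $ i > 0) \<or> \<not> (b $ i - x $ i > 0)" by (auto simp: mem_box_cart)
    then show ?thesis using False by (auto intro!: prod_zero bexI[of _ i])
  qed
  finally show ?thesis .
qed

text \<open>If \<open>\<rho>\<^sub>S\<close> are bumps for the boxes \<open>S\<close>, then \<open>1 - \<Prod>(1 - \<rho>\<^sub>S)\<close> approximates the indicator of
  the union of the boxes, however they overlap.\<close>

lemma test_functions_approximate_box_union:
  assumes "A \<in> box_unions \<Omega>"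
  obtains \<psi> where "\<And>n. \<psi> n \<in> test_functions \<Omega>" "\<And>n x. \<bar>\<psi> n x\<bar> \<le> 1" "\<And>x. (\<lambda>n. \<psi> n x) \<longlonglongrightarrow> indicator A x"
    "\<And>n. \<psi> n \<in> smooth_class"
proof -
  obtain F where F: "A = \<Union>F" "finite F" "F \<subseteq> rational_boxes_in \<Omega>"
    using assms by (auto simp: box_unions_def)
  have "\<forall>S\<in>F. \<exists>a b. S = box a b \<and> cbox a b \<subseteq> \<Omega>"
    using F(3) unfolding rational_boxes_in_def by blast
  then obtain a b where ab: "\<And>S. S \<in> F \<Longrightarrow> S = box (a S) (b S)" "\<And>S. S \<in> F \<Longrightarrow> cbox (a S) (b S) \<subseteq> \<Omega>"
    by metis
  define \<psi> where "\<psi> n x = 1 + (-1) * (\<Prod>S\<in>F. 1 + (-1) * box_bump n (a S) (b S) x)" for n x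
  have smooth: "\<psi> n \<in> smooth_class" for n
    unfolding \<psi>_def[abs_def] by (intro smooth_class.intros smooth_class_prod box_bump_smooth)
  have supp: "{x. \<psi> n x \<noteq> 0} \<subseteq> (\<Union>S\<in>F. cbox (a S) (b S))" for n
  proof
    fix x assume "x \<in> {x. \<psi> n x \<noteq> 0}"
    then have "\<exists>S\<in>F. box_bump n (a S) (b S) x \<noteq> 0"
      unfolding \<psi>_def by (auto intro!: prod.neutral)
    then obtain S where "S \<in> F" "box_bump n (a S) (b S) x \<noteq> 0" by blast
    then show "x \<in> (\<Union>S\<in>F. cbox (a S) (b S))"
      using box_bump_nonzero[of n "a S" "b S" x] box_subset_cbox[of "a S" "b S"] by auto
  qed
  have cl: "closure {x. \<psi> n x \<noteq> 0} \<subseteq> (\<Union>S\<in>F. cbox (a S) (b S))" for n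
    using F(2) by (intro closure_minimal supp closed_UN ballI) auto
  have "\<psi> n \<in> test_functions \<Omega>" for n
  proof -
    have "bounded {x. \<psi> n x \<noteq> 0}"
      by (rule bounded_subset[OF _ supp]) (use F(2) in \<open>auto intro!: bounded_UN\<close>)
    moreover have "(\<Union>S\<in>F. cbox (a S) (b S)) \<subseteq> \<Omega>" using ab(2) by blast
    ultimately show ?thesis
      unfolding test_functions_def
      using smooth_class_times_differentiable[OF smooth] cl[of n] by (auto simp: compact_closure)
  qed
  moreover have "\<bar>\<psi> n x\<bar> \<le> 1" for n x
  proof -
    have "0 \<le> (\<Prod>S\<in>F. 1 + (-1) * box_bump n (a S) (b S) x)" "(\<Prod>S\<in>F. 1 + (-1) * box_bump n (a S) (b S) x) \<le> 1"
      using box_bump_bounds[of n _ _ x] by (intro prod_nonneg prod_le_1 ballI; simp)+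
    then show ?thesis unfolding \<psi>_def by linarith
  qed
  moreover have "(\<lambda>n. \<psi> n x) \<longlonglongrightarrow> indicator A x" for x
  proof -
    have "(\<lambda>n. \<psi> n x) \<longlonglongrightarrow> 1 + (-1) * (\<Prod>S\<in>F. 1 + (-1) * indicator (box (a S) (b S)) x)"
      unfolding \<psi>_def by (intro tendsto_intros box_bump_tendsto)
    also have "1 + (-1) * (\<Prod>S\<in>F. 1 + (-1) * indicator (box (a S) (b S)) x) = (indicator A x :: real)"
    proof (cases "x \<in> A")
      case True
      then obtain S where "S \<in> F" "x \<in> S" using F by auto
      then have "(\<Prod>S\<in>F. 1 + (-1) * indicator (box (a S) (b S)) x) = (0::real)"
        using ab(1)[of S] F(2) by (intro prod_zero bexI[of _ S]) auto
      then show ?thesis using True by simp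
    next
      case False
      then have "(\<Prod>S\<in>F. 1 + (-1) * indicator (box (a S) (b S)) x) = (1::real)"
        using ab(1) F(1) by (intro prod.neutral) (auto simp: indicator_def)
      then show ?thesis using False by simp
    qed
    finally show ?thesis .
  qed
  ultimately show ?thesis using that smooth by blast
qed

lemma square_integrable_bounded_function:
  assumes "S \<in> lmeasurable" "f \<in> borel_measurable (lebesgue_on S)" "\<And>x. x \<in> S \<Longrightarrow> \<bar>f x\<bar> \<le> B"
  shows "square_integrable (lebesgue_on S) f"
proof (rule square_integrable_bound)
  have fm: "finite_measure (lebesgue_on S)" by (rule finite_measure_lebesgue_on[OF assms(1)])
  show "square_integrable (lebesgue_on S) (\<lambda>x. B)"
    by (rule square_integrableI) (auto intro: finite_measure.integrable_const[OF fm])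
  show "AE x in lebesgue_on S. \<bar>f x\<bar> \<le> \<bar>B\<bar>"
    using assms(3) by (intro AE_I2) (auto intro: order.trans[OF _ abs_ge_self])
qed (rule assms(2))

lemma integral_indicator_diff_square:
  assumes "\<Omega> \<in> lmeasurable" "A \<in> lmeasurable" "B \<in> lmeasurable" "A \<subseteq> \<Omega>" "B \<subseteq> \<Omega>"
  shows "square_integrable (lebesgue_on \<Omega>) (\<lambda>x. indicator A x - indicator B x)"
    and "(\<integral>x. (indicator A x - indicator B x :: real)\<^sup>2 \<partial>lebesgue_on \<Omega>) = measure lebesgue ((A - B) \<union> (B - A))"
proof -
  show "square_integrable (lebesgue_on \<Omega>) (\<lambda>x. indicator A x - indicator B x)"
  proof (rule square_integrable_bounded_function[OF assms(1), where B = 1])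
    have "indicator A \<in> borel_measurable lebesgue" "indicator B \<in> borel_measurable lebesgue"
      using assms by auto
    then show "(\<lambda>x. indicator A x - indicator B x :: real) \<in> borel_measurable (lebesgue_on \<Omega>)"
      by (intro borel_measurable_diff measurable_restrict_space1) auto
  qed (auto simp: indicator_def)
  have s: "(A - B) \<union> (B - A) \<in> sets lebesgue" using assms by auto
  have "(\<integral>x. (indicator A x - indicator B x :: real)\<^sup>2 \<partial>lebesgue_on \<Omega>)
      = (\<integral>x. indicator ((A - B) \<union> (B - A)) x \<partial>lebesgue_on \<Omega>)"
    by (intro Bochner_Integration.integral_cong) (auto simp: indicator_def power2_eq_square)
  also have "\<dots> = measure (lebesgue_on \<Omega>) ((A - B) \<union> (B - A))"
    using assms by (auto intro!: Int_absorb2 arg_cong[of _ _ "measure (lebesgue_on \<Omega>)"])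
  also have "\<dots> = measure lebesgue ((A - B) \<union> (B - A))"
    using assms by (intro measure_restrict_space) auto
  finally show "(\<integral>x. (indicator A x - indicator B x :: real)\<^sup>2 \<partial>lebesgue_on \<Omega>) = measure lebesgue ((A - B) \<union> (B - A))" .
qed

text \<open>Bumps transfer the orthogonality to finite unions of boxes. These approximate every measurable
  subset of \<open>\<Omega>\<close> in measure, and Cauchy--Schwarz controls the error since \<open>f\<close> is square integrable. The
  sets where \<open>f\<close> is positive or negative then have measure zero.\<close>

lemma fundamental_lemma_variations:
  fixes \<Omega> :: "(real^'n) set"
  assumes "open \<Omega>" "bounded \<Omega>" and f: "square_integrable (lebesgue_on \<Omega>) f"
    and orth: "\<And>\<psi>. \<psi> \<in> test_functions \<Omega> \<Longrightarrow> \<psi> \<in> smooth_class \<Longrightarrow> (\<integral>x. f x * \<psi> x \<partial>lebesgue_on \<Omega>) = 0"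
  shows "AE x in lebesgue_on \<Omega>. f x = 0"
proof -
  have \<Omega>: "\<Omega> \<in> lmeasurable" using assms by (auto intro: lmeasurable_open)
  have fm: "f \<in> borel_measurable (lebesgue_on \<Omega>)" using f by (simp add: square_integrable_def)
  have one: "square_integrable (lebesgue_on \<Omega>) (\<lambda>x. 1)"
    by (rule square_integrable_bounded_function[OF \<Omega>, where B = 1]) auto
  have fint: "integrable (lebesgue_on \<Omega>) f" using square_integrable_mult[OF f one] by simp
  have ind: "(indicator E :: _ \<Rightarrow> real) \<in> borel_measurable (lebesgue_on \<Omega>)" if "E \<in> lmeasurable" for E :: "(real^'n) set"
    using that by (intro measurable_restrict_space1) auto
  have sind: "square_integrable (lebesgue_on \<Omega>) (indicator E :: _ \<Rightarrow> real)" if "E \<in> lmeasurable" for E :: "(real^'n) set"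
    using ind[OF that] by (intro square_integrable_bounded_function[OF \<Omega>, where B = 1]) auto
  have boxes: "(\<integral>x. f x * indicator A x \<partial>lebesgue_on \<Omega>) = 0" if A: "A \<in> box_unions \<Omega>" for A
  proof -
    obtain \<psi> where \<psi>: "\<And>n. \<psi> n \<in> test_functions \<Omega>" "\<And>n x. \<bar>\<psi> n x\<bar> \<le> 1"
      "\<And>x. (\<lambda>n. \<psi> n x) \<longlonglongrightarrow> indicator A x" "\<And>n. \<psi> n \<in> smooth_class"
      using test_functions_approximate_box_union[OF A] by blast
    have "(\<lambda>n. \<integral>x. f x * \<psi> n x \<partial>lebesgue_on \<Omega>) \<longlonglongrightarrow> (\<integral>x. f x * indicator A x \<partial>lebesgue_on \<Omega>)"
    proof (rule integral_dominated_convergence[where w = "\<lambda>x. \<bar>f x\<bar>"])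
      have "continuous_on UNIV (\<psi> n)" for n
        using smooth_class_times_differentiable[OF \<psi>(4), of 0] by simp
      then have "\<psi> n \<in> borel_measurable (lebesgue_on \<Omega>)" for n
        by (intro measurable_restrict_space1 measurable_completion) (simp add: borel_measurable_continuous_onI)
      then show "(\<lambda>x. f x * \<psi> n x) \<in> borel_measurable (lebesgue_on \<Omega>)" for n using fm by simp
      show "(\<lambda>x. f x * indicator A x) \<in> borel_measurable (lebesgue_on \<Omega>)"
        using fm ind[OF box_unionsD(5)[OF A]] by simp
      show "AE x in lebesgue_on \<Omega>. (\<lambda>n. f x * \<psi> n x) \<longlonglongrightarrow> f x * indicator A x"
        by (intro AE_I2 tendsto_intros \<psi>)
      show "AE x in lebesgue_on \<Omega>. norm (f x * \<psi> n x) \<le> \<bar>f x\<bar>" for n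
        using \<psi>(2) by (intro AE_I2) (auto simp: abs_mult intro!: mult_left_le)
    qed (use fint in simp)
    then show ?thesis using orth[OF \<psi>(1,4)] by (simp add: LIMSEQ_const_iff)
  qed
  have meas: "(\<integral>x. f x * indicator E x \<partial>lebesgue_on \<Omega>) = 0" if E: "E \<in> lmeasurable" "E \<subseteq> \<Omega>" for E
  proof -
    define N where "N = (\<integral>x. (f x)\<^sup>2 \<partial>lebesgue_on \<Omega>)"
    have N0: "N \<ge> 0" by (simp add: N_def)
    have "(\<integral>x. f x * indicator E x \<partial>lebesgue_on \<Omega>)\<^sup>2 \<le> N * e" if e: "e > 0" for e
    proof -
      obtain A where A: "A \<in> box_unions \<Omega>" "measure lebesgue ((E - A) \<union> (A - E)) < e"
        using box_unions_dense[OF assms(1) E e] by blast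
      note Am = box_unionsD(5)[OF A(1)] and As = box_unionsD(2)[OF A(1)]
      have "(\<integral>x. f x * indicator E x \<partial>lebesgue_on \<Omega>)
          = (\<integral>x. f x * (indicator E x - indicator A x) \<partial>lebesgue_on \<Omega>)"
        using boxes[OF A(1)] square_integrable_mult[OF f sind[OF E(1)]] square_integrable_mult[OF f sind[OF Am]]
        by (simp add: right_diff_distrib)
      also have "\<dots>\<^sup>2 \<le> N * (\<integral>x. (indicator E x - indicator A x)\<^sup>2 \<partial>lebesgue_on \<Omega>)"
        unfolding N_def by (rule Cauchy_Schwarz_integral[OF f integral_indicator_diff_square(1)[OF \<Omega> E(1) Am E(2) As]])
      also have "\<dots> \<le> N * e"
        using A(2) N0 integral_indicator_diff_square(2)[OF \<Omega> E(1) Am E(2) As] by (intro mult_left_mono) auto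
      finally show ?thesis .
    qed
    then have "(\<integral>x. f x * indicator E x \<partial>lebesgue_on \<Omega>)\<^sup>2 \<le> 0 + d" if "d > 0" for d
    proof -
      have "(\<integral>x. f x * indicator E x \<partial>lebesgue_on \<Omega>)\<^sup>2 \<le> N * (d / (N + 1))"
        using that N0 \<open>\<And>e. e > 0 \<Longrightarrow> (\<integral>x. f x * indicator E x \<partial>lebesgue_on \<Omega>)\<^sup>2 \<le> N * e\<close>[of "d / (N + 1)"] by simp
      also have "\<dots> \<le> d" using that N0 by (simp add: field_simps)
      finally show ?thesis by simp
    qed
    then have "(\<integral>x. f x * indicator E x \<partial>lebesgue_on \<Omega>)\<^sup>2 \<le> 0" by (rule field_le_epsilon)
    then show ?thesis by simp
  qed
  have half: "AE x in lebesgue_on \<Omega>. g x \<le> (0::real)"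
    if g: "g \<in> borel_measurable (lebesgue_on \<Omega>)" "integrable (lebesgue_on \<Omega>) g"
      and z: "\<And>E. E \<in> lmeasurable \<Longrightarrow> E \<subseteq> \<Omega> \<Longrightarrow> (\<integral>x. g x * indicator E x \<partial>lebesgue_on \<Omega>) = 0" for g
  proof -
    define E where "E = {x \<in> \<Omega>. g x > 0}"
    have "{x \<in> space (lebesgue_on \<Omega>). g x > 0} \<in> sets (lebesgue_on \<Omega>)" using g(1) by measurable
    then have "E \<in> sets lebesgue" using \<Omega> by (auto simp: E_def sets_restrict_space_iff)
    then have E: "E \<in> lmeasurable" "E \<subseteq> \<Omega>" using \<Omega> by (auto simp: E_def intro: fmeasurableI2)
    have "AE x in lebesgue_on \<Omega>. g x * indicator E x = 0"
    proof (subst integral_nonneg_eq_0_iff_AE[symmetric])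
      show "integrable (lebesgue_on \<Omega>) (\<lambda>x. g x * indicator E x)"
        by (rule Bochner_Integration.integrable_bound[OF g(2) borel_measurable_times[OF g(1) ind[OF E(1)]]])
          (auto simp: indicator_def)
      show "AE x in lebesgue_on \<Omega>. 0 \<le> g x * indicator E x"
        by (intro AE_I2) (auto simp: E_def indicator_def)
    qed (rule z[OF E])
    with AE_space show ?thesis
    proof eventually_elim
      case (elim x)
      then show ?case by (cases "g x > 0") (simp_all add: E_def)
    qed
  qed
  have "AE x in lebesgue_on \<Omega>. f x \<le> 0" by (rule half[OF fm fint meas])
  moreover have "AE x in lebesgue_on \<Omega>. - f x \<le> 0"
    by (rule half) (use fm fint meas in auto)
  ultimately show ?thesis by eventually_elim simp
qed


section \<open>Periodic continuous functions and trigonometric polynomials\<close>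

lemma C_per_apply: "f \<in> C_per \<Longrightarrow> apply_bcontfun f (y + real_vec k) = apply_bcontfun f y"
  by (simp add: C_per_def periodic_def)

lemma C_per_add: "f \<in> C_per \<Longrightarrow> g \<in> C_per \<Longrightarrow> f + g \<in> C_per"
  and C_per_scaleR: "f \<in> C_per \<Longrightarrow> c *\<^sub>R f \<in> C_per"
  and C_per_diff: "f \<in> C_per \<Longrightarrow> g \<in> C_per \<Longrightarrow> f - g \<in> C_per"
  and C_per_zero: "0 \<in> C_per"
  by (auto simp: C_per_def periodic_def)

lemma subspace_C_per: "subspace C_per"
  by (auto simp: subspace_def C_per_add C_per_scaleR C_per_zero)

lemma real_vec_axis: "real_vec (axis i 1) = axis i 1"
  by (simp add: real_vec_def axis_def vec_eq_iff)

lemma real_vec_inner: "real_vec k \<bullet> real_vec l = of_int (\<Sum>i\<in>UNIV. k $ i * l $ i)"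
  by (simp add: real_vec_def inner_vec_def)

lemma real_vec_0 [simp]: "real_vec 0 = 0"
  by (simp add: real_vec_def vec_eq_iff)

lemma cos_add_int_2pi: "cos (x + 2 * pi * of_int n) = cos x"
  and sin_add_int_2pi: "sin (x + 2 * pi * of_int n) = sin x"
  unfolding cos_add sin_add cos_int_2pin sin_int_2pin by simp_all

definition frac_vec :: "real^'m \<Rightarrow> real^'m" where
  "frac_vec y = (\<chi> i. frac (y $ i))"

lemma frac_vec_decomp: "y = frac_vec y + real_vec (\<chi> i. \<lfloor>y $ i\<rfloor>)"
  by (simp add: frac_vec_def real_vec_def vec_eq_iff frac_def)

lemma frac_vec_in_cbox: "frac_vec y \<in> cbox 0 (\<chi> i. 1)"
  using frac_ge_0 frac_lt_1 by (auto simp: frac_vec_def mem_box_cart intro: less_imp_le)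

lemma frac_vec_cell: "y \<in> cell \<Longrightarrow> frac_vec y = y"
  by (auto simp: cell_def mem_box_cart frac_vec_def vec_eq_iff frac_eq less_imp_le)

lemma periodic_frac_vec: "periodic (\<lambda>y. f (frac_vec y))"
  unfolding periodic_def
  by (auto simp: frac_vec_def real_vec_def frac_def intro!: arg_cong[of _ _ f])

text \<open>Phase \<open>0\<close> gives the cosine and phase \<open>- \<pi>/2\<close> the sine of frequency \<open>k\<close>. Allowing all phases
  makes derivatives and products of waves easy to write.\<close>

definition wave :: "int^'m \<Rightarrow> real \<Rightarrow> (real^'m) \<Rightarrow>\<^sub>C real" where
  "wave k b = Bcontfun (\<lambda>y. cos (2 * pi * (real_vec k \<bullet> y) + b))"

lemma apply_wave [simp]: "apply_bcontfun (wave k b) y = cos (2 * pi * (real_vec k \<bullet> y) + b)"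
proof -
  have "(\<lambda>y. cos (2 * pi * (real_vec k \<bullet> y) + b)) \<in> bcontfun"
    by (rule bcontfun_normI[where b = 1]) (auto intro!: continuous_intros)
  then show ?thesis by (simp add: wave_def Bcontfun_inverse)
qed

lemma wave_in_C_per: "wave k b \<in> C_per"
proof -
  have "cos (2 * pi * (real_vec k \<bullet> (y + real_vec l)) + b) = cos (2 * pi * (real_vec k \<bullet> y) + b)" for y l
  proof -
    have "2 * pi * (real_vec k \<bullet> (y + real_vec l)) + b
        = (2 * pi * (real_vec k \<bullet> y) + b) + 2 * pi * of_int (\<Sum>i\<in>UNIV. k $ i * l $ i)"
      unfolding inner_add_right real_vec_inner by (simp add: algebra_simps)
    then show ?thesis by (simp only: cos_add_int_2pi)
  qed
  then show ?thesis by (simp add: C_per_def periodic_def)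
qed

definition waves :: "((real^'m) \<Rightarrow>\<^sub>C real) set" where
  "waves = range (\<lambda>k. wave k 0) \<union> range (\<lambda>k. wave k (- (pi/2)))"

lemma countable_waves: "countable waves"
  unfolding waves_def by (intro countable_Un countable_image countableI_type)

lemma waves_C_per: "waves \<subseteq> C_per"
  by (auto simp: waves_def wave_in_C_per)

abbreviation trig_polys :: "((real^'m) \<Rightarrow>\<^sub>C real) set" where
  "trig_polys \<equiv> span waves"

lemma wave_in_trig_polys: "wave k b \<in> trig_polys"
proof -
  have "wave k b = cos b *\<^sub>R wave k 0 + (- sin b) *\<^sub>R wave k (- (pi/2))"
    by (rule bcontfun_eqI) (simp add: cos_add cos_diff mult.commute)
  moreover have "wave k 0 \<in> trig_polys" "wave k (- (pi/2)) \<in> trig_polys"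
    by (auto intro!: span_base simp: waves_def)
  ultimately show ?thesis by (metis span_add span_scale)
qed

lemma trig_polys_subset_C_per: "trig_polys \<subseteq> C_per"
  using span_minimal[OF waves_C_per subspace_C_per] .

lemma waves_mult:
  assumes "f \<in> waves" "g \<in> waves"
  shows "\<exists>h\<in>trig_polys. \<forall>y. apply_bcontfun h y = apply_bcontfun f y * apply_bcontfun g y"
proof -
  obtain k a l b where fg: "f = wave k a" "g = wave l b" using assms by (auto simp: waves_def)
  let ?h = "(1/2) *\<^sub>R wave (k - l) (a - b) + (1/2) *\<^sub>R wave (k + l) (a + b)"
  have "?h \<in> trig_polys" by (intro span_add span_scale wave_in_trig_polys)
  moreover have "apply_bcontfun ?h y = apply_bcontfun f y * apply_bcontfun g y" for y
  proof -
    have e: "real_vec (k - l) = real_vec k - real_vec l" "real_vec (k + l) = real_vec k + real_vec l"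
      by (simp_all add: real_vec_def vec_eq_iff)
    show ?thesis
      by (simp add: fg cos_times_cos e inner_diff_left inner_add_left algebra_simps add_divide_distrib)
  qed
  ultimately show ?thesis by blast
qed

lemma trig_polys_mult:
  fixes f g :: "(real^'m) \<Rightarrow>\<^sub>C real"
  assumes "f \<in> trig_polys" "g \<in> trig_polys"
  shows "\<exists>h\<in>trig_polys. \<forall>y. apply_bcontfun h y = apply_bcontfun f y * apply_bcontfun g y"
proof -
  define P where "P f g \<longleftrightarrow> (\<exists>h\<in>trig_polys. \<forall>y. apply_bcontfun h y = apply_bcontfun f y * apply_bcontfun g y)"
    for f g :: "(real^'m) \<Rightarrow>\<^sub>C real"
  have comm: "P f g \<Longrightarrow> P g f" for f g by (auto simp: P_def mult.commute)
  have lin: "subspace {f. P f g}" for g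
    unfolding subspace_def
  proof (intro conjI ballI allI; clarsimp simp: P_def)
    show "\<exists>h\<in>trig_polys. \<forall>y. apply_bcontfun h y = 0" by (rule bexI[of _ 0]) (auto intro: span_zero)
  next
    fix x y h i assume "h \<in> trig_polys" "\<forall>z. apply_bcontfun h z = apply_bcontfun x z * apply_bcontfun g z"
      "i \<in> trig_polys" "\<forall>z. apply_bcontfun i z = apply_bcontfun y z * apply_bcontfun g z"
    then show "\<exists>h\<in>trig_polys. \<forall>z. apply_bcontfun h z = (apply_bcontfun x z + apply_bcontfun y z) * apply_bcontfun g z"
      by (intro bexI[of _ "h + i"]) (auto simp: distrib_right intro: span_add)
  next
    fix c x h assume "h \<in> trig_polys" "\<forall>z. apply_bcontfun h z = apply_bcontfun x z * apply_bcontfun g z"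
    then show "\<exists>h\<in>trig_polys. \<forall>z. apply_bcontfun h z = c * apply_bcontfun x z * apply_bcontfun g z"
      by (intro bexI[of _ "c *\<^sub>R h"]) (auto intro: span_scale)
  qed
  have 1: "P f g" if "g \<in> waves" "f \<in> trig_polys" for f g
    using that(2) by (induction rule: span_induct) (use lin waves_mult that(1) in \<open>auto simp: P_def\<close>)
  have "P g f" if "g \<in> trig_polys" "f \<in> trig_polys" for f g
    using that(1) by (induction rule: span_induct) (use lin comm 1 that(2) in auto)
  then show ?thesis using assms by (auto simp: P_def)
qed

lemma trig_poly_const: "\<exists>h\<in>trig_polys. \<forall>y. apply_bcontfun h y = c"
proof (rule bexI[of _ "c *\<^sub>R wave 0 0"])
  show "c *\<^sub>R wave 0 0 \<in> trig_polys" by (intro span_scale wave_in_trig_polys)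
  show "\<forall>y. apply_bcontfun (c *\<^sub>R wave 0 0) y = c" by simp
qed

text \<open>The torus as a compact subset of \<open>\<complex>\<^sup>m\<close>: there the polynomials separate points, as the
  Stone--Weierstrass theorem requires. On the closed cell itself periodic functions do not separate
  opposite faces.\<close>

definition torus_map :: "real^'m \<Rightarrow> complex^'m" where
  "torus_map y = (\<chi> i. cis (2 * pi * y $ i))"

lemma continuous_torus_map: "continuous_on S torus_map"
  unfolding torus_map_def by (intro continuous_intros)

lemma torus_map_eq_imp_translate:
  assumes "torus_map x = torus_map y"
  obtains k where "x = y + real_vec k"
proof -
  have "\<exists>n::int. x $ i = y $ i + of_int n" for i
  proof -
    have "cis (2 * pi * x $ i) = cis (2 * pi * y $ i)"
      using assms by (auto simp: torus_map_def vec_eq_iff)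
    then have "sin (2 * pi * x $ i) = sin (2 * pi * y $ i)" "cos (2 * pi * x $ i) = cos (2 * pi * y $ i)"
      by (auto simp: complex_eq_iff)
    then obtain n where "2 * pi * x $ i = 2 * pi * y $ i + 2 * pi * of_int n"
      using sin_cos_eq_iff by blast
    then have "2 * pi * (x $ i) = 2 * pi * (y $ i + of_int n)" by (simp add: algebra_simps)
    then show ?thesis by (intro exI[of _ n]) simp
  qed
  then obtain n where "\<And>i. x $ i = y $ i + of_int (n i)" by metis
  then have "x = y + real_vec (\<chi> i. n i)" by (simp add: vec_eq_iff real_vec_def)
  then show ?thesis using that by blast
qed

lemma torus_map_translate: "torus_map (y + real_vec k) = torus_map y"
proof -
  have "2 * pi * (y + real_vec k) $ i = 2 * pi * y $ i + 2 * pi * of_int (k $ i)" for i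
    by (simp add: real_vec_def algebra_simps)
  then show ?thesis
    by (simp add: torus_map_def vec_eq_iff complex_eq_iff cos_add_int_2pi sin_add_int_2pi del: vector_add_component)
qed

lemma polynomial_on_torus_is_trig_poly:
  fixes p :: "complex^'m \<Rightarrow> real"
  assumes "real_polynomial_function p"
  shows "\<exists>h\<in>trig_polys. \<forall>y. apply_bcontfun h y = p (torus_map y)"
  using assms
proof (induction rule: real_polynomial_function.induct)
  case (linear f)
  interpret bounded_linear f by fact
  let ?h = "\<Sum>i\<in>UNIV. f (axis i 1) *\<^sub>R wave (axis i 1) 0 + f (axis i \<i>) *\<^sub>R wave (axis i 1) (- (pi/2))"
  have "apply_bcontfun ?h y = f (torus_map y)" for y
  proof -
    have c: "cis t = cos t *\<^sub>R 1 + sin t *\<^sub>R \<i>" for t by (simp add: complex_eq_iff)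
    have ax: "axis i (a *\<^sub>R z) = a *\<^sub>R axis i z" "axis i (z + w) = axis i z + axis i w"
      for i :: 'm and a and z w :: complex
      by (auto simp: axis_def vec_eq_iff)
    have "torus_map y = (\<Sum>i\<in>UNIV. axis i (torus_map y $ i))"
      by (simp add: vec_eq_iff axis_def if_distrib[of "\<lambda>f. f _"] cong: if_cong)
    then have "f (torus_map y) = (\<Sum>i\<in>UNIV. f (axis i (cis (2 * pi * y $ i))))"
      by (metis (no_types, lifting) sum sum.cong torus_map_def vec_lambda_beta)
    also have "\<dots> = (\<Sum>i\<in>UNIV. cos (2 * pi * y $ i) * f (axis i 1) + sin (2 * pi * y $ i) * f (axis i \<i>))"
      unfolding c ax add scaleR by simp
    also have "\<dots> = (\<Sum>i\<in>UNIV. apply_bcontfun (f (axis i 1) *\<^sub>R wave (axis i 1) 0 + f (axis i \<i>) *\<^sub>R wave (axis i 1) (- (pi/2))) y)"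
      by (simp add: real_vec_axis inner_axis' cos_diff mult.commute)
    also have "\<dots> = apply_bcontfun ?h y"
    proof -
      have "apply_bcontfun (\<Sum>i\<in>I. F i) y = (\<Sum>i\<in>I. apply_bcontfun (F i) y)" if "finite I" for I and F :: "'m \<Rightarrow> (real^'m) \<Rightarrow>\<^sub>C real"
        using that by (induction I rule: finite_induct) auto
      then show ?thesis by simp
    qed
    finally show ?thesis by simp
  qed
  moreover have "?h \<in> trig_polys"
    by (intro span_sum span_add span_scale wave_in_trig_polys)
  ultimately show ?case by blast
next
  case (const c)
  show ?case by (rule trig_poly_const)
next
  case (add f g)
  then obtain h i where "h \<in> trig_polys" "\<And>y. apply_bcontfun h y = f (torus_map y)"
    "i \<in> trig_polys" "\<And>y. apply_bcontfun i y = g (torus_map y)" by blast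
  then show ?case by (intro bexI[of _ "h + i"]) (auto intro: span_add)
next
  case (mult f g)
  then obtain h i where "h \<in> trig_polys" "\<And>y. apply_bcontfun h y = f (torus_map y)"
    "i \<in> trig_polys" "\<And>y. apply_bcontfun i y = g (torus_map y)" by blast
  then show ?case using trig_polys_mult[of h i] by auto
qed

text \<open>A periodic function is a continuous function on the torus, where Stone--Weierstrass provides a
  polynomial in the coordinates \<open>exp(2 \<pi> \<i> y\<^sub>i)\<close> near it. Such a polynomial is a trigonometric
  polynomial in \<open>y\<close>.\<close>

theorem trig_polys_dense:
  fixes f :: "(real^'m) \<Rightarrow>\<^sub>C real"
  assumes f: "f \<in> C_per" and e: "e > 0"
  obtains h where "h \<in> trig_polys" "norm (f - h) \<le> e"
proof -
  define Q where "Q = (cbox 0 (\<chi> i. 1) :: (real^'m) set)"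
  define K where "K = torus_map ` Q"
  have "compact K" unfolding K_def Q_def by (intro compact_continuous_image continuous_torus_map compact_cbox)
  define g where "g z = apply_bcontfun f (SOME y. torus_map y = z)" for z
  have gf: "g (torus_map y) = apply_bcontfun f y" for y
  proof -
    have "torus_map (SOME x. torus_map x = torus_map y) = torus_map y" by (rule someI[of _ y]) simp
    then obtain k where "(SOME x. torus_map x = torus_map y) = y + real_vec k"
      by (rule torus_map_eq_imp_translate)
    then show ?thesis unfolding g_def by (simp add: C_per_apply[OF f])
  qed
  \<comment> \<open>The torus map is a quotient map because it is a continuous map from a compact set.\<close>
  have "continuous_on K g"
    unfolding continuous_on_closed_invariant
  proof (intro allI impI)
    fix B :: "real set" assume "closed B"
    let ?A = "torus_map ` (apply_bcontfun f -` B \<inter> Q)"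
    have "closed (apply_bcontfun f -` B)"
      using \<open>closed B\<close> by (intro closed_vimage) auto
    then have "compact (apply_bcontfun f -` B \<inter> Q)" unfolding Q_def by (intro closed_Int_compact compact_cbox)
    then have "closed ?A" by (intro compact_imp_closed compact_continuous_image continuous_torus_map)
    moreover have "?A \<inter> K = g -` B \<inter> K"
      using gf by (auto simp: K_def)
    ultimately show "\<exists>A. closed A \<and> A \<inter> K = g -` B \<inter> K" by blast
  qed
  then obtain p where p: "real_polynomial_function p" "\<And>z. z \<in> K \<Longrightarrow> \<bar>g z - p z\<bar> < e"
    using Stone_Weierstrass_real_polynomial_function[OF \<open>compact K\<close> _ e] by blast
  obtain h where h: "h \<in> trig_polys" "\<And>y. apply_bcontfun h y = p (torus_map y)"
    using polynomial_on_torus_is_trig_poly[OF p(1)] by blast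
  have "norm (f - h) \<le> e"
  proof (rule norm_bound)
    fix y :: "real^'m"
    have "torus_map y = torus_map (frac_vec y)" by (metis frac_vec_decomp torus_map_translate)
    then have "torus_map y \<in> K" using frac_vec_in_cbox by (auto simp: K_def Q_def)
    from p(2)[OF this] show "norm (apply_bcontfun (f - h) y) \<le> e" by (simp add: gf h)
  qed
  then show ?thesis using that h by blast
qed

lemma countable_dense_subset_of_span:
  fixes B :: "'a::real_normed_vector set"
  assumes "countable B"
  obtains T where "countable T" "T \<subseteq> span B" "0 \<in> T" "\<And>x e. x \<in> span B \<Longrightarrow> e > 0 \<Longrightarrow> \<exists>t\<in>T. norm (x - t) < e"
proof -
  define c where "c l = (\<Sum>(q, b)\<leftarrow>l. real_of_rat q *\<^sub>R b)" for l :: "(rat \<times> 'a) list"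
  define T where "T = c ` lists (UNIV \<times> B)"
  have cT: "countable T" unfolding T_def by (intro countable_image countable_lists countable_SIGMA assms) auto
  have sT: "T \<subseteq> span B"
  proof -
    have "l \<in> lists (UNIV \<times> B) \<Longrightarrow> c l \<in> span B" for l
      by (induction l) (auto simp: c_def intro: span_add span_scale span_base span_zero)
    then show ?thesis by (auto simp: T_def)
  qed
  have zero: "0 \<in> T" unfolding T_def by (rule image_eqI[of _ _ "[]"]) (auto simp: c_def)
  have dense: "\<forall>e>0. \<exists>t\<in>T. norm (x - t) < e" if "x \<in> span B" for x
    using that
  proof (induction rule: span_induct_alt)
    case base
    then show ?case using zero by force
  next
    case (step a b y)
    show ?case
    proof (intro allI impI)
      fix e :: real assume e: "e > 0"
      obtain t where t: "t \<in> T" "norm (y - t) < e/2" using step e by (meson half_gt_zero)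
      have "0 < e / (2 * (1 + norm b))" using e by (intro divide_pos_pos) (auto intro: add_pos_nonneg)
      then obtain r where "a - e / (2 * (1 + norm b)) < of_rat r" "of_rat r < a"
        using of_rat_dense[of "a - e / (2 * (1 + norm b))" a] by auto
      then have r: "\<bar>a - of_rat r\<bar> < e / (2 * (1 + norm b))" by auto
      obtain l where l: "l \<in> lists (UNIV \<times> B)" "t = c l" using t by (auto simp: T_def)
      have "(r, b) # l \<in> lists (UNIV \<times> B)" using l step by auto
      then have T': "of_rat r *\<^sub>R b + t \<in> T" unfolding T_def by (rule image_eqI[rotated]) (simp add: c_def l)
      have "norm ((a *\<^sub>R b + y) - (of_rat r *\<^sub>R b + t)) = norm ((a - of_rat r) *\<^sub>R b + (y - t))"
        by (simp add: algebra_simps)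
      also have "\<dots> \<le> \<bar>a - of_rat r\<bar> * norm b + norm (y - t)"
        by (metis norm_triangle_ineq norm_scaleR)
      also have "\<bar>a - of_rat r\<bar> * norm b \<le> e/2"
      proof -
        have "\<bar>a - of_rat r\<bar> * norm b \<le> e / (2 * (1 + norm b)) * (1 + norm b)"
          using r by (intro mult_mono) auto
        also have "\<dots> = e/2" using norm_ge_zero[of b] by (simp add: field_simps add_nonneg_eq_0_iff)
        finally show ?thesis .
      qed
      finally have "norm ((a *\<^sub>R b + y) - (of_rat r *\<^sub>R b + t)) < e" using t by simp
      with T' show "\<exists>t\<in>T. norm (a *\<^sub>R b + y - t) < e" by blast
    qed
  qed
  show ?thesis using that[OF cT sT zero] dense by blast
qed

lemma C_per_separable:
  obtains T :: "((real^'m) \<Rightarrow>\<^sub>C real) set" where "countable T" "T \<subseteq> C_per" "0 \<in> T"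
    "\<And>f e. f \<in> C_per \<Longrightarrow> e > 0 \<Longrightarrow> \<exists>t\<in>T. norm (f - t) < e"
proof -
  obtain T :: "((real^'m) \<Rightarrow>\<^sub>C real) set" where T: "countable T" "T \<subseteq> trig_polys" "0 \<in> T"
    "\<And>x e. x \<in> trig_polys \<Longrightarrow> e > 0 \<Longrightarrow> \<exists>t\<in>T. norm (x - t) < e"
    using countable_dense_subset_of_span[OF countable_waves] by metis
  show ?thesis
  proof (rule that[OF T(1) _ T(3)])
    show "T \<subseteq> C_per" using T(2) trig_polys_subset_C_per by blast
    fix f :: "(real^'m) \<Rightarrow>\<^sub>C real" and e :: real assume "f \<in> C_per" "e > 0"
    then obtain h where h: "h \<in> trig_polys" "norm (f - h) \<le> e/2"
      using trig_polys_dense[of f "e/2"] by auto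
    obtain t where "t \<in> T" "norm (h - t) < e/2" using T(4)[OF h(1)] \<open>e > 0\<close> by (meson half_gt_zero)
    then show "\<exists>t\<in>T. norm (f - t) < e"
      using h(2) norm_triangle_ineq[of "f - h" "h - t"] by (intro bexI[of _ t]) auto
  qed
qed


section \<open>Mean values of oscillating periodic functions\<close>

lemma cell_borel [measurable, simp]: "cell \<in> sets borel"
  by (simp add: cell_def)

lemma cell_lmeasurable: "cell \<in> lmeasurable"
  by (simp add: cell_def)

lemma measure_cell: "measure lborel (cell :: (real^'m) set) = 1"
proof -
  have "measure lborel (box 0 (\<chi> i. 1) :: (real^'m) set) = (\<Prod>b\<in>Basis. ((\<chi> i. 1) - 0 :: real^'m) \<bullet> b)"
    by (rule measure_lborel_box) (auto simp: Basis_vec_def inner_axis)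
  also have "\<dots> = 1" by (intro prod.neutral) (auto simp: Basis_vec_def inner_axis)
  finally show ?thesis by (simp add: cell_def)
qed

lemma emeasure_cell: "emeasure lborel (cell :: (real^'m) set) = 1"
proof -
  have "emeasure lborel (cell :: (real^'m) set) \<noteq> \<infinity>"
    using emeasure_bounded_finite[of "cell :: (real^'m) set"] by (auto simp: cell_def)
  then show ?thesis using emeasure_eq_ennreal_measure[of lborel "cell :: (real^'m) set"] measure_cell
    by (simp add: measure_cell)
qed

lemma integrable_on_bounded_borel:
  fixes f :: "'a::euclidean_space \<Rightarrow> real"
  assumes "S \<in> sets borel" "emeasure lborel S < \<infinity>" "f \<in> borel_measurable borel" "\<And>x. \<bar>f x\<bar> \<le> B"
  shows "integrable lborel (\<lambda>x. indicator S x * f x)"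
proof (rule Bochner_Integration.integrable_bound[of _ "\<lambda>x. B * indicator S x"])
  show "integrable lborel (\<lambda>x. B * indicator S x :: real)"
    using assms(1,2) by (intro integrable_mult_right) (simp add: integrable_indicator_iff)
  show "(\<lambda>x. indicator S x * f x) \<in> borel_measurable lborel"
    using assms(1,3) by simp
  have "B \<ge> 0" using assms(4)[of undefined] by linarith
  then show "AE x in lborel. norm (indicator S x * f x) \<le> norm (B * indicator S x)"
    using assms(4) by (intro AE_I2) (auto simp: indicator_def)
qed

lemma hyperplane_AE: "AE y in lborel. (y::real^'m) $ i \<noteq> c"
proof -
  have "negligible {y::real^'m. y $ i = c}" 
    using negligible_standard_hyperplane[of "axis i 1 :: real^'m" c] by (auto simp: inner_axis Basis_vec_def)
  then have "{y::real^'m. y $ i = c} \<in> null_sets lebesgue" by (simp add: negligible_iff_null_sets)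
  then have "AE y in lebesgue. y \<notin> {y::real^'m. y $ i = c}" by (rule AE_not_in)
  then show ?thesis by (simp add: AE_completion_iff)
qed

text \<open>The part of the translated cell beyond the face \<open>y\<^sub>i = 1\<close> is moved back by one period; it fills
  the slab which the translation has left empty.\<close>

lemma cell_integral_translate_axis:
  fixes f :: "real^'m \<Rightarrow> real"
  assumes f: "f \<in> borel_measurable borel" "\<And>y. \<bar>f y\<bar> \<le> B"
    and per: "\<And>y. f (y + axis i 1) = f y" and h: "0 \<le> h" "h \<le> 1"
  shows "(\<integral>y. indicator cell y * f (y + h *\<^sub>R axis i 1) \<partial>lborel) = (\<integral>y. indicator cell y * f y \<partial>lborel)"
proof -
  note [measurable] = f(1)
  define C where "C = {y::real^'m. \<forall>j. j \<noteq> i \<longrightarrow> 0 < y $ j \<and> y $ j < 1}"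
  define S where "S a b = C \<inter> {y. a < y $ i \<and> y $ i < b}" for a b
  have S_eq: "S a b = box (\<chi> j. if j = i then a else 0) (\<chi> j. if j = i then b else 1)" for a b
    by (auto simp: S_def C_def mem_box_cart split: if_splits)
  have Sb [measurable]: "S a b \<in> sets borel" for a b by (simp add: S_eq)
  have Sfin: "emeasure lborel (S a b) < \<infinity>" for a b 
    unfolding S_eq by (intro emeasure_bounded_finite bounded_box)
  have int: "integrable lborel (\<lambda>y. indicator (S a b) y * f y)" for a b
    by (rule integrable_on_bounded_borel[OF Sb Sfin f])
  have cell: "cell = S 0 1" by (auto simp: cell_def S_def C_def mem_box_cart)
  have shift: "indicator (S a b) (y + c *\<^sub>R axis i 1) = (indicator (S (a - c) (b - c)) y :: real)" for a b c y
    by (auto simp: S_def C_def indicator_def axis_def)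
  have split: "(\<integral>y. indicator (S a b) y * f y \<partial>lborel)
      = (\<integral>y. indicator (S a c) y * f y \<partial>lborel) + (\<integral>y. indicator (S c b) y * f y \<partial>lborel)"
    if "a \<le> c" "c \<le> b" for a b c
  proof -
    have "(\<integral>y. indicator (S a b) y * f y \<partial>lborel)
        = (\<integral>y. indicator (S a c) y * f y + indicator (S c b) y * f y \<partial>lborel)"
    proof (rule integral_cong_AE)
      show "AE y in lborel. indicator (S a b) y * f y = indicator (S a c) y * f y + indicator (S c b) y * f y"
        using hyperplane_AE[of i c] by eventually_elim (use that in \<open>auto simp: S_def indicator_def\<close>)
    qed measurable
    then show ?thesis using int by simp
  qed
  have "(\<integral>y. indicator (S 0 1) y * f (y + h *\<^sub>R axis i 1) \<partial>lborel)
      = (\<integral>y. indicator (S h (1 + h)) (y + h *\<^sub>R axis i 1) * f (y + h *\<^sub>R axis i 1) \<partial>lborel)"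
    by (simp add: shift)
  also have "\<dots> = (\<integral>y. indicator (S h (1 + h)) y * f y \<partial>lborel)"
    by (rule lebesgue_integral_translate[where f = "\<lambda>y. indicator (S h (1 + h)) y * f y"]) measurable
  also have "\<dots> = (\<integral>y. indicator (S h 1) y * f y \<partial>lborel) + (\<integral>y. indicator (S 1 (1 + h)) y * f y \<partial>lborel)"
    using h by (intro split) auto
  also have "(\<integral>y. indicator (S 1 (1 + h)) y * f y \<partial>lborel)
      = (\<integral>y. indicator (S 1 (1 + h)) (y + 1 *\<^sub>R axis i 1) * f (y + 1 *\<^sub>R axis i 1) \<partial>lborel)"
    by (rule lebesgue_integral_translate[where f = "\<lambda>y. indicator (S 1 (1 + h)) y * f y", symmetric]) measurable
  also have "\<dots> = (\<integral>y. indicator (S 0 h) y * f y \<partial>lborel)"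
    unfolding shift by (simp add: per)
  finally show ?thesis
    using split[of 0 h 1] h by (simp add: cell)
qed

text \<open>Translation by half a period along an axis with \<open>k\<^sub>i \<noteq> 0\<close> changes the sign of the wave and
  preserves its integral over the cell.\<close>

lemma wave_cell_integral_zero:
  fixes k :: "int^'m"
  assumes "k \<noteq> 0"
  shows "(\<integral>y. indicator cell y * apply_bcontfun (wave k b) y \<partial>lborel) = 0"
proof -
  obtain i where i: "k $ i \<noteq> 0" using assms by (auto simp: vec_eq_iff)
  \<comment> \<open>Half a period of the wave in the direction of the axis \<open>i\<close>.\<close>
  define h where "h = 1 / (2 * \<bar>real_of_int (k $ i)\<bar>)"
  have "\<bar>real_of_int (k $ i)\<bar> \<ge> 1" using i by linarith
  then have h: "0 \<le> h" "h \<le> 1" by (auto simp: h_def)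
  let ?f = "apply_bcontfun (wave k b)"
  have flip: "?f (y + h *\<^sub>R axis i 1) = - ?f y" for y
  proof -
    define \<theta> where "\<theta> = 2 * pi * (real_vec k \<bullet> y) + b"
    have "real_vec k \<bullet> axis i 1 = real_of_int (k $ i)" by (simp add: inner_axis real_vec_def)
    then have "2 * pi * (real_vec k \<bullet> (y + h *\<^sub>R axis i 1)) + b
        = \<theta> + 2 * pi * (h * real_of_int (k $ i))"
      by (simp add: \<theta>_def inner_add_right algebra_simps)
    also have "2 * pi * (h * real_of_int (k $ i)) = (if k $ i > 0 then pi else - pi)"
      using i by (auto simp: h_def field_simps)
    finally show ?thesis unfolding apply_wave \<theta>_def[symmetric] by (simp add: cos_diff)
  qed
  have "(\<integral>y. indicator cell y * ?f (y + h *\<^sub>R axis i 1) \<partial>lborel) = (\<integral>y. indicator cell y * ?f y \<partial>lborel)"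
  proof (rule cell_integral_translate_axis[OF _ _ _ h, where B = 1])
    show "?f (y + axis i 1) = ?f y" for y
      using C_per_apply[OF wave_in_C_per, of k b y "axis i 1"] by (simp only: real_vec_axis)
    show "?f \<in> borel_measurable borel"
      by (rule borel_measurable_continuous_onI[OF continuous_on_apply_bcontfun])
  qed simp
  then show ?thesis unfolding flip by simp
qed

lemma bcontfun_borel [measurable]: "apply_bcontfun f \<in> borel_measurable borel"
  by (intro borel_measurable_continuous_onI) simp

lemma abs_bcontfun_le: "\<bar>apply_bcontfun f y\<bar> \<le> norm (f :: 'a::topological_space \<Rightarrow>\<^sub>C real)"
  using norm_bounded[of f y] by simp

locale oscillation =
  fixes R :: "real^'d^'m" and \<eta> :: "nat \<Rightarrow> real"
  assumes nonresonant: "\<And>k::int^'m. k \<noteq> 0 \<Longrightarrow> transpose R *v real_vec k \<noteq> 0"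
    and pos: "\<And>n. \<eta> n > 0" and null: "\<eta> \<longlonglongrightarrow> 0"
begin

definition fast :: "nat \<Rightarrow> real^'d \<Rightarrow> real^'m" where
  "fast n x = (1 / \<eta> n) *\<^sub>R (R *v x)"

lemma continuous_on_fast: "continuous_on S (fast n)"
  unfolding fast_def by (intro continuous_intros linear_continuous_on_compose matrix_vector_mul_linear)

lemma fast_borel [measurable]: "fast n \<in> borel_measurable borel"
  by (intro borel_measurable_continuous_onI continuous_on_fast)

definition mean_value :: "((real^'m) \<Rightarrow>\<^sub>C real) \<Rightarrow> (real^'d) set \<Rightarrow> bool" where
  "mean_value t A \<longleftrightarrow>
    (\<lambda>n. \<integral>x. indicator A x * apply_bcontfun t (fast n x) \<partial>lborel)
      \<longlonglongrightarrow> measure lborel A * (\<integral>y. indicator cell y * apply_bcontfun t y \<partial>lborel)"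

context
  fixes A :: "(real^'d) set"
  assumes A: "A \<in> sets borel" "bounded A"
begin

lemma bounded_set_finite: "emeasure lborel A < \<infinity>"
  using A(2) by (rule emeasure_bounded_finite)

lemma integrable_fast_on_set:
  fixes t :: "(real^'m) \<Rightarrow>\<^sub>C real"
  shows "integrable lborel (\<lambda>x. indicator A x * apply_bcontfun t (fast n x))"
  by (rule integrable_on_bounded_borel[OF A(1) bounded_set_finite, where B = "norm t"]) (auto simp: abs_bcontfun_le)

lemma integrable_on_cell:
  fixes t :: "(real^'m) \<Rightarrow>\<^sub>C real"
  shows "integrable lborel (\<lambda>y. indicator cell y * apply_bcontfun t y)"
  by (rule integrable_on_bounded_borel[where B = "norm t"]) (auto simp: abs_bcontfun_le emeasure_cell)

text \<open>A wave of frequency \<open>k\<close> in the fast variable is a wave of frequency \<open>2 \<pi> R\<^sup>T k / \<eta>\<close> in \<open>x\<close>. The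
  nonresonance condition makes this frequency unbounded for \<open>k \<noteq> 0\<close>.\<close>

lemma mean_value_wave: "mean_value (wave k b) A"
proof (cases "k = 0")
  case True
  then show ?thesis using A(1) by (simp add: mean_value_def measure_cell)
next
  case False
  define v where "v = transpose R *v real_vec k"
  have v: "norm v > 0" using nonresonant[OF False] by (simp add: v_def)
  define \<xi> where "\<xi> n = (2 * pi / \<eta> n) *\<^sub>R v" for n
  have "filterlim (\<lambda>n. norm (\<xi> n)) at_top sequentially"
  proof -
    have "filterlim (\<lambda>n. inverse (\<eta> n)) at_top sequentially"
      by (rule filterlim_inverse_at_top[OF null]) (simp add: pos)
    then have "filterlim (\<lambda>n. (2 * pi * norm v) * inverse (\<eta> n)) at_top sequentially"
      using v by (intro filterlim_tendsto_pos_mult_at_top[OF tendsto_const]) auto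
    moreover have "norm (\<xi> n) = (2 * pi * norm v) * inverse (\<eta> n)" for n
      using pos[of n] by (simp add: \<xi>_def divide_inverse mult_ac)
    ultimately show ?thesis by simp
  qed
  from Riemann_Lebesgue_set[OF A this]
  have "(\<lambda>n. Re (cis b * (\<integral>x. indicator A x *\<^sub>R cis (\<xi> n \<bullet> x) \<partial>lborel))) \<longlonglongrightarrow> Re (cis b * 0)"
    by (intro tendsto_intros)
  moreover have "Re (cis b * (\<integral>x. indicator A x *\<^sub>R cis (\<xi> n \<bullet> x) \<partial>lborel))
      = (\<integral>x. indicator A x * apply_bcontfun (wave k b) (fast n x) \<partial>lborel)" for n
  proof -
    have i: "integrable lborel (\<lambda>x. indicator A x *\<^sub>R cis (\<xi> n \<bullet> x))"
    proof (rule Bochner_Integration.integrable_bound[of _ "indicator A :: _ \<Rightarrow> real"])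
      show "integrable lborel (indicator A :: _ \<Rightarrow> real)"
        using bounded_set_finite A(1) by (simp add: integrable_indicator_iff)
      have "(\<lambda>x. cis (\<xi> n \<bullet> x)) \<in> borel_measurable borel"
        by (intro borel_measurable_continuous_onI continuous_intros)
      then show "(\<lambda>x. indicator A x *\<^sub>R cis (\<xi> n \<bullet> x)) \<in> borel_measurable lborel"
        using A(1) by simp
    qed (simp add: indicator_def)
    have i2: "integrable lborel (\<lambda>x. cis b * (indicator A x *\<^sub>R cis (\<xi> n \<bullet> x)))"
      by (rule integrable_mult_right[OF i])
    have "Re (cis b * (\<integral>x. indicator A x *\<^sub>R cis (\<xi> n \<bullet> x) \<partial>lborel))
        = Re (\<integral>x. cis b * (indicator A x *\<^sub>R cis (\<xi> n \<bullet> x)) \<partial>lborel)"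
      by (simp only: Bochner_Integration.integral_mult_right[OF i])
    also have "\<dots> = (\<integral>x. Re (cis b * (indicator A x *\<^sub>R cis (\<xi> n \<bullet> x))) \<partial>lborel)"
      by (rule integral_Re[OF i2, symmetric])
    also have "\<dots> = (\<integral>x. indicator A x * apply_bcontfun (wave k b) (fast n x) \<partial>lborel)"
    proof (rule Bochner_Integration.integral_cong[OF refl])
      fix x
      have "\<xi> n \<bullet> x = 2 * pi * (real_vec k \<bullet> fast n x)"
        unfolding \<xi>_def v_def fast_def
        by (simp add: dot_lmul_matrix[symmetric] vector_transpose_matrix inner_commute)
      then show "Re (cis b * (indicator A x *\<^sub>R cis (\<xi> n \<bullet> x))) = indicator A x * apply_bcontfun (wave k b) (fast n x)"
        by (simp add: cos_add indicator_def algebra_simps)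
    qed
    finally show ?thesis .
  qed
  ultimately show ?thesis by (simp only: mean_value_def wave_cell_integral_zero[OF False]) simp
qed

lemma mean_value_trig_poly:
  assumes "t \<in> trig_polys"
  shows "mean_value t A"
  using assms
proof (induction rule: span_induct)
  case base
  show ?case
    unfolding subspace_def
  proof (intro conjI ballI allI; clarsimp)
    show "mean_value 0 A" by (simp add: mean_value_def)
  next
    fix s t assume "mean_value s A" "mean_value t A"
    from tendsto_add[OF this[unfolded mean_value_def]] show "mean_value (s + t) A"
      unfolding mean_value_def by (simp add: distrib_left integrable_fast_on_set integrable_on_cell)
  next
    fix c t assume "mean_value t A"
    from tendsto_mult_left[OF this[unfolded mean_value_def], of c] show "mean_value (c *\<^sub>R t) A"
      unfolding mean_value_def by (simp add: mult.left_commute[of _ c])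
  qed
next
  case (step t)
  then show ?case by (auto simp: waves_def mean_value_wave)
qed

text \<open>Both sides are bounded by a multiple of the uniform norm, so the statement passes from trigonometric
  polynomials to their uniform limits.\<close>

theorem mean_value_C_per:
  assumes t: "t \<in> C_per"
  shows "mean_value t A"
  unfolding mean_value_def
proof (rule LIMSEQ_I)
  fix e :: real assume e: "e > 0"
  define \<mu> where "\<mu> = measure lborel A"
  have \<mu>: "\<mu> \<ge> 0" by (simp add: \<mu>_def)
  define d where "d = e / (3 * (1 + \<mu>))"
  have d: "d > 0" using e \<mu> by (auto simp: d_def intro!: divide_pos_pos)
  have d\<mu>: "\<mu> * d \<le> e / 3" using e \<mu> by (simp add: d_def field_simps)
  obtain h where h: "h \<in> trig_polys" "norm (t - h) \<le> d" using trig_polys_dense[OF t d] by blast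
  define X where "X s n = (\<integral>x. indicator A x * apply_bcontfun s (fast n x) \<partial>lborel)" for s :: "(real^'m) \<Rightarrow>\<^sub>C real" and n
  define Y where "Y s = (\<integral>y. indicator cell y * apply_bcontfun s y \<partial>lborel)" for s :: "(real^'m) \<Rightarrow>\<^sub>C real"
  have bnd: "\<bar>apply_bcontfun (t - h) y\<bar> \<le> d" for y
    using abs_bcontfun_le[of "t - h" y] h(2) by linarith
  have X: "\<bar>X t n - X h n\<bar> \<le> \<mu> * d" for n
  proof -
    have "X t n - X h n = (\<integral>x. indicator A x * apply_bcontfun (t - h) (fast n x) \<partial>lborel)"
      unfolding X_def using integrable_fast_on_set[of t n] integrable_fast_on_set[of h n] by (simp add: right_diff_distrib)
    also have "norm \<dots> \<le> (\<integral>x. indicator A x * d \<partial>lborel)"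
      using bnd A bounded_set_finite d
      by (intro Bochner_Integration.integral_norm_bound_integral integrable_fast_on_set integrable_on_bounded_borel[where B = d])
        (auto simp: indicator_def)
    also have "\<dots> = \<mu> * d" using A(1) by (simp add: \<mu>_def)
    finally show ?thesis by simp
  qed
  have Y: "\<bar>Y t - Y h\<bar> \<le> d"
  proof -
    have "Y t - Y h = (\<integral>y. indicator cell y * apply_bcontfun (t - h) y \<partial>lborel)"
      unfolding Y_def using integrable_on_cell[of t] integrable_on_cell[of h] by (simp add: right_diff_distrib)
    also have "norm \<dots> \<le> (\<integral>y. indicator (cell :: (real^'m) set) y * d \<partial>lborel)"
      using bnd d emeasure_cell[where 'm = 'm]
      by (intro Bochner_Integration.integral_norm_bound_integral integrable_on_cell integrable_on_bounded_borel[where B = d])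
        (auto simp: indicator_def)
    also have "\<dots> = d" using measure_cell[where 'm = 'm] by simp
    finally show ?thesis by simp
  qed
  have "X h \<longlonglongrightarrow> \<mu> * Y h"
    using mean_value_trig_poly[OF h(1)] unfolding mean_value_def X_def[abs_def] \<mu>_def Y_def .
  then obtain N where N: "\<And>n. n \<ge> N \<Longrightarrow> \<bar>X h n - \<mu> * Y h\<bar> < e/3"
    using LIMSEQ_D[of "X h" "\<mu> * Y h" "e/3"] e by auto
  have "\<bar>X t n - \<mu> * Y t\<bar> < e" if "n \<ge> N" for n
  proof -
    have "\<bar>\<mu> * Y t - \<mu> * Y h\<bar> \<le> \<mu> * d"
      using Y \<mu> by (simp add: right_diff_distrib[symmetric] abs_mult mult_left_mono)
    then show ?thesis using X[of n] N[OF that] d\<mu> by linarith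
  qed
  then show "\<exists>no. \<forall>n\<ge>no. norm ((\<integral>x. indicator A x * apply_bcontfun t (fast n x) \<partial>lborel)
      - measure lborel A * (\<integral>y. indicator cell y * apply_bcontfun t y \<partial>lborel)) < e"
    by (auto simp: X_def Y_def \<mu>_def)
qed

end

end


section \<open>Simple fields and their density\<close>

lemma complete_measure_lebesgue_on:
  assumes "S \<in> sets lebesgue"
  shows "complete_measure (lebesgue_on S)"
proof
  fix A B assume "B \<subseteq> A" "A \<in> null_sets (lebesgue_on S)"
  then have "A \<subseteq> S" "A \<in> null_sets lebesgue" using assms by (auto simp: null_sets_restrict_space)
  then have "B \<in> null_sets lebesgue" "B \<subseteq> S" using \<open>B \<subseteq> A\<close> by (auto intro: completion.complete2)
  then show "B \<in> sets (lebesgue_on S)" using assms by (auto simp: sets_restrict_space_iff)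
qed

lemma (in complete_measure) borel_measurable_AE_eq:
  assumes h: "h \<in> borel_measurable M" and ae: "AE x in M. h x = g x"
  shows "g \<in> borel_measurable M"
proof (rule measurableI)
  fix B :: "'b set" assume B: "B \<in> sets borel"
  show "g -` B \<inter> space M \<in> sets M"
  proof (rule in_sets_AE)
    show "AE x in M. x \<in> h -` B \<inter> space M \<longleftrightarrow> x \<in> g -` B \<inter> space M"
      using ae by eventually_elim auto
    show "h -` B \<inter> space M \<in> sets M" using h B by (rule measurable_sets)
  qed auto
qed auto

lemma borel_measurable_lebesgue_on_AE_limit:
  fixes f :: "nat \<Rightarrow> 'a::euclidean_space \<Rightarrow> real"
  assumes S: "S \<in> sets lebesgue" and f: "\<And>n. f n \<in> borel_measurable (lebesgue_on S)"
    and lim: "AE x in lebesgue_on S. (\<lambda>n. f n x) \<longlonglongrightarrow> g x"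
  shows "g \<in> borel_measurable (lebesgue_on S)"
proof -
  interpret complete_measure "lebesgue_on S" by (rule complete_measure_lebesgue_on[OF S])
  show ?thesis
  proof (rule borel_measurable_AE_eq)
    show "(\<lambda>x. lim (\<lambda>n. f n x)) \<in> borel_measurable (lebesgue_on S)" using f by measurable
    show "AE x in lebesgue_on S. lim (\<lambda>n. f n x) = g x"
      using lim by eventually_elim (rule limI)
  qed
qed

text \<open>Step functions are represented by lists, which makes sums and multiples of step functions again
  step functions by appending and mapping.\<close>

definition simple_field :: "('a set \<times> 'b::real_vector) list \<Rightarrow> 'a \<Rightarrow> 'b" where
  "simple_field l x = (\<Sum>(A, t)\<leftarrow>l. indicator A x *\<^sub>R t)"

lemma simple_field_Nil [simp]: "simple_field [] x = 0"
  and simple_field_Cons [simp]: "simple_field ((A, t) # l) x = indicator A x *\<^sub>R t + simple_field l x"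
  and simple_field_append: "simple_field (l @ l') x = simple_field l x + simple_field l' x"
  by (simp_all add: simple_field_def)

lemma simple_field_scale: "simple_field (map (\<lambda>(A, t). (A, c *\<^sub>R t)) l) x = c *\<^sub>R simple_field l x"
  by (induction l) (auto simp: scaleR_add_right mult.commute)

lemma simple_field_diff_set:
  "simple_field (map (\<lambda>(A, t). (A - E, t)) l) x = (if x \<in> E then 0 else simple_field l x)"
  by (induction l) (auto simp: indicator_def)

lemma simple_function_simple_field:
  assumes "l \<in> lists (sets lebesgue \<times> UNIV)" "\<Omega> \<in> sets lebesgue"
  shows "simple_function (lebesgue_on \<Omega>) (simple_field l)"
  using assms(1)
proof (induction l)
  case Nil
  have "simple_field [] = (\<lambda>x. 0)" by (simp add: fun_eq_iff)
  then show ?case by simp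
next
  case (Cons p l)
  obtain A t where p: "p = (A, t)" "A \<in> sets lebesgue" using Cons.hyps by auto
  define ind :: "'a \<Rightarrow> real" where "ind = indicator (A \<inter> \<Omega>)"
  have "A \<inter> \<Omega> \<in> sets (lebesgue_on \<Omega>)" using p(2) assms(2) by (auto simp: sets_restrict_space_iff)
  then have "simple_function (lebesgue_on \<Omega>) ind" unfolding ind_def by (rule simple_function_indicator)
  then have "simple_function (lebesgue_on \<Omega>) (\<lambda>x. ind x *\<^sub>R t + simple_field l x)"
    by (rule simple_function_compose2[OF _ Cons.IH])
  moreover have "simple_function (lebesgue_on \<Omega>) (\<lambda>x. ind x *\<^sub>R t + simple_field l x)
      = simple_function (lebesgue_on \<Omega>) (simple_field (p # l))"
    by (rule simple_function_cong) (simp add: ind_def p indicator_def)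
  ultimately show ?case by simp
qed

text \<open>The target need not be second countable, so a difference of measurable functions need not be
  measurable. It is so when one of the functions takes finitely many values.\<close>

lemma borel_measurable_norm_diff_simple:
  fixes \<phi> :: "'a \<Rightarrow> 'b::real_normed_vector"
  assumes \<phi>: "\<phi> \<in> borel_measurable M" and s: "simple_function M s"
  shows "(\<lambda>x. norm (\<phi> x - s x)) \<in> borel_measurable M"
proof (rule measurable_compose_countable'[where I = "s ` space M" and g = s])
  show "(\<lambda>x. norm (\<phi> x - v)) \<in> borel_measurable M" for v
    by (rule measurable_compose[OF \<phi>]) (intro borel_measurable_continuous_onI continuous_intros)
  have fin: "finite (s ` space M)" by (rule simple_functionD(1)[OF s])
  then show "countable (s ` space M)" by (rule countable_finite)
  show "s \<in> measurable M (count_space (s ` space M))"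
    using fin s by (auto simp: measurable_count_space_eq2 simple_function_def)
qed

text \<open>The values of \<open>\<phi>\<close> lie in a separable set, although the whole target space is not separable. Going
  through a dense sequence, a step function that always keeps the nearest point found so far
  converges to \<open>\<phi>\<close>. Since \<open>0\<close> is the first point tried, the error never exceeds \<open>norm (\<phi> x)\<close>, and
  dominated convergence applies.\<close>

lemma simple_field_dense_measurable:
  fixes \<phi> :: "'a::euclidean_space \<Rightarrow> 'b::real_normed_vector"
  assumes \<Omega>: "\<Omega> \<in> lmeasurable" and \<phi>: "\<phi> \<in> L2_on \<Omega>"
    and T: "countable T" "0 \<in> T"
    and dense: "AE x in lebesgue_on \<Omega>. \<forall>e>0. \<exists>t\<in>T. norm (\<phi> x - t) < e"
    and e: "e > 0"
  obtains l where "l \<in> lists ({A \<in> lmeasurable. A \<subseteq> \<Omega>} \<times> T)"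
    "integrable (lebesgue_on \<Omega>) (\<lambda>x. (norm (\<phi> x - simple_field l x))\<^sup>2)"
    "(\<integral>x. (norm (\<phi> x - simple_field l x))\<^sup>2 \<partial>lebesgue_on \<Omega>) < e"
proof -
  define t where "t = from_nat_into T"
  have t: "range t = T" unfolding t_def using T by (intro range_from_nat_into) auto
  have \<phi>m: "\<phi> \<in> borel_measurable (lebesgue_on \<Omega>)" and \<phi>2: "integrable (lebesgue_on \<Omega>) (\<lambda>x. (norm (\<phi> x))\<^sup>2)"
    using \<phi> by (auto simp: L2_on_def)
  \<comment> \<open>The distance of \<open>\<phi> x\<close> to \<open>0\<close> and the first \<open>N\<close> members of the dense sequence.\<close>
  define d where "d = rec_nat (\<lambda>x. norm (\<phi> x)) (\<lambda>N dN x. min (dN x) (norm (\<phi> x - t N)))"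
  have d0: "d 0 x = norm (\<phi> x)" and dS: "d (Suc N) x = min (d N x) (norm (\<phi> x - t N))" for N x
    by (simp_all add: d_def)
  have nm: "(\<lambda>x. norm (\<phi> x - v)) \<in> borel_measurable (lebesgue_on \<Omega>)" for v
    by (rule measurable_compose[OF \<phi>m]) (intro borel_measurable_continuous_onI continuous_intros)
  have dm: "d N \<in> borel_measurable (lebesgue_on \<Omega>)" for N
  proof (induction N)
    case 0
    then show ?case using nm[of 0] by (simp add: d0[abs_def])
  next
    case (Suc N)
    note [measurable] = Suc nm[of "t N"]
    show ?case unfolding dS[abs_def] by measurable
  qed
  have dnn: "0 \<le> d N x" and dle: "d N x \<le> norm (\<phi> x)" for N x
    by (induction N) (auto simp: d0 dS)
  have dmono: "d N x \<le> d K x" if "K \<le> N" for K N x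
    using that by (induction rule: dec_induct) (auto simp: dS)
  have realised: "\<exists>l\<in>lists ({A \<in> lmeasurable. A \<subseteq> \<Omega>} \<times> T). \<forall>x\<in>\<Omega>. norm (\<phi> x - simple_field l x) = d N x" for N
  proof (induction N)
    case 0
    show ?case by (rule bexI[of _ "[]"]) (auto simp: d0)
  next
    case (Suc N)
    then obtain l where l: "l \<in> lists ({A \<in> lmeasurable. A \<subseteq> \<Omega>} \<times> T)"
      "\<And>x. x \<in> \<Omega> \<Longrightarrow> norm (\<phi> x - simple_field l x) = d N x" by blast
    define E where "E = {x \<in> \<Omega>. norm (\<phi> x - t N) < d N x}"
    have "{x \<in> space (lebesgue_on \<Omega>). norm (\<phi> x - t N) < d N x} \<in> sets (lebesgue_on \<Omega>)"
      using nm[of "t N"] dm[of N] by (rule borel_measurable_less)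
    then have "E \<in> sets lebesgue" using \<Omega> by (auto simp: E_def sets_restrict_space_iff)
    then have E: "E \<in> lmeasurable" "E \<subseteq> \<Omega>" using \<Omega> by (auto simp: E_def intro: fmeasurableI2)
    define l' where "l' = (E, t N) # map (\<lambda>(A, s). (A - E, s)) l"
    have "l' \<in> lists ({A \<in> lmeasurable. A \<subseteq> \<Omega>} \<times> T)"
    proof -
      have "map (\<lambda>(A, s). (A - E, s)) l \<in> lists ({A \<in> lmeasurable. A \<subseteq> \<Omega>} \<times> T)"
        using l(1) E(1) by (induction l) (auto intro!: fmeasurable_Diff fmeasurableD)
      then show ?thesis using E t by (auto simp: l'_def)
    qed
    moreover have "norm (\<phi> x - simple_field l' x) = d (Suc N) x" if "x \<in> \<Omega>" for x
      unfolding l'_def simple_field_Cons simple_field_diff_set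
      using l(2)[OF that] that by (auto simp: dS E_def)
    ultimately show ?case by blast
  qed
  have "(\<lambda>N. \<integral>x. (d N x)\<^sup>2 \<partial>lebesgue_on \<Omega>) \<longlonglongrightarrow> (\<integral>x. 0 \<partial>lebesgue_on \<Omega>)"
  proof (rule integral_dominated_convergence[where w = "\<lambda>x. (norm (\<phi> x))\<^sup>2"])
    show "(\<lambda>x. (d N x)\<^sup>2) \<in> borel_measurable (lebesgue_on \<Omega>)" for N using dm[of N] by (rule borel_measurable_power)
    show "AE x in lebesgue_on \<Omega>. norm ((d N x)\<^sup>2) \<le> (norm (\<phi> x))\<^sup>2" for N
      using dnn dle by (intro AE_I2) (auto intro!: power_mono)
    show "AE x in lebesgue_on \<Omega>. (\<lambda>N. (d N x)\<^sup>2) \<longlonglongrightarrow> 0"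
      using dense
    proof eventually_elim
      case (elim x)
      have "(\<lambda>N. d N x) \<longlonglongrightarrow> 0"
      proof (rule LIMSEQ_I)
        fix e :: real assume "e > 0"
        then obtain s where "s \<in> T" "norm (\<phi> x - s) < e" using elim by blast
        then obtain n where "norm (\<phi> x - t n) < e" using t by auto
        then have "d (Suc n) x < e" by (simp add: dS)
        then have "\<bar>d N x\<bar> < e" if "N \<ge> Suc n" for N
          using dmono[OF that, of x] dnn[of N x] by linarith
        then show "\<exists>no. \<forall>n\<ge>no. norm (d n x - 0) < e" by auto
      qed
      from tendsto_power[OF this, of 2] show ?case by simp
    qed
  qed (use \<phi>2 in auto)
  then have "\<forall>\<^sub>F N in sequentially. (\<integral>x. (d N x)\<^sup>2 \<partial>lebesgue_on \<Omega>) < e"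
    by (rule order_tendstoD(2)) (use e in simp)
  then obtain N where N: "(\<integral>x. (d N x)\<^sup>2 \<partial>lebesgue_on \<Omega>) < e"
    unfolding eventually_sequentially by blast
  obtain l where l: "l \<in> lists ({A \<in> lmeasurable. A \<subseteq> \<Omega>} \<times> T)"
    "\<And>x. x \<in> \<Omega> \<Longrightarrow> norm (\<phi> x - simple_field l x) = d N x"
    using realised[of N] by (elim bexE) auto
  have di: "integrable (lebesgue_on \<Omega>) (\<lambda>x. (d N x)\<^sup>2)"
    by (rule Bochner_Integration.integrable_bound[OF \<phi>2 borel_measurable_power[OF dm]])
      (use dnn dle in \<open>auto intro!: power_mono\<close>)
  show ?thesis
  proof (rule that[OF l(1)])
    show "integrable (lebesgue_on \<Omega>) (\<lambda>x. (norm (\<phi> x - simple_field l x))\<^sup>2)"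
      using di by (rule Bochner_Integration.integrable_cong[THEN iffD1, rotated 2]) (auto simp: l(2))
    have "(\<integral>x. (norm (\<phi> x - simple_field l x))\<^sup>2 \<partial>lebesgue_on \<Omega>) = (\<integral>x. (d N x)\<^sup>2 \<partial>lebesgue_on \<Omega>)"
      by (rule Bochner_Integration.integral_cong) (auto simp: l(2))
    then show "(\<integral>x. (norm (\<phi> x - simple_field l x))\<^sup>2 \<partial>lebesgue_on \<Omega>) < e" using N by simp
  qed
qed

lemma norm_add_square_le: "(norm (x + y))\<^sup>2 \<le> 2 * (norm x)\<^sup>2 + 2 * (norm (y::'a::real_normed_vector))\<^sup>2"
proof -
  have "(norm (x + y))\<^sup>2 \<le> (norm x + norm y)\<^sup>2" by (intro power_mono norm_triangle_ineq) auto
  also have "\<dots> \<le> 2 * (norm x)\<^sup>2 + 2 * (norm y)\<^sup>2"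
    using sum_squares_bound[of "norm x" "norm y"] by (simp add: power2_sum)
  finally show ?thesis .
qed

lemma integral_norm_add_square:
  fixes f g h :: "'a \<Rightarrow> 'b::real_normed_vector"
  assumes "(\<lambda>x. norm (h x)) \<in> borel_measurable M" "\<And>x. x \<in> space M \<Longrightarrow> h x = f x + g x"
    and f: "integrable M (\<lambda>x. (norm (f x))\<^sup>2)" and g: "integrable M (\<lambda>x. (norm (g x))\<^sup>2)"
  shows "integrable M (\<lambda>x. (norm (h x))\<^sup>2)"
    and "(\<integral>x. (norm (h x))\<^sup>2 \<partial>M) \<le> 2 * (\<integral>x. (norm (f x))\<^sup>2 \<partial>M) + 2 * (\<integral>x. (norm (g x))\<^sup>2 \<partial>M)"
proof -
  have i: "integrable M (\<lambda>x. 2 * (norm (f x))\<^sup>2 + 2 * (norm (g x))\<^sup>2)" using f g by auto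
  show h: "integrable M (\<lambda>x. (norm (h x))\<^sup>2)"
    by (rule Bochner_Integration.integrable_bound[OF i borel_measurable_power[OF assms(1)]])
      (use assms(2) norm_add_square_le in \<open>auto intro!: AE_I2\<close>)
  have "(\<integral>x. (norm (h x))\<^sup>2 \<partial>M) \<le> (\<integral>x. 2 * (norm (f x))\<^sup>2 + 2 * (norm (g x))\<^sup>2 \<partial>M)"
    by (rule integral_mono[OF h i]) (use assms(2) norm_add_square_le in auto)
  also have "\<dots> = 2 * (\<integral>x. (norm (f x))\<^sup>2 \<partial>M) + 2 * (\<integral>x. (norm (g x))\<^sup>2 \<partial>M)" using f g by simp
  finally show "(\<integral>x. (norm (h x))\<^sup>2 \<partial>M) \<le> 2 * (\<integral>x. (norm (f x))\<^sup>2 \<partial>M) + 2 * (\<integral>x. (norm (g x))\<^sup>2 \<partial>M)" .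
qed

lemma lists_lebesgue:
  "l \<in> lists ({A \<in> lmeasurable. A \<subseteq> \<Omega>} \<times> T) \<Longrightarrow> l \<in> lists (sets lebesgue \<times> UNIV)"
  "l \<in> lists (box_unions \<Omega>' \<times> T) \<Longrightarrow> l \<in> lists (sets lebesgue \<times> UNIV)"
  using box_unionsD(5) by (auto intro: fmeasurableD elim!: lists_mono[THEN subsetD, rotated])

lemma simple_field_dense_boxes:
  fixes T :: "'b::real_normed_vector set" and \<Omega> :: "(real^'n) set"
  assumes \<Omega>: "open \<Omega>" "bounded \<Omega>" and l: "l \<in> lists ({A \<in> lmeasurable. A \<subseteq> \<Omega>} \<times> T)" and e: "e > 0"
  shows "\<exists>l'\<in>lists (box_unions \<Omega> \<times> T).
    integrable (lebesgue_on \<Omega>) (\<lambda>x. (norm (simple_field l x - simple_field l' x))\<^sup>2) \<and>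
    (\<integral>x. (norm (simple_field l x - simple_field l' x))\<^sup>2 \<partial>lebesgue_on \<Omega>) < e"
  using l e
proof (induction l arbitrary: e)
  case Nil
  then show ?case by (intro bexI[of _ "[]"]) auto
next
  case (Cons p l)
  have \<Omega>m: "\<Omega> \<in> lmeasurable" using \<Omega> by (auto intro: lmeasurable_open)
  obtain A t where p: "p = (A, t)" "A \<in> lmeasurable" "A \<subseteq> \<Omega>" "t \<in> T" using Cons.hyps by auto
  have "0 < e/4" using Cons.prems by simp
  then obtain l' where l': "l' \<in> lists (box_unions \<Omega> \<times> T)"
    "integrable (lebesgue_on \<Omega>) (\<lambda>x. (norm (simple_field l x - simple_field l' x))\<^sup>2)"
    "(\<integral>x. (norm (simple_field l x - simple_field l' x))\<^sup>2 \<partial>lebesgue_on \<Omega>) < e/4"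
    using Cons.IH by blast
  define c where "c = 1 + (norm t)\<^sup>2"
  have c: "c > 0" "(norm t)\<^sup>2 \<le> c" by (auto simp: c_def intro: add_pos_nonneg)
  have "e / (4 * c) > 0" using Cons.prems c by simp
  then obtain B where B: "B \<in> box_unions \<Omega>" "measure lebesgue ((A - B) \<union> (B - A)) < e / (4 * c)"
    using box_unions_dense[OF \<Omega>(1) p(2,3)] by blast
  note Bm = box_unionsD(5)[OF B(1)] and Bs = box_unionsD(2)[OF B(1)]
  note ind = integral_indicator_diff_square[OF \<Omega>m p(2) Bm p(3) Bs]
  have n1: "(norm ((indicator A x - indicator B x) *\<^sub>R t))\<^sup>2 = (norm t)\<^sup>2 * (indicator A x - indicator B x)\<^sup>2" for x
    by (simp add: power_mult_distrib mult.commute)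
  have i1: "integrable (lebesgue_on \<Omega>) (\<lambda>x. (norm ((indicator A x - indicator B x) *\<^sub>R t))\<^sup>2)"
    unfolding n1 using ind(1) by (intro integrable_mult_right square_integrableD(2))
  have "(\<integral>x. (norm ((indicator A x - indicator B x) *\<^sub>R t))\<^sup>2 \<partial>lebesgue_on \<Omega>)
      = (norm t)\<^sup>2 * measure lebesgue ((A - B) \<union> (B - A))"
    unfolding n1 integral_mult_right_zero ind(2) ..
  also have "\<dots> \<le> c * measure lebesgue ((A - B) \<union> (B - A))" using c by (intro mult_right_mono) auto
  also have "\<dots> < c * (e / (4 * c))" using c B(2) by (intro mult_strict_left_mono) auto
  also have "\<dots> = e/4" using c by simp
  finally have v1: "(\<integral>x. (norm ((indicator A x - indicator B x) *\<^sub>R t))\<^sup>2 \<partial>lebesgue_on \<Omega>) < e/4" .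
  let ?l = "(B, t) # l'"
  have lists: "?l \<in> lists (box_unions \<Omega> \<times> T)" using l'(1) B(1) p(4) by auto
  have pl: "p # l \<in> lists ({A \<in> lmeasurable. A \<subseteq> \<Omega>} \<times> T)" using Cons.hyps by auto
  have sf: "simple_function (lebesgue_on \<Omega>) (simple_field (p # l))" "simple_function (lebesgue_on \<Omega>) (simple_field ?l)"
    using \<Omega>m lists_lebesgue(1)[OF pl] lists_lebesgue(2)[OF lists] by (auto intro!: simple_function_simple_field)
  have meas: "(\<lambda>x. norm (simple_field (p # l) x - simple_field ?l x)) \<in> borel_measurable (lebesgue_on \<Omega>)"
    by (rule borel_measurable_simple_function, rule simple_function_compose2[OF sf])
  have split: "simple_field (p # l) x - simple_field ?l x
      = (indicator A x - indicator B x) *\<^sub>R t + (simple_field l x - simple_field l' x)" for x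
    by (simp add: p scaleR_left_diff_distrib)
  note h = integral_norm_add_square[OF meas split i1 l'(2)]
  show ?case
    by (rule bexI[OF _ lists]) (use h v1 l'(3) in linarith)
qed

theorem simple_field_dense:
  fixes \<phi> :: "real^'n \<Rightarrow> 'b::real_normed_vector"
  assumes \<Omega>: "open \<Omega>" "bounded \<Omega>" and \<phi>: "\<phi> \<in> L2_on \<Omega>"
    and T: "countable T" "0 \<in> T"
    and dense: "AE x in lebesgue_on \<Omega>. \<forall>e>0. \<exists>t\<in>T. norm (\<phi> x - t) < e"
    and e: "e > 0"
  obtains l where "l \<in> lists (box_unions \<Omega> \<times> T)"
    "integrable (lebesgue_on \<Omega>) (\<lambda>x. (norm (\<phi> x - simple_field l x))\<^sup>2)"
    "(\<integral>x. (norm (\<phi> x - simple_field l x))\<^sup>2 \<partial>lebesgue_on \<Omega>) < e"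
proof -
  have \<Omega>m: "\<Omega> \<in> lmeasurable" using \<Omega> by (auto intro: lmeasurable_open)
  have e4: "e/4 > 0" using e by simp
  obtain l where l: "l \<in> lists ({A \<in> lmeasurable. A \<subseteq> \<Omega>} \<times> T)"
    "integrable (lebesgue_on \<Omega>) (\<lambda>x. (norm (\<phi> x - simple_field l x))\<^sup>2)"
    "(\<integral>x. (norm (\<phi> x - simple_field l x))\<^sup>2 \<partial>lebesgue_on \<Omega>) < e/4"
    using simple_field_dense_measurable[OF \<Omega>m \<phi> T dense e4] by blast
  obtain l' where l': "l' \<in> lists (box_unions \<Omega> \<times> T)"
    "integrable (lebesgue_on \<Omega>) (\<lambda>x. (norm (simple_field l x - simple_field l' x))\<^sup>2)"
    "(\<integral>x. (norm (simple_field l x - simple_field l' x))\<^sup>2 \<partial>lebesgue_on \<Omega>) < e/4"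
    using simple_field_dense_boxes[OF \<Omega> l(1) e4] by blast
  have meas: "(\<lambda>x. norm (\<phi> x - simple_field l' x)) \<in> borel_measurable (lebesgue_on \<Omega>)"
    using \<phi> \<Omega>m lists_lebesgue(2)[OF l'(1)]
    by (intro borel_measurable_norm_diff_simple simple_function_simple_field) (auto simp: L2_on_def)
  have split: "\<phi> x - simple_field l' x = (\<phi> x - simple_field l x) + (simple_field l x - simple_field l' x)" for x
    by simp
  note h = integral_norm_add_square[OF meas split l(2) l'(2)]
  show ?thesis
    by (rule that[OF l'(1) h(1)]) (use h(2) l(3) l'(3) in linarith)
qed


section \<open>Functions on the product of the domain and the cell\<close>

lemma borel_measurable_lebesgue_on:
  "f \<in> borel_measurable borel \<Longrightarrow> f \<in> borel_measurable (lebesgue_on S)"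
  by (intro measurable_restrict_space1 measurable_completion) simp

text \<open>Borel functions on the product space have Borel sections, so Fubini's theorem applies to them
  directly, which fails for functions that are only Lebesgue measurable.\<close>

lemma borel_representative:
  fixes f :: "'a::euclidean_space \<Rightarrow> real"
  assumes S: "S \<in> sets borel" and f: "f \<in> borel_measurable (lebesgue_on S)"
  obtains g where "g \<in> borel_measurable borel" "\<And>x. x \<notin> S \<Longrightarrow> g x = 0" "AE x in lebesgue_on S. f x = g x"
proof -
  have S': "S \<inter> space lebesgue \<in> sets lebesgue" using S by simp
  have "(\<lambda>x. indicator S x *\<^sub>R f x) \<in> borel_measurable lebesgue"
    using f by (simp only: borel_measurable_restrict_space_iff[OF S'])
  from completion_ex_borel_measurable_real[OF this]
  obtain g where g: "g \<in> borel_measurable lborel" "AE x in lborel. indicator S x *\<^sub>R f x = g x" by blast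
  show ?thesis
  proof (rule that[of "\<lambda>x. indicator S x * g x"])
    show "(\<lambda>x. indicator S x * g x) \<in> borel_measurable borel" using g(1) S by simp
    have "AE x in lebesgue. indicator S x *\<^sub>R f x = g x" using AE_completion[OF g(2)] .
    then have "AE x in lebesgue. x \<in> S \<longrightarrow> f x = indicator S x * g x" by eventually_elim auto
    then show "AE x in lebesgue_on S. f x = indicator S x * g x"
      by (simp add: AE_restrict_space_iff[OF S'])
  qed auto
qed

lemma lebesgue_on_borel_integral:
  fixes f :: "'a::euclidean_space \<Rightarrow> 'b::{banach, second_countable_topology}"
  assumes S: "S \<in> sets borel" and f: "f \<in> borel_measurable borel" and z: "\<And>x. x \<notin> S \<Longrightarrow> f x = 0"
  shows "integrable (lebesgue_on S) f \<longleftrightarrow> integrable lborel f"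
    and "(\<integral>x. f x \<partial>lebesgue_on S) = (\<integral>x. f x \<partial>lborel)"
proof -
  have S': "S \<inter> space lebesgue \<in> sets lebesgue" using S by simp
  have e: "(\<lambda>x. indicator S x *\<^sub>R f x) = f" using z by (auto simp: indicator_def)
  show "integrable (lebesgue_on S) f \<longleftrightarrow> integrable lborel f"
    unfolding integrable_restrict_space[OF S'] e using f by (simp add: integrable_completion)
  show "(\<integral>x. f x \<partial>lebesgue_on S) = (\<integral>x. f x \<partial>lborel)"
    unfolding integral_restrict_space[OF S'] e using f by (simp add: integral_completion)
qed

text \<open>A Borel null set in the first factor times the whole second factor is a null set of the product.\<close>

lemma AE_lebesgue_on_fst:
  fixes \<Omega> :: "'a::euclidean_space set" and S :: "'b::euclidean_space set"
  assumes \<Omega>: "\<Omega> \<in> sets borel" and S: "S \<in> sets borel" and P: "AE x in lebesgue_on \<Omega>. P x"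
  shows "AE z in lebesgue_on (\<Omega> \<times> S). P (fst z)"
proof -
  have \<Omega>': "\<Omega> \<inter> space lebesgue \<in> sets lebesgue" using \<Omega> by simp
  have "\<Omega> \<times> S \<in> sets borel" using \<Omega> S by (rule borel_Times)
  then have D': "(\<Omega> \<times> S) \<inter> space lebesgue \<in> sets lebesgue" by simp
  have "AE x in lborel. x \<in> \<Omega> \<longrightarrow> P x"
    using P by (simp only: AE_restrict_space_iff[OF \<Omega>'] AE_completion_iff)
  then obtain N where N: "{x \<in> space lborel. \<not> (x \<in> \<Omega> \<longrightarrow> P x)} \<subseteq> N" "emeasure lborel N = 0" "N \<in> sets lborel"
    by (rule AE_E)
  have "emeasure (lborel \<Otimes>\<^sub>M lborel) (N \<times> (UNIV :: 'b set)) = emeasure lborel N * emeasure lborel (UNIV :: 'b set)"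
    by (rule lborel.emeasure_pair_measure_Times) (use N(3) in auto)
  then have "emeasure (lborel :: ('a \<times> 'b) measure) (N \<times> UNIV) = 0"
    unfolding lborel_prod by (simp add: N(2))
  moreover have "N \<times> (UNIV :: 'b set) \<in> sets lborel" using N(3) borel_Times[of N "UNIV :: 'b set"] by simp
  ultimately have "N \<times> (UNIV :: 'b set) \<in> null_sets lborel" by (simp add: null_sets_def)
  then have "AE z in lborel. z \<notin> N \<times> (UNIV :: 'b set)" by (rule AE_not_in)
  then have "AE z in lborel. z \<in> \<Omega> \<times> S \<longrightarrow> P (fst z)"
    by eventually_elim (use N(1) in auto)
  then show ?thesis by (simp only: AE_restrict_space_iff[OF D'] AE_completion_iff)
qed

lemma product_integral_lborel:
  fixes g :: "'a::euclidean_space \<Rightarrow> real" and h :: "'b::euclidean_space \<Rightarrow> real"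
  assumes g: "integrable lborel g" and h: "integrable lborel h"
  shows "integrable lborel (\<lambda>z. g (fst z) * h (snd z))"
    and "(\<integral>z. g (fst z) * h (snd z) \<partial>lborel) = (\<integral>x. g x \<partial>lborel) * (\<integral>y. h y \<partial>lborel)"
proof -
  have [measurable]: "g \<in> borel_measurable borel" "h \<in> borel_measurable borel" using g h by auto
  have m: "(\<lambda>z. g (fst z) * h (snd z)) \<in> borel_measurable (lborel \<Otimes>\<^sub>M lborel)" by measurable
  have i: "integrable (lborel \<Otimes>\<^sub>M lborel) (\<lambda>z. g (fst z) * h (snd z))"
  proof (rule integrableI_bounded[OF m])
    have "(\<integral>\<^sup>+z. ennreal (norm (g (fst z) * h (snd z))) \<partial>(lborel \<Otimes>\<^sub>M lborel))
        = (\<integral>\<^sup>+x. \<integral>\<^sup>+y. ennreal (norm (g x)) * ennreal (norm (h y)) \<partial>lborel \<partial>lborel)"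
      by (subst lborel.nn_integral_fst[symmetric]) (auto simp: abs_mult ennreal_mult intro!: nn_integral_cong)
    also have "\<dots> = (\<integral>\<^sup>+x. ennreal (norm (g x)) \<partial>lborel) * (\<integral>\<^sup>+y. ennreal (norm (h y)) \<partial>lborel)"
      by (simp add: nn_integral_cmult nn_integral_multc)
    also have "\<dots> < \<infinity>"
      using g h unfolding integrable_iff_bounded by (auto intro: ennreal_mult_less_top[THEN iffD2])
    finally show "(\<integral>\<^sup>+z. ennreal (norm (g (fst z) * h (snd z))) \<partial>(lborel \<Otimes>\<^sub>M lborel)) < \<infinity>" .
  qed
  then show "integrable lborel (\<lambda>z. g (fst z) * h (snd z))" by (simp add: lborel_prod)
  have "(\<integral>z. g (fst z) * h (snd z) \<partial>(lborel \<Otimes>\<^sub>M lborel)) = (\<integral>x. \<integral>y. g x * h y \<partial>lborel \<partial>lborel)"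
    using lborel_pair.integral_fst'[OF i] by simp
  then show "(\<integral>z. g (fst z) * h (snd z) \<partial>lborel) = (\<integral>x. g x \<partial>lborel) * (\<integral>y. h y \<partial>lborel)"
    by (simp add: lborel_prod)
qed

lemma integral_lebesgue_on_fst:
  fixes \<Omega> :: "'a::euclidean_space set" and g :: "'a \<Rightarrow> real"
  assumes \<Omega>: "\<Omega> \<in> sets borel" and g: "integrable (lebesgue_on \<Omega>) g"
  shows "(\<lambda>z. g (fst z)) \<in> borel_measurable (lebesgue_on (\<Omega> \<times> (cell :: (real^'m) set)))"
    and "integrable (lebesgue_on (\<Omega> \<times> (cell :: (real^'m) set))) (\<lambda>z. g (fst z))"
    and "(\<integral>z. g (fst z) \<partial>lebesgue_on (\<Omega> \<times> (cell :: (real^'m) set))) = (\<integral>x. g x \<partial>lebesgue_on \<Omega>)"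
proof -
  let ?D = "\<Omega> \<times> (cell :: (real^'m) set)"
  have D: "?D \<in> sets borel" using \<Omega> by (intro borel_Times) auto
  interpret complete_measure "lebesgue_on ?D" by (rule complete_measure_lebesgue_on) (use D in auto)
  obtain h where h: "h \<in> borel_measurable borel" "\<And>x. x \<notin> \<Omega> \<Longrightarrow> h x = 0" "AE x in lebesgue_on \<Omega>. g x = h x"
    using borel_representative[OF \<Omega>] g by blast
  have gm: "g \<in> borel_measurable (lebesgue_on \<Omega>)" using g by auto
  have hm: "h \<in> borel_measurable (lebesgue_on \<Omega>)" by (rule borel_measurable_lebesgue_on[OF h(1)])
  have "integrable (lebesgue_on \<Omega>) h" using integrable_cong_AE[OF gm hm h(3)] g by simp
  then have hi: "integrable lborel h" using lebesgue_on_borel_integral(1)[OF \<Omega> h(1,2)] by simp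
  have ci: "integrable lborel (indicator (cell :: (real^'m) set) :: _ \<Rightarrow> real)"
    by (simp add: integrable_indicator_iff emeasure_cell)
  define H where "H z = h (fst z) * indicator (cell :: (real^'m) set) (snd z)" for z
  have Hb: "H \<in> borel_measurable borel"
    using product_integral_lborel(1)[OF hi ci] by (auto simp: H_def[abs_def] dest: borel_measurable_integrable)
  have Hz: "z \<notin> ?D \<Longrightarrow> H z = 0" for z using h(2)[of "fst z"] by (cases z) (auto simp: H_def indicator_def)
  have Hi: "integrable (lebesgue_on ?D) H" "(\<integral>z. H z \<partial>lebesgue_on ?D) = (\<integral>x. h x \<partial>lborel)"
    using lebesgue_on_borel_integral[OF D Hb Hz] product_integral_lborel[OF hi ci]
    by (simp_all add: H_def[abs_def] measure_cell)
  have "AE z in lebesgue_on ?D. g (fst z) = h (fst z)"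
    by (rule AE_lebesgue_on_fst[OF \<Omega> _ h(3)]) simp
  then have ae: "AE z in lebesgue_on ?D. H z = g (fst z)"
    using AE_space by eventually_elim (auto simp: H_def)
  show m: "(\<lambda>z. g (fst z)) \<in> borel_measurable (lebesgue_on ?D)"
    by (rule borel_measurable_AE_eq[OF _ ae]) (use Hi in auto)
  have Hm: "H \<in> borel_measurable (lebesgue_on ?D)" using Hi(1) by auto
  show "integrable (lebesgue_on ?D) (\<lambda>z. g (fst z))"
    using integrable_cong_AE[OF Hm m ae] Hi(1) by simp
  have "(\<integral>z. g (fst z) \<partial>lebesgue_on ?D) = (\<integral>x. h x \<partial>lborel)"
    using integral_cong_AE[OF Hm m ae] Hi(2) by simp
  also have "\<dots> = (\<integral>x. h x \<partial>lebesgue_on \<Omega>)"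
    by (rule lebesgue_on_borel_integral(2)[OF \<Omega> h(1,2), symmetric])
  also have "\<dots> = (\<integral>x. g x \<partial>lebesgue_on \<Omega>)"
    by (rule integral_cong_AE[OF gm hm h(3), symmetric])
  finally show "(\<integral>z. g (fst z) \<partial>lebesgue_on ?D) = (\<integral>x. g x \<partial>lebesgue_on \<Omega>)" .
qed

section \<open>Extraction of subsequences\<close>

text \<open>Tychonoff's theorem and first countability of \<open>\<real>\<^sup>\<nat>\<close> replace the explicit diagonal argument: a product
  of compact intervals is sequentially compact for pointwise convergence.\<close>

lemma diagonal_convergent_subsequence:
  fixes a :: "nat \<Rightarrow> nat \<Rightarrow> real"
  assumes "\<And>n i. \<bar>a n i\<bar> \<le> K i"
  obtains r :: "nat \<Rightarrow> nat" where "strict_mono r" "\<And>i. convergent (\<lambda>n. a (r n) i)"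
proof -
  define S where "S = (\<Pi>\<^sub>E i\<in>(UNIV :: nat set). {- K i..K i})"
  have "compactin (product_topology (\<lambda>i. euclidean) UNIV) S"
    unfolding S_def by (subst compactin_PiE) auto
  then have "compact S" by (simp add: euclidean_product_topology)
  then have "seq_compact S" by (rule compact_imp_seq_compact)
  moreover have "\<forall>n. a n \<in> S" using assms by (auto simp: S_def abs_le_iff minus_le_iff)
  ultimately obtain l r where lr: "l \<in> S" "strict_mono r" "(a \<circ> r) \<longlonglongrightarrow> l" by (rule seq_compactE)
  have "(\<lambda>n. a (r n) i) \<longlonglongrightarrow> l i" for i
  proof -
    have "isCont (\<lambda>x :: nat \<Rightarrow> real. x i) l"
      by (rule continuous_on_interior[OF continuous_on_product_coordinates]) simp
    from isCont_tendsto_compose[OF this lr(3)] show ?thesis by simp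
  qed
  then show ?thesis using that[OF lr(2)] by (auto simp: convergent_def)
qed

lemma convergent_if_uniformly_approximable:
  fixes X :: "nat \<Rightarrow> real"
  assumes "\<And>e. e > 0 \<Longrightarrow> \<exists>Y. convergent Y \<and> (\<forall>n. \<bar>X n - Y n\<bar> \<le> e)"
  shows "convergent X"
proof -
  have "Cauchy X"
  proof (rule metric_CauchyI)
    fix e :: real assume e: "e > 0"
    obtain Y where Y: "convergent Y" "\<And>n. \<bar>X n - Y n\<bar> \<le> e/4" using assms[of "e/4"] e by auto
    have "Cauchy Y" using Y(1) by (rule convergent_Cauchy)
    then obtain M where M: "\<And>m n. m \<ge> M \<Longrightarrow> n \<ge> M \<Longrightarrow> dist (Y m) (Y n) < e/4"
      using metric_CauchyD[of Y "e/4"] e by auto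
    have "dist (X m) (X n) < e" if "m \<ge> M" "n \<ge> M" for m n
      using M[OF that] Y(2)[of m] Y(2)[of n] e unfolding dist_real_def by linarith
    then show "\<exists>M. \<forall>m\<ge>M. \<forall>n\<ge>M. dist (X m) (X n) < e" by blast
  qed
  then show ?thesis by (simp add: Cauchy_convergent_iff)
qed

definition two_variable :: "('a set \<times> ('b::topological_space \<Rightarrow>\<^sub>C real)) list \<Rightarrow> 'a \<times> 'b \<Rightarrow> real" where
  "two_variable l z = apply_bcontfun (simple_field l (fst z)) (snd z)"

lemma two_variable_Nil [simp]: "two_variable [] z = 0"
  and two_variable_Cons [simp]: "two_variable ((A, t) # l) z = indicator A (fst z) * apply_bcontfun t (snd z) + two_variable l z"
  and two_variable_append: "two_variable (l @ l') z = two_variable l z + two_variable l' z"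
  by (simp_all add: two_variable_def simple_field_append)

lemma two_variable_scale: "two_variable (map (\<lambda>(A, t). (A, c *\<^sub>R t)) l) z = c * two_variable l z"
  by (simp add: two_variable_def simple_field_scale)

lemma two_variable_borel:
  fixes l :: "((real^'n) set \<times> ((real^'m) \<Rightarrow>\<^sub>C real)) list"
  assumes "l \<in> lists (box_unions \<Omega> \<times> T)"
  shows "two_variable l \<in> borel_measurable borel"
  using assms
proof (induction l)
  case Nil
  then show ?case by (simp add: two_variable_Nil[abs_def])
next
  case (Cons p l)
  obtain A t where p: "p = (A, t)" "A \<in> box_unions \<Omega>" using Cons.hyps by auto
  have [measurable]: "A \<in> sets borel" "two_variable l \<in> borel_measurable borel"
    using box_unionsD(4)[OF p(2)] Cons.IH by auto
  have "(\<lambda>z. indicator A (fst z) * apply_bcontfun t (snd z) + two_variable l z) \<in> borel_measurable (borel \<Otimes>\<^sub>M borel)"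
    by (intro borel_measurable_add borel_measurable_times) (measurable, simp add: borel_prod)
  then show ?case by (simp add: p borel_prod)
qed

lemma two_variable_bounded:
  "\<exists>B. \<forall>z. \<bar>two_variable l z\<bar> \<le> B"
proof (induction l)
  case Nil
  then show ?case by auto
next
  case (Cons p l)
  then obtain B where B: "\<And>z. \<bar>two_variable l z\<bar> \<le> B" by blast
  obtain A t where p: "p = (A, t)" by (cases p)
  have "\<bar>indicator A (fst z) * apply_bcontfun t (snd z)\<bar> \<le> norm t" for z
    using abs_bcontfun_le[of t "snd z"] by (auto simp: indicator_def intro: order.trans[OF abs_ge_zero])
  then have "\<bar>two_variable (p # l) z\<bar> \<le> norm t + B" for z
    unfolding p two_variable_Cons by (intro order.trans[OF abs_triangle_ineq] add_mono B)
  then show ?case by blast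
qed

lemma C_per_mult:
  assumes "s \<in> C_per" "t \<in> C_per"
  obtains p where "p \<in> C_per" "\<And>y. apply_bcontfun p y = apply_bcontfun s y * apply_bcontfun t y"
proof -
  have "(\<lambda>y. apply_bcontfun s y * apply_bcontfun t y) \<in> bcontfun"
  proof (rule bcontfun_normI[where b = "norm s * norm t"])
    show "norm (apply_bcontfun s y * apply_bcontfun t y) \<le> norm s * norm t" for y
      unfolding norm_mult by (intro mult_mono norm_bounded) auto
  qed (intro continuous_intros continuous_on_apply_bcontfun)
  then have "apply_bcontfun (Bcontfun (\<lambda>y. apply_bcontfun s y * apply_bcontfun t y)) y = apply_bcontfun s y * apply_bcontfun t y" for y
    by (simp add: Bcontfun_inverse)
  then show ?thesis using that[of "Bcontfun (\<lambda>y. apply_bcontfun s y * apply_bcontfun t y)"] assms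
    by (auto simp: C_per_def periodic_def)
qed


section \<open>Two-scale compactness\<close>

locale oscillation_domain = oscillation R \<eta> for R :: "real^'d^'m" and \<eta> :: "nat \<Rightarrow> real" +
  fixes \<Omega> :: "(real^'d) set"
  assumes open_dom: "open \<Omega>" and bounded_dom: "bounded \<Omega>"
begin

abbreviation D :: "((real^'d) \<times> (real^'m)) set" where "D \<equiv> \<Omega> \<times> cell"

abbreviation box_fields :: "(((real^'d) set) \<times> ((real^'m) \<Rightarrow>\<^sub>C real)) list set" where
  "box_fields \<equiv> lists (box_unions \<Omega> \<times> C_per)"

lemma dom_borel: "\<Omega> \<in> sets borel" using open_dom by auto

lemma dom_lmeasurable: "\<Omega> \<in> lmeasurable" using open_dom bounded_dom by (auto intro: lmeasurable_open)

lemma D_borel: "D \<in> sets borel" using dom_borel by (intro borel_Times) auto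

lemma D_lmeasurable: "D \<in> lmeasurable"
proof (rule bounded_set_imp_lmeasurable)
  show "bounded D" using bounded_dom by (intro bounded_Times) (auto simp: cell_def)
  show "D \<in> sets lebesgue" using D_borel by simp
qed

lemma pair_fast_borel: "(\<lambda>x. (x, fast n x)) \<in> borel_measurable borel"
  unfolding borel_prod[symmetric] by measurable

lemma at_fast_borel:
  assumes "f \<in> borel_measurable borel"
  shows "(\<lambda>x. f (x, fast n x)) \<in> borel_measurable (lebesgue_on \<Omega>)"
  by (rule borel_measurable_lebesgue_on[OF measurable_compose[OF pair_fast_borel assms]])

lemma square_integrable_bounded_borel:
  fixes f :: "(real^'d) \<times> (real^'m) \<Rightarrow> real"
  assumes f: "f \<in> borel_measurable borel" and B: "\<And>z. \<bar>f z\<bar> \<le> B"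
  shows "square_integrable (lebesgue_on \<Omega>) (\<lambda>x. f (x, fast n x))"
    and "square_integrable (lebesgue_on D) f"
  by (rule square_integrable_bounded_function[OF dom_lmeasurable at_fast_borel[OF f] B])
    (rule square_integrable_bounded_function[OF D_lmeasurable borel_measurable_lebesgue_on[OF f] B])

lemma integrable_bounded_borel:
  fixes f :: "(real^'d) \<times> (real^'m) \<Rightarrow> real"
  assumes f: "f \<in> borel_measurable borel" and B: "\<And>z. \<bar>f z\<bar> \<le> B"
  shows "integrable (lebesgue_on \<Omega>) (\<lambda>x. f (x, fast n x))"
    and "integrable (lebesgue_on D) f"
proof -
  have 1: "square_integrable (lebesgue_on \<Omega>) (\<lambda>x. 1)" "square_integrable (lebesgue_on D) (\<lambda>x. 1)"
    by (auto intro: square_integrable_bounded_function[OF dom_lmeasurable, where B = 1]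
        square_integrable_bounded_function[OF D_lmeasurable, where B = 1])
  show "integrable (lebesgue_on \<Omega>) (\<lambda>x. f (x, fast n x))"
    using square_integrable_mult[OF square_integrable_bounded_borel(1)[OF f B] 1(1)] by simp
  show "integrable (lebesgue_on D) f"
    using square_integrable_mult[OF square_integrable_bounded_borel(2)[OF f B] 1(2)] by simp
qed

text \<open>Boundedness is included in order that \<open>F\<close> is integrable on both domains, which additivity of
  this property needs.\<close>

definition averages :: "((real^'d) \<times> (real^'m) \<Rightarrow> real) \<Rightarrow> bool" where
  "averages F \<longleftrightarrow> F \<in> borel_measurable borel \<and> (\<exists>B. \<forall>z. \<bar>F z\<bar> \<le> B) \<and>
    (\<lambda>n. \<integral>x. F (x, fast n x) \<partial>lebesgue_on \<Omega>) \<longlonglongrightarrow> (\<integral>z. F z \<partial>lebesgue_on D)"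

lemma averages_zero: "averages (\<lambda>z. 0)"
  unfolding averages_def by auto

lemma averages_add:
  assumes F: "averages F" and G: "averages G"
  shows "averages (\<lambda>z. F z + G z)"
proof -
  obtain B C where B: "\<And>z. \<bar>F z\<bar> \<le> B" and C: "\<And>z. \<bar>G z\<bar> \<le> C" using F G unfolding averages_def by blast
  have Fm: "F \<in> borel_measurable borel" and Gm: "G \<in> borel_measurable borel" using F G unfolding averages_def by auto
  have "\<bar>F z + G z\<bar> \<le> B + C" for z using B[of z] C[of z] by linarith
  moreover have "(\<lambda>n. \<integral>x. F (x, fast n x) + G (x, fast n x) \<partial>lebesgue_on \<Omega>) \<longlonglongrightarrow> (\<integral>z. F z + G z \<partial>lebesgue_on D)"
    using tendsto_add[of "\<lambda>n. \<integral>x. F (x, fast n x) \<partial>lebesgue_on \<Omega>"] F G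
    by (simp add: averages_def integrable_bounded_borel[OF Fm B] integrable_bounded_borel[OF Gm C])
  ultimately show ?thesis unfolding averages_def using Fm Gm by (intro conjI borel_measurable_add) blast+
qed

lemma averages_product:
  assumes A: "A \<in> sets borel" "A \<subseteq> \<Omega>" and t: "t \<in> C_per"
  shows "averages (\<lambda>z. indicator A (fst z) * apply_bcontfun t (snd z))"
proof -
  let ?F = "\<lambda>z. indicator A (fst z) * apply_bcontfun t (snd z) :: real"
  have bA: "bounded A" using A(2) bounded_dom by (rule bounded_subset[rotated])
  have "(\<lambda>z. ?F z) \<in> borel_measurable (borel \<Otimes>\<^sub>M borel)" using A(1) by measurable
  then have Fm: "?F \<in> borel_measurable borel" by (simp add: borel_prod)
  have B: "\<bar>?F z\<bar> \<le> norm t" for z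
    using abs_bcontfun_le[of t "snd z"] by (auto simp: indicator_def intro: order.trans[OF abs_ge_zero])
  have left: "(\<integral>x. ?F (x, fast n x) \<partial>lebesgue_on \<Omega>) = (\<integral>x. indicator A x * apply_bcontfun t (fast n x) \<partial>lborel)" for n
  proof -
    have "(\<lambda>x. indicator A x * apply_bcontfun t (fast n x)) \<in> borel_measurable borel"
      using measurable_compose[OF pair_fast_borel Fm, of n] by simp
    then show ?thesis
      using lebesgue_on_borel_integral(2)[OF dom_borel, of "\<lambda>x. indicator A x * apply_bcontfun t (fast n x)"] A(2)
      by (auto simp: indicator_def)
  qed
  let ?G = "\<lambda>z. indicator A (fst z) * (indicator cell (snd z) * apply_bcontfun t (snd z)) :: real"
  have iA: "integrable lborel (indicator A :: _ \<Rightarrow> real)"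
    using A(1) emeasure_bounded_finite[OF bA] by (simp add: integrable_indicator_iff)
  have it: "integrable lborel (\<lambda>y. indicator cell y * apply_bcontfun t y)"
    by (rule integrable_on_bounded_borel[where B = "norm t"]) (auto simp: abs_bcontfun_le emeasure_cell)
  note P = product_integral_lborel[OF iA it]
  have "(\<integral>z. ?F z \<partial>lebesgue_on D) = (\<integral>z. ?G z \<partial>lebesgue_on D)"
    by (rule Bochner_Integration.integral_cong) (auto simp: indicator_def)
  also have "\<dots> = (\<integral>z. ?G z \<partial>lborel)"
    using P(1) A(2) by (intro lebesgue_on_borel_integral(2)[OF D_borel])
      (auto simp: indicator_def dest: borel_measurable_integrable)
  also have "\<dots> = measure lborel A * (\<integral>y. indicator cell y * apply_bcontfun t y \<partial>lborel)"
    unfolding P(2) using A(1) by simp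
  finally have "(\<lambda>n. \<integral>x. ?F (x, fast n x) \<partial>lebesgue_on \<Omega>) \<longlonglongrightarrow> (\<integral>z. ?F z \<partial>lebesgue_on D)"
    using mean_value_C_per[OF A(1) bA t] unfolding mean_value_def left by simp
  moreover have "\<exists>B. \<forall>z. \<bar>?F z\<bar> \<le> B" using B by (intro exI[of _ "norm t"]) blast
  ultimately show ?thesis unfolding averages_def using Fm by blast
qed

lemma averages_two_variable_mult:
  assumes "l \<in> box_fields" "l' \<in> box_fields"
  shows "averages (\<lambda>z. two_variable l z * two_variable l' z)"
  using assms(1)
proof (induction l)
  case Nil
  then show ?case by (simp add: averages_zero)
next
  case (Cons p l)
  obtain A s where p: "p = (A, s)" "A \<in> box_unions \<Omega>" "s \<in> C_per" using Cons.hyps by auto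
  have "averages (\<lambda>z. (indicator A (fst z) * apply_bcontfun s (snd z)) * two_variable l' z)"
    using assms(2)
  proof (induction l')
    case Nil
    then show ?case by (simp add: averages_zero)
  next
    case (Cons q l')
    obtain B t where q: "q = (B, t)" "B \<in> box_unions \<Omega>" "t \<in> C_per" using Cons.hyps by auto
    obtain w where w: "w \<in> C_per" "\<And>y. apply_bcontfun w y = apply_bcontfun s y * apply_bcontfun t y"
      using C_per_mult[OF p(3) q(3)] by blast
    have "averages (\<lambda>z. indicator (A \<inter> B) (fst z) * apply_bcontfun w (snd z))"
      using box_unionsD(4)[OF p(2)] box_unionsD(4)[OF q(2)] box_unionsD(2)[OF p(2)]
      by (intro averages_product w) auto
    from averages_add[OF this Cons.IH] show ?case
      by (simp add: q w indicator_inter_arith algebra_simps)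
  qed
  from averages_add[OF this Cons.IH] show ?case by (simp add: p distrib_right)
qed

lemma box_field_borel_bounded:
  assumes "l \<in> box_fields"
  obtains B where "two_variable l \<in> borel_measurable borel" "\<And>z. \<bar>two_variable l z\<bar> \<le> B"
  using two_variable_borel[OF assms] two_variable_bounded[of l] by blast

lemma box_field_square_integrable:
  assumes "l \<in> box_fields"
  shows "square_integrable (lebesgue_on \<Omega>) (\<lambda>x. two_variable l (x, fast n x))"
    and "square_integrable (lebesgue_on D) (two_variable l)"
proof -
  obtain B where B: "two_variable l \<in> borel_measurable borel" "\<And>z. \<bar>two_variable l z\<bar> \<le> B"
    using box_field_borel_bounded[OF assms] by blast
  show "square_integrable (lebesgue_on \<Omega>) (\<lambda>x. two_variable l (x, fast n x))"
    "square_integrable (lebesgue_on D) (two_variable l)"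
    by (rule square_integrable_bounded_borel[OF B])+
qed

text \<open>A test function is only known to be measurable as a map into the continuous periodic functions. Step
  functions converging to it almost everywhere in the uniform norm show that its values on the product
  and along the fast variable are measurable. The last part says that the approximation is uniform in
  \<open>n\<close>: along the fast variable the difference is dominated pointwise by its uniform norm.\<close>

lemma admissible_square_integrable:
  fixes \<phi> :: "real^'d \<Rightarrow> ((real^'m) \<Rightarrow>\<^sub>C real)"
  assumes \<phi>: "\<phi> \<in> L2_on \<Omega>" and per: "AE x in lebesgue_on \<Omega>. \<phi> x \<in> C_per"
  shows "square_integrable (lebesgue_on \<Omega>) (\<lambda>x. apply_bcontfun (\<phi> x) (fast n x))"
    and "square_integrable (lebesgue_on D) (\<lambda>z. apply_bcontfun (\<phi> (fst z)) (snd z))"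
    and "\<And>e. e > 0 \<Longrightarrow> \<exists>l\<in>box_fields.
      (\<forall>n. (\<integral>x. (apply_bcontfun (\<phi> x) (fast n x) - two_variable l (x, fast n x))\<^sup>2 \<partial>lebesgue_on \<Omega>) \<le> e) \<and>
      (\<integral>z. (apply_bcontfun (\<phi> (fst z)) (snd z) - two_variable l z)\<^sup>2 \<partial>lebesgue_on D) \<le> e"
proof -
  obtain T :: "((real^'m) \<Rightarrow>\<^sub>C real) set" where T: "countable T" "T \<subseteq> C_per" "0 \<in> T"
    "\<And>f e. f \<in> C_per \<Longrightarrow> e > 0 \<Longrightarrow> \<exists>t\<in>T. norm (f - t) < e"
    using C_per_separable by blast
  have dense: "AE x in lebesgue_on \<Omega>. \<forall>e>0. \<exists>t\<in>T. norm (\<phi> x - t) < e"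
    using per by eventually_elim (use T(4) in blast)
  define \<delta> where "\<delta> l x = (norm (\<phi> x - simple_field l x))\<^sup>2" for l x
  have approx: "\<exists>l. l \<in> box_fields \<and> integrable (lebesgue_on \<Omega>) (\<delta> l) \<and> (\<integral>x. \<delta> l x \<partial>lebesgue_on \<Omega>) < e" if e: "e > 0" for e
  proof -
    obtain l where l: "l \<in> lists (box_unions \<Omega> \<times> T)" "integrable (lebesgue_on \<Omega>) (\<delta> l)"
      "(\<integral>x. \<delta> l x \<partial>lebesgue_on \<Omega>) < e"
      using simple_field_dense[OF open_dom bounded_dom \<phi> T(1,3) dense e] unfolding \<delta>_def[abs_def] by blast
    have "l \<in> box_fields" using l(1) T(2) lists_mono[of "box_unions \<Omega> \<times> T" "box_unions \<Omega> \<times> C_per"] by blast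
    with l show ?thesis by blast
  qed
  then have "\<forall>k. \<exists>l. l \<in> box_fields \<and> integrable (lebesgue_on \<Omega>) (\<delta> l) \<and> (\<integral>x. \<delta> l x \<partial>lebesgue_on \<Omega>) < inverse (real (Suc k))"
    by simp
  then obtain ls where ls: "\<And>k. ls k \<in> box_fields" "\<And>k. integrable (lebesgue_on \<Omega>) (\<delta> (ls k))"
    "\<And>k. (\<integral>x. \<delta> (ls k) x \<partial>lebesgue_on \<Omega>) < inverse (real (Suc k))" by metis
  have "(\<lambda>k. \<integral>x. norm (\<delta> (ls k) x) \<partial>lebesgue_on \<Omega>) \<longlonglongrightarrow> 0"
  proof (rule tendsto_sandwich[OF _ _ tendsto_const LIMSEQ_inverse_real_of_nat])
    show "\<forall>\<^sub>F k in sequentially. (\<integral>x. norm (\<delta> (ls k) x) \<partial>lebesgue_on \<Omega>) \<le> inverse (real (Suc k))"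
      using ls(3) by (intro always_eventually allI) (auto simp: \<delta>_def intro: less_imp_le)
  qed simp
  from tendsto_L1_AE_subseq[OF ls(2) this]
  obtain q where q: "AE x in lebesgue_on \<Omega>. (\<lambda>k. \<delta> (ls (q k)) x) \<longlonglongrightarrow> 0" by blast
  have conv: "AE x in lebesgue_on \<Omega>. \<forall>y. (\<lambda>k. two_variable (ls (q k)) (x, y)) \<longlonglongrightarrow> apply_bcontfun (\<phi> x) y"
    using q
  proof eventually_elim
    case (elim x)
    have nrm: "(\<lambda>k. norm (\<phi> x - simple_field (ls (q k)) x)) \<longlonglongrightarrow> 0"
      using tendsto_real_sqrt[OF elim] by (simp add: \<delta>_def)
    show ?case
    proof
      fix y
      show "(\<lambda>k. two_variable (ls (q k)) (x, y)) \<longlonglongrightarrow> apply_bcontfun (\<phi> x) y"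
      proof (rule LIM_zero_cancel, rule Lim_null_comparison[OF always_eventually nrm], rule allI)
        fix k
        show "norm (two_variable (ls (q k)) (x, y) - apply_bcontfun (\<phi> x) y) \<le> norm (\<phi> x - simple_field (ls (q k)) x)"
          using abs_bcontfun_le[of "\<phi> x - simple_field (ls (q k)) x" y]
          by (simp add: two_variable_def abs_minus_commute)
      qed
    qed
  qed
  have tv: "two_variable (ls (q k)) \<in> borel_measurable borel" for k
    using two_variable_borel[OF ls(1)] .
  have m1: "(\<lambda>x. apply_bcontfun (\<phi> x) (fast n x)) \<in> borel_measurable (lebesgue_on \<Omega>)" for n
  proof (rule borel_measurable_lebesgue_on_AE_limit)
    show "(\<lambda>x. two_variable (ls (q k)) (x, fast n x)) \<in> borel_measurable (lebesgue_on \<Omega>)" for k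
      by (rule at_fast_borel[OF tv])
    show "AE x in lebesgue_on \<Omega>. (\<lambda>k. two_variable (ls (q k)) (x, fast n x)) \<longlonglongrightarrow> apply_bcontfun (\<phi> x) (fast n x)"
      using conv by eventually_elim blast
  qed (use dom_borel in simp)
  have m2: "(\<lambda>z. apply_bcontfun (\<phi> (fst z)) (snd z)) \<in> borel_measurable (lebesgue_on D)"
  proof (rule borel_measurable_lebesgue_on_AE_limit)
    show "two_variable (ls (q k)) \<in> borel_measurable (lebesgue_on D)" for k
      by (rule borel_measurable_lebesgue_on[OF tv])
    show "AE z in lebesgue_on D. (\<lambda>k. two_variable (ls (q k)) z) \<longlonglongrightarrow> apply_bcontfun (\<phi> (fst z)) (snd z)"
      using AE_lebesgue_on_fst[OF dom_borel cell_borel conv] by eventually_elim (metis prod.collapse)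
  qed (use D_borel in simp)
  have \<phi>2: "integrable (lebesgue_on \<Omega>) (\<lambda>x. (norm (\<phi> x))\<^sup>2)" using \<phi> by (simp add: L2_on_def)
  have le: "\<bar>apply_bcontfun f y\<bar>\<^sup>2 \<le> (norm f)\<^sup>2" for f :: "(real^'m) \<Rightarrow>\<^sub>C real" and y
    by (intro power_mono abs_bcontfun_le) auto
  show s1: "square_integrable (lebesgue_on \<Omega>) (\<lambda>x. apply_bcontfun (\<phi> x) (fast n x))" for n
    by (rule square_integrableI[OF m1], rule Bochner_Integration.integrable_bound[OF \<phi>2])
      (use borel_measurable_power[OF m1] le in \<open>auto intro!: AE_I2\<close>)
  show s2: "square_integrable (lebesgue_on D) (\<lambda>z. apply_bcontfun (\<phi> (fst z)) (snd z))"
    by (rule square_integrableI[OF m2], rule Bochner_Integration.integrable_bound[OF integral_lebesgue_on_fst(2)[OF dom_borel \<phi>2]])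
      (use borel_measurable_power[OF m2] le in \<open>auto intro!: AE_I2\<close>)
  fix e :: real assume "e > 0"
  then obtain l where l: "l \<in> box_fields" "integrable (lebesgue_on \<Omega>) (\<delta> l)" "(\<integral>x. \<delta> l x \<partial>lebesgue_on \<Omega>) < e"
    using approx by blast
  have pt: "(apply_bcontfun (\<phi> x) y - two_variable l (x, y))\<^sup>2 \<le> \<delta> l x" for x y
    using le[of "\<phi> x - simple_field l x" y] by (simp add: \<delta>_def two_variable_def)
  have "(\<integral>x. (apply_bcontfun (\<phi> x) (fast n x) - two_variable l (x, fast n x))\<^sup>2 \<partial>lebesgue_on \<Omega>)
      \<le> (\<integral>x. \<delta> l x \<partial>lebesgue_on \<Omega>)" for n
    using square_integrable_diff[OF s1[of n] box_field_square_integrable(1)[OF l(1), of n]] l(2) pt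
    by (intro integral_mono) (auto simp: square_integrable_def)
  moreover have "(\<integral>z. (apply_bcontfun (\<phi> (fst z)) (snd z) - two_variable l z)\<^sup>2 \<partial>lebesgue_on D)
      \<le> (\<integral>z. \<delta> l (fst z) \<partial>lebesgue_on D)"
  proof (rule integral_mono)
    show "integrable (lebesgue_on D) (\<lambda>z. (apply_bcontfun (\<phi> (fst z)) (snd z) - two_variable l z)\<^sup>2)"
      using square_integrable_diff[OF s2 box_field_square_integrable(2)[OF l(1)]] by (simp add: square_integrable_def)
    show "integrable (lebesgue_on D) (\<lambda>z. \<delta> l (fst z))"
      by (rule integral_lebesgue_on_fst(2)[OF dom_borel l(2)])
    show "(apply_bcontfun (\<phi> (fst z)) (snd z) - two_variable l z)\<^sup>2 \<le> \<delta> l (fst z)" for z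
      using pt[of "fst z" "snd z"] by simp
  qed
  moreover have "(\<integral>z. \<delta> l (fst z) \<partial>lebesgue_on D) = (\<integral>x. \<delta> l x \<partial>lebesgue_on \<Omega>)"
    by (rule integral_lebesgue_on_fst(3)[OF dom_borel l(2)])
  ultimately have "(\<forall>n. (\<integral>x. (apply_bcontfun (\<phi> x) (fast n x) - two_variable l (x, fast n x))\<^sup>2 \<partial>lebesgue_on \<Omega>) \<le> e) \<and>
      (\<integral>z. (apply_bcontfun (\<phi> (fst z)) (snd z) - two_variable l z)\<^sup>2 \<partial>lebesgue_on D) \<le> e"
    using l(3) by (auto intro: order.trans less_imp_le)
  then show "\<exists>l\<in>box_fields.
      (\<forall>n. (\<integral>x. (apply_bcontfun (\<phi> x) (fast n x) - two_variable l (x, fast n x))\<^sup>2 \<partial>lebesgue_on \<Omega>) \<le> e) \<and>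
      (\<integral>z. (apply_bcontfun (\<phi> (fst z)) (snd z) - two_variable l z)\<^sup>2 \<partial>lebesgue_on D) \<le> e"
    using l(1) by blast
qed

text \<open>The limit functional is constructed on step functions, where the averages of squares are known to
  converge. This gives its bound in \<open>L\<^sup>2(\<Omega> \<times> Y)\<close> and hence the function \<open>w\<close>. For general test
  functions the uniform approximation by step functions transfers the convergence.\<close>

theorem two_scale_compactness:
  fixes v :: "nat \<Rightarrow> real^'d \<Rightarrow> real"
  assumes v: "\<And>n. square_integrable (lebesgue_on \<Omega>) (v n)"
    and C: "\<And>n. (\<integral>x. (v n x)\<^sup>2 \<partial>lebesgue_on \<Omega>) \<le> C"
  obtains r w where "strict_mono (r :: nat \<Rightarrow> nat)" "w \<in> borel_measurable borel" "\<And>z. z \<notin> D \<Longrightarrow> w z = 0"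
    "square_integrable lborel w"
    "\<And>\<phi> :: real^'d \<Rightarrow> ((real^'m) \<Rightarrow>\<^sub>C real). \<phi> \<in> L2_on \<Omega> \<Longrightarrow> AE x in lebesgue_on \<Omega>. \<phi> x \<in> C_per \<Longrightarrow>
      (\<lambda>n. \<integral>x. v (r n) x * apply_bcontfun (\<phi> x) (fast (r n) x) \<partial>lebesgue_on \<Omega>)
        \<longlonglongrightarrow> (\<integral>z. w z * apply_bcontfun (\<phi> (fst z)) (snd z) \<partial>lebesgue_on D)"
proof -
  have C0: "C \<ge> 0" using order.trans[OF integral_nonneg_AE C[of 0]] by simp
  define B where "B n f = (\<integral>x. v n x * f (x, fast n x) \<partial>lebesgue_on \<Omega>)" for n and f :: "(real^'d) \<times> (real^'m) \<Rightarrow> real"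
  have int: "integrable (lebesgue_on \<Omega>) (\<lambda>x. v n x * two_variable l (x, fast n x))" if "l \<in> box_fields" for n l
    by (rule square_integrable_mult[OF v box_field_square_integrable(1)[OF that]])
  have B_add: "B n (\<lambda>z. two_variable l z + two_variable l' z) = B n (two_variable l) + B n (two_variable l')"
    if "l \<in> box_fields" "l' \<in> box_fields" for n l l'
    unfolding B_def using int[OF that(1), of n] int[OF that(2), of n] by (simp add: distrib_left)
  have B_scale: "B n (\<lambda>z. c * f z) = c * B n f" for n c f
    unfolding B_def by (simp add: mult.left_commute[of _ c])
  define \<mu> where "\<mu> = measure lebesgue \<Omega>"
  have \<mu>: "\<mu> \<ge> 0" by (simp add: \<mu>_def)
  have B_single: "\<bar>B n (two_variable [(A, t)])\<bar> \<le> sqrt (C * \<mu>) * norm t" if "A \<in> box_unions \<Omega>" "t \<in> C_per" for n A t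
  proof -
    have l: "[(A, t)] \<in> box_fields" using that by auto
    note si = box_field_square_integrable(1)[OF l, of n]
    have "(two_variable [(A, t)] z)\<^sup>2 \<le> (norm t)\<^sup>2" for z
    proof -
      have "\<bar>two_variable [(A, t)] z\<bar> \<le> norm t"
        using abs_bcontfun_le[of t "snd z"] by (auto simp: indicator_def)
      then have "\<bar>two_variable [(A, t)] z\<bar>\<^sup>2 \<le> (norm t)\<^sup>2" by (rule power_mono) simp
      then show ?thesis by simp
    qed
    then have "(\<integral>x. (two_variable [(A, t)] (x, fast n x))\<^sup>2 \<partial>lebesgue_on \<Omega>) \<le> (\<integral>x. (norm t)\<^sup>2 \<partial>lebesgue_on \<Omega>)"
      using si finite_measure.integrable_const[OF finite_measure_lebesgue_on[OF dom_lmeasurable]]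
      by (intro integral_mono) (auto simp: square_integrable_def)
    also have "\<dots> = \<mu> * (norm t)\<^sup>2"
      using dom_lmeasurable by (simp add: \<mu>_def measure_restrict_space)
    finally have "\<bar>B n (two_variable [(A, t)])\<bar> \<le> sqrt (C * (\<mu> * (norm t)\<^sup>2))"
      unfolding B_def by (rule abs_integral_le_sqrt[OF v si C])
    then show ?thesis by (simp add: real_sqrt_mult)
  qed
  obtain T :: "((real^'m) \<Rightarrow>\<^sub>C real) set" where T: "countable T" "T \<subseteq> C_per" "0 \<in> T"
    "\<And>f e. f \<in> C_per \<Longrightarrow> e > 0 \<Longrightarrow> \<exists>t\<in>T. norm (f - t) < e"
    using C_per_separable by blast
  \<comment> \<open>Countably many elementary test functions suffice: finite unions of rational boxes times a
    dense sequence of periodic functions.\<close>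
  define I where "I = box_unions \<Omega> \<times> T"
  have I: "countable I" "I \<noteq> {}"
    using countable_box_unions T(1,3) by (auto simp: I_def box_unions_def)
  define p where "p = from_nat_into I"
  have p: "range p = I" unfolding p_def by (rule range_from_nat_into[OF I(2,1)])
  have pI: "fst (p i) \<in> box_unions \<Omega>" "snd (p i) \<in> C_per" for i
    using p T(2) rangeI[of p i] by (auto simp: I_def mem_Times_iff)
  have B_p: "\<bar>B n (two_variable [p i])\<bar> \<le> sqrt (C * \<mu>) * norm (snd (p i))" for n i
    using B_single[OF pI(1)[of i] pI(2)[of i], of n] by simp
  obtain r :: "nat \<Rightarrow> nat" where r: "strict_mono r" "\<And>i. convergent (\<lambda>n. B (r n) (two_variable [p i]))"
    using diagonal_convergent_subsequence[of "\<lambda>n i. B n (two_variable [p i])", OF B_p] by blast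
  \<comment> \<open>Replacing the periodic factor by a near member of the dense sequence costs a uniformly small error.\<close>
  have conv1: "convergent (\<lambda>n. B (r n) (two_variable [(A, t)]))" if A: "A \<in> box_unions \<Omega>" and t: "t \<in> C_per" for A t
  proof (rule convergent_if_uniformly_approximable)
    fix e :: real assume e: "e > 0"
    define c where "c = 1 + sqrt (C * \<mu>)"
    have c: "c > 0" "sqrt (C * \<mu>) \<le> c" using C0 \<mu> by (auto simp: c_def intro!: add_pos_nonneg)
    then have "e / c > 0" using e by simp
    then obtain s where s: "s \<in> T" "norm (t - s) < e / c" using T(4)[OF t] by blast
    have sC: "s \<in> C_per" using s T(2) by blast
    have "(A, s) \<in> I" using A s by (simp add: I_def)
    then obtain i where i: "p i = (A, s)" using p by (metis imageE)
    have "\<bar>B (r n) (two_variable [(A, t)]) - B (r n) (two_variable [(A, s)])\<bar> \<le> e" for n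
    proof -
      have "two_variable [(A, t)] = (\<lambda>z. two_variable [(A, t - s)] z + two_variable [(A, s)] z)"
        by (simp add: fun_eq_iff algebra_simps)
      then have "B (r n) (two_variable [(A, t)]) = B (r n) (two_variable [(A, t - s)]) + B (r n) (two_variable [(A, s)])"
        using B_add[of "[(A, t - s)]" "[(A, s)]" "r n"] A t sC by (simp add: C_per_diff)
      moreover have "\<bar>B (r n) (two_variable [(A, t - s)])\<bar> \<le> sqrt (C * \<mu>) * norm (t - s)"
        using A t sC by (intro B_single C_per_diff)
      moreover have "sqrt (C * \<mu>) * norm (t - s) \<le> c * (e / c)"
        using c s by (intro mult_mono) auto
      ultimately show ?thesis using c by simp
    qed
    then show "\<exists>Y. convergent Y \<and> (\<forall>n. \<bar>B (r n) (two_variable [(A, t)]) - Y n\<bar> \<le> e)"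
      using r(2)[of i] unfolding i by blast
  qed
  have conv: "convergent (\<lambda>n. B (r n) (two_variable l))" if "l \<in> box_fields" for l
    using that
  proof (induction l)
    case Nil
    then show ?case by (simp add: B_def convergent_const)
  next
    case (Cons q l)
    obtain A t where q: "q = (A, t)" "A \<in> box_unions \<Omega>" "t \<in> C_per" using Cons.hyps by auto
    have l: "l \<in> box_fields" "[(A, t)] \<in> box_fields" using Cons.hyps q by auto
    have "two_variable (q # l) = (\<lambda>z. two_variable [(A, t)] z + two_variable l z)"
      by (simp add: fun_eq_iff q)
    then have "B (r n) (two_variable (q # l)) = B (r n) (two_variable [(A, t)]) + B (r n) (two_variable l)" for n
      using B_add[OF l(2,1)] by simp
    then show ?case using convergent_add[OF conv1[OF q(2,3)] Cons.IH] by simp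
  qed
  define L where "L f = lim (\<lambda>n. B (r n) f)" for f
  define V where "V = two_variable ` box_fields"
  have L: "(\<lambda>n. B (r n) f) \<longlonglongrightarrow> L f" if "f \<in> V" for f
    using conv that unfolding V_def L_def by (auto simp: convergent_LIMSEQ_iff)
  have scaled: "map (\<lambda>(A, t). (A, c *\<^sub>R t)) l \<in> box_fields" if "l \<in> box_fields" for c l
    using that by (induction l) (auto intro: C_per_scaleR)
  have V_add: "(\<lambda>z. f z + g z) \<in> V" if "f \<in> V" "g \<in> V" for f g
  proof -
    obtain l l' where l: "l \<in> box_fields" "f = two_variable l" "l' \<in> box_fields" "g = two_variable l'"
      using \<open>f \<in> V\<close> \<open>g \<in> V\<close> by (auto simp: V_def)
    have "(\<lambda>z. f z + g z) = two_variable (l @ l')" by (simp add: l two_variable_append fun_eq_iff)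
    moreover have "l @ l' \<in> box_fields" using l by simp
    ultimately show ?thesis unfolding V_def by (rule image_eqI)
  qed
  have V_scale: "(\<lambda>z. c * f z) \<in> V" if "f \<in> V" for c f
  proof -
    obtain l where l: "l \<in> box_fields" "f = two_variable l" using \<open>f \<in> V\<close> by (auto simp: V_def)
    have "(\<lambda>z. c * f z) = two_variable (map (\<lambda>(A, t). (A, c *\<^sub>R t)) l)"
      by (simp add: l two_variable_scale fun_eq_iff)
    then show ?thesis unfolding V_def by (rule image_eqI[OF _ scaled[OF l(1)]])
  qed
  have L_add: "L (\<lambda>z. f z + g z) = L f + L g" if f: "f \<in> V" and g: "g \<in> V" for f g
  proof -
    have "B n (\<lambda>z. f z + g z) = B n f + B n g" for n
      using f g B_add unfolding V_def by auto
    then show ?thesis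
      using LIMSEQ_unique[OF L[OF V_add[OF f g]]] tendsto_add[OF L[OF f] L[OF g]] by simp
  qed
  have L_scale: "L (\<lambda>z. c * f z) = c * L f" if f: "f \<in> V" for c f
    using LIMSEQ_unique[OF L[OF V_scale[OF f]]] tendsto_mult_left[OF L[OF f], of c] by (simp add: B_scale)
  have L_bound: "(L f)\<^sup>2 \<le> C * (\<integral>z. (f z)\<^sup>2 \<partial>lebesgue_on D)" if f: "f \<in> V" for f
  proof -
    obtain l where l: "l \<in> box_fields" "f = two_variable l" using f by (auto simp: V_def)
    have le: "(B (r n) f)\<^sup>2 \<le> C * (\<integral>x. (f (x, fast (r n) x))\<^sup>2 \<partial>lebesgue_on \<Omega>)" for n
    proof -
      have "(B (r n) f)\<^sup>2 \<le> (\<integral>x. (v (r n) x)\<^sup>2 \<partial>lebesgue_on \<Omega>) * (\<integral>x. (f (x, fast (r n) x))\<^sup>2 \<partial>lebesgue_on \<Omega>)"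
        unfolding B_def l(2) by (rule Cauchy_Schwarz_integral[OF v box_field_square_integrable(1)[OF l(1)]])
      also have "\<dots> \<le> C * (\<integral>x. (f (x, fast (r n) x))\<^sup>2 \<partial>lebesgue_on \<Omega>)"
        by (intro mult_right_mono C) simp
      finally show ?thesis .
    qed
    have "(\<lambda>n. \<integral>x. (f (x, fast n x))\<^sup>2 \<partial>lebesgue_on \<Omega>) \<longlonglongrightarrow> (\<integral>z. (f z)\<^sup>2 \<partial>lebesgue_on D)"
      using averages_two_variable_mult[OF l(1) l(1)] by (simp add: averages_def l(2) power2_eq_square)
    from LIMSEQ_subseq_LIMSEQ[OF this r(1)]
    have lim: "(\<lambda>n. C * (\<integral>x. (f (x, fast (r n) x))\<^sup>2 \<partial>lebesgue_on \<Omega>)) \<longlonglongrightarrow> C * (\<integral>z. (f z)\<^sup>2 \<partial>lebesgue_on D)"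
      by (intro tendsto_mult_left) (simp add: comp_def)
    show ?thesis
      using LIMSEQ_le[OF tendsto_power[OF L[OF f], of 2] lim] le by blast
  qed
  obtain w0 where w0: "square_integrable (lebesgue_on D) w0"
    "\<And>f. f \<in> V \<Longrightarrow> (\<integral>z. w0 z * f z \<partial>lebesgue_on D) = L f"
  proof (rule Riesz_representation_on_subspace[of V "lebesgue_on D" L C])
    show "square_integrable (lebesgue_on D) f" if "f \<in> V" for f
      using that box_field_square_integrable(2) by (auto simp: V_def)
    show "(\<lambda>x. 0) \<in> V" unfolding V_def by (rule image_eqI[of _ _ "[]"]) auto
  qed (use V_add V_scale L_add L_scale L_bound in blast)+
  obtain w where w: "w \<in> borel_measurable borel" "\<And>z. z \<notin> D \<Longrightarrow> w z = 0" "AE z in lebesgue_on D. w0 z = w z"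
    using borel_representative[OF D_borel square_integrableD(1)[OF w0(1)]] by blast
  have wm: "w \<in> borel_measurable (lebesgue_on D)" by (rule borel_measurable_lebesgue_on[OF w(1)])
  have wsi: "square_integrable (lebesgue_on D) w"
    by (rule square_integrable_bound[OF w0(1) wm]) (use w(3) in eventually_elim, simp)
  have wlb: "square_integrable lborel w"
  proof (rule square_integrableI)
    have "integrable (lebesgue_on D) (\<lambda>z. (w z)\<^sup>2)" using wsi by (simp add: square_integrable_def)
    then show "integrable lborel (\<lambda>z. (w z)\<^sup>2)"
      using w by (subst lebesgue_on_borel_integral(1)[OF D_borel, symmetric]) auto
  qed (use w in simp)
  have wV: "(\<integral>z. w z * f z \<partial>lebesgue_on D) = L f" if f: "f \<in> V" for f
  proof -
    have fm: "f \<in> borel_measurable (lebesgue_on D)"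
      using f box_field_square_integrable(2) by (auto simp: V_def square_integrable_def)
    have "(\<integral>z. w z * f z \<partial>lebesgue_on D) = (\<integral>z. w0 z * f z \<partial>lebesgue_on D)"
      using w(3) square_integrableD(1)[OF w0(1)] wm fm
      by (intro integral_cong_AE borel_measurable_times) (auto elim: eventually_mono)
    then show ?thesis using w0(2)[OF f] by simp
  qed
  show ?thesis
  proof (rule that[OF r(1) w(1,2) wlb])
    fix \<phi> :: "real^'d \<Rightarrow> ((real^'m) \<Rightarrow>\<^sub>C real)"
    assume \<phi>: "\<phi> \<in> L2_on \<Omega>" and per: "AE x in lebesgue_on \<Omega>. \<phi> x \<in> C_per"
    note adm = admissible_square_integrable[OF \<phi> per]
    define G where "G z = apply_bcontfun (\<phi> (fst z)) (snd z)" for z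
    define W where "W = (\<integral>z. (w z)\<^sup>2 \<partial>lebesgue_on D)"
    have W0: "W \<ge> 0" by (simp add: W_def)
    have Gs: "square_integrable (lebesgue_on D) G" "square_integrable (lebesgue_on \<Omega>) (\<lambda>x. G (x, fast n x))" for n
      using adm(1,2) by (simp_all add: G_def[abs_def])
    have "(\<lambda>n. B (r n) G) \<longlonglongrightarrow> (\<integral>z. w z * G z \<partial>lebesgue_on D)"
    proof (rule LIMSEQ_I)
      fix e :: real assume e: "e > 0"
      define K where "K = 1 + C + W"
      have K: "K > 0" "C \<le> K" "W \<le> K" using C0 W0 by (auto simp: K_def)
      define d where "d = (e/3)\<^sup>2 / K"
      have d: "d > 0" using e K by (simp add: d_def)
      have sq: "sqrt (X * d) \<le> e/3" if "X \<le> K" for X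
      proof -
        have "X * d \<le> K * d" using that d by (intro mult_right_mono) auto
        also have "\<dots> = (e/3)\<^sup>2" using K by (simp add: d_def)
        finally show ?thesis using e by (intro real_le_lsqrt) auto
      qed
      obtain l where l: "l \<in> box_fields"
        "\<And>n. (\<integral>x. (G (x, fast n x) - two_variable l (x, fast n x))\<^sup>2 \<partial>lebesgue_on \<Omega>) \<le> d"
        "(\<integral>z. (G z - two_variable l z)\<^sup>2 \<partial>lebesgue_on D) \<le> d"
        using adm(3)[OF d] by (auto simp: G_def)
      note ls = box_field_square_integrable[OF l(1)]
      have 1: "\<bar>B n G - B n (two_variable l)\<bar> \<le> e/3" for n
      proof -
        have "B n G - B n (two_variable l) = (\<integral>x. v n x * (G (x, fast n x) - two_variable l (x, fast n x)) \<partial>lebesgue_on \<Omega>)"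
          unfolding B_def using square_integrable_mult[OF v Gs(2), of n n] int[OF l(1), of n]
          by (simp add: right_diff_distrib)
        then show ?thesis
          using abs_integral_le_sqrt[OF v square_integrable_diff[OF Gs(2) ls(1)] C l(2), of n n] sq[OF K(2)] by simp
      qed
      have 2: "\<bar>(\<integral>z. w z * G z \<partial>lebesgue_on D) - (\<integral>z. w z * two_variable l z \<partial>lebesgue_on D)\<bar> \<le> e/3"
      proof -
        have "(\<integral>z. w z * G z \<partial>lebesgue_on D) - (\<integral>z. w z * two_variable l z \<partial>lebesgue_on D)
            = (\<integral>z. w z * (G z - two_variable l z) \<partial>lebesgue_on D)"
          using square_integrable_mult[OF wsi Gs(1)] square_integrable_mult[OF wsi ls(2)]
          by (simp add: right_diff_distrib)
        then show ?thesis
          using abs_integral_le_sqrt[OF wsi square_integrable_diff[OF Gs(1) ls(2)] order.refl l(3)] sq[OF K(3)]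
          by (simp add: W_def)
      qed
      have "two_variable l \<in> V" using l(1) by (simp add: V_def)
      from LIMSEQ_D[OF L[OF this], of "e/3"] e
      obtain N where N: "\<And>n. n \<ge> N \<Longrightarrow> \<bar>B (r n) (two_variable l) - L (two_variable l)\<bar> < e/3" by auto
      have "\<bar>B (r n) G - (\<integral>z. w z * G z \<partial>lebesgue_on D)\<bar> < e" if "n \<ge> N" for n
        using N[OF that] 1[of "r n"] 2 wV[OF \<open>two_variable l \<in> V\<close>] by linarith
      then show "\<exists>no. \<forall>n\<ge>no. norm (B (r n) G - (\<integral>z. w z * G z \<partial>lebesgue_on D)) < e" by auto
    qed
    then show "(\<lambda>n. \<integral>x. v (r n) x * apply_bcontfun (\<phi> x) (fast (r n) x) \<partial>lebesgue_on \<Omega>)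
        \<longlonglongrightarrow> (\<integral>z. w z * apply_bcontfun (\<phi> (fst z)) (snd z) \<partial>lebesgue_on D)"
      by (simp add: B_def G_def)
  qed
qed

end


section \<open>Two-scale limits of finitely many sequences\<close>

text \<open>The limit is a Borel function on the whole product space which vanishes outside \<open>\<Omega> \<times> cell\<close>, so
  that its sections and iterated integrals can be taken with respect to the Borel measure.\<close>

definition two_scale_limit ::
  "(real^'d) set \<Rightarrow> real^'d^'m \<Rightarrow> (nat \<Rightarrow> real) \<Rightarrow> (nat \<Rightarrow> real^'d \<Rightarrow> real) \<Rightarrow> ((real^'d) \<times> (real^'m) \<Rightarrow> real) \<Rightarrow> bool" where
  "two_scale_limit \<Omega> R \<eta> v w \<longleftrightarrow>
    w \<in> borel_measurable borel \<and> (\<forall>z. z \<notin> \<Omega> \<times> cell \<longrightarrow> w z = 0) \<and> square_integrable lborel w \<and>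
    (\<forall>\<phi> :: real^'d \<Rightarrow> ((real^'m) \<Rightarrow>\<^sub>C real). \<phi> \<in> L2_on \<Omega> \<longrightarrow> (AE x in lebesgue_on \<Omega>. \<phi> x \<in> C_per) \<longrightarrow>
      (\<lambda>n. \<integral>x. v n x * apply_bcontfun (\<phi> x) ((1 / \<eta> n) *\<^sub>R (R *v x)) \<partial>lebesgue_on \<Omega>)
        \<longlonglongrightarrow> (\<integral>z. w z * apply_bcontfun (\<phi> (fst z)) (snd z) \<partial>lebesgue_on (\<Omega> \<times> cell)))"

lemma two_scale_limit_subseq:
  assumes "two_scale_limit \<Omega> R \<eta> v w" "strict_mono r"
  shows "two_scale_limit \<Omega> R (\<lambda>n. \<eta> (r n)) (\<lambda>n. v (r n)) w"
  using assms(1) LIMSEQ_subseq_LIMSEQ[OF _ assms(2)] unfolding two_scale_limit_def comp_def by fastforce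

lemma two_scale_compactness_finite:
  fixes R :: "real^'d^'m" and v :: "'i \<Rightarrow> nat \<Rightarrow> real^'d \<Rightarrow> real"
  assumes I: "finite I" and dom: "open \<Omega>" "bounded \<Omega>"
    and nonres: "\<And>k::int^'m. k \<noteq> 0 \<Longrightarrow> transpose R *v real_vec k \<noteq> 0"
    and \<eta>: "\<And>n. \<eta> n > 0" "\<eta> \<longlonglongrightarrow> 0"
    and v: "\<And>i n. square_integrable (lebesgue_on \<Omega>) (v i n)"
    and C: "\<And>i n. (\<integral>x. (v i n x)\<^sup>2 \<partial>lebesgue_on \<Omega>) \<le> C"
  shows "\<exists>r :: nat \<Rightarrow> nat. strict_mono r \<and> (\<forall>i\<in>I. \<exists>w. two_scale_limit \<Omega> R (\<lambda>n. \<eta> (r n)) (\<lambda>n. v i (r n)) w)"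
  using I
proof (induction I rule: finite_induct)
  case empty
  show ?case by (intro exI[of _ "\<lambda>n. n"]) (auto simp: strict_mono_def)
next
  case (insert i I)
  then obtain r :: "nat \<Rightarrow> nat" where r: "strict_mono r"
    "\<And>j. j \<in> I \<Longrightarrow> \<exists>w. two_scale_limit \<Omega> R (\<lambda>n. \<eta> (r n)) (\<lambda>n. v j (r n)) w" by blast
  have null: "(\<lambda>n. \<eta> (r n)) \<longlonglongrightarrow> 0" using LIMSEQ_subseq_LIMSEQ[OF \<eta>(2) r(1)] by (simp add: comp_def)
  interpret O: oscillation_domain R "\<lambda>n. \<eta> (r n)" \<Omega>
    by unfold_locales (use nonres \<eta>(1) null dom in auto)
  obtain q w where qw: "strict_mono (q :: nat \<Rightarrow> nat)" "w \<in> borel_measurable borel" "\<And>z. z \<notin> \<Omega> \<times> cell \<Longrightarrow> w z = 0"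
    "square_integrable lborel w"
    "\<And>\<phi> :: real^'d \<Rightarrow> ((real^'m) \<Rightarrow>\<^sub>C real). \<phi> \<in> L2_on \<Omega> \<Longrightarrow> AE x in lebesgue_on \<Omega>. \<phi> x \<in> C_per \<Longrightarrow>
      (\<lambda>n. \<integral>x. v i (r (q n)) x * apply_bcontfun (\<phi> x) (O.fast (q n) x) \<partial>lebesgue_on \<Omega>)
        \<longlonglongrightarrow> (\<integral>z. w z * apply_bcontfun (\<phi> (fst z)) (snd z) \<partial>lebesgue_on (\<Omega> \<times> cell))"
    using O.two_scale_compactness[of "\<lambda>n. v i (r n)" C, OF v C] by blast
  have "two_scale_limit \<Omega> R (\<lambda>n. \<eta> (r (q n))) (\<lambda>n. v i (r (q n))) w"
    unfolding two_scale_limit_def using qw(2-5) by (auto simp: O.fast_def)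
  moreover have "\<exists>w. two_scale_limit \<Omega> R (\<lambda>n. \<eta> (r (q n))) (\<lambda>n. v j (r (q n))) w" if j: "j \<in> I" for j
    using r(2)[OF j] two_scale_limit_subseq[OF _ qw(1)] by fast
  moreover have "strict_mono (\<lambda>n. r (q n))" using strict_mono_o[OF r(1) qw(1)] by (simp add: comp_def)
  ultimately show ?case by (intro exI[of _ "\<lambda>n. r (q n)"]) auto
qed

section \<open>Sections of a two-scale limit\<close>

lemma square_integrable_indicator:
  fixes S :: "'a::euclidean_space set"
  assumes S: "S \<in> sets borel" "emeasure lborel S < \<infinity>"
  shows "square_integrable lborel (\<lambda>z. indicator S z * c)"
proof (rule square_integrableI)
  have "(\<lambda>z. (indicator S z * c)\<^sup>2) = (\<lambda>z. c\<^sup>2 * indicator S z)"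
    by (auto simp: fun_eq_iff indicator_def)
  then show "integrable lborel (\<lambda>z. (indicator S z * c)\<^sup>2)"
    using S by (simp add: integrable_indicator_iff)
qed (use S in simp)

lemma AE_lebesgue_on_lborel:
  fixes S :: "'a::euclidean_space set"
  assumes "S \<in> sets borel" "AE x in lborel. P x"
  shows "AE x in lebesgue_on S. P x"
  using assms AE_restrict_space_iff[of S lebesgue P] AE_completion[of P lborel] by (auto elim: eventually_mono)

text \<open>For a wave \<open>e\<close> these are the real and imaginary parts of the Fourier coefficients of the sections;
  for \<open>e = 1\<close> this is the mean over the cell.\<close>

definition cell_coeff :: "((real^'d) \<times> (real^'m) \<Rightarrow> real) \<Rightarrow> (real^'m \<Rightarrow> real) \<Rightarrow> real^'d \<Rightarrow> real" where
  "cell_coeff w e x = (\<integral>y. w (x, y) * e y \<partial>lborel)"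

locale section_function =
  fixes \<Omega> :: "(real^'d) set" and w :: "(real^'d) \<times> (real^'m) \<Rightarrow> real"
  assumes dom: "open \<Omega>" "bounded \<Omega>" and w_borel: "w \<in> borel_measurable borel"
    and w_zero: "\<And>z. z \<notin> \<Omega> \<times> cell \<Longrightarrow> w z = 0" and w_square: "square_integrable lborel w"
begin

lemma dom_sets: "\<Omega> \<in> sets borel" "\<Omega> \<in> lmeasurable" using dom by (auto intro: lmeasurable_open)

lemma D_sets: "\<Omega> \<times> (cell :: (real^'m) set) \<in> sets borel" using dom_sets by (intro borel_Times) auto

lemma w_pair [measurable]: "w \<in> borel_measurable (borel \<Otimes>\<^sub>M borel)" using w_borel by (simp add: borel_prod)

lemma section_square_integrable: "AE x in lborel. square_integrable lborel (\<lambda>y. w (x, y))"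
proof -
  have "integrable (lborel \<Otimes>\<^sub>M lborel) (\<lambda>z. (w z)\<^sup>2)"
    using w_square by (simp add: square_integrable_def lborel_prod)
  from lborel_pair.AE_integrable_fst'[OF this] show ?thesis
    by eventually_elim (auto simp: square_integrable_def)
qed

lemma w_integrable_mult:
  assumes e: "e \<in> borel_measurable borel" "\<And>y. \<bar>e y\<bar> \<le> B" and \<psi>: "\<psi> \<in> borel_measurable borel" "\<And>x. x \<in> \<Omega> \<Longrightarrow> \<bar>\<psi> x\<bar> \<le> K"
  shows "integrable lborel (\<lambda>z. w z * (\<psi> (fst z) * e (snd z)))"
proof -
  have fin: "emeasure lborel (\<Omega> \<times> (cell :: (real^'m) set)) < \<infinity>"
    using dom by (intro emeasure_bounded_finite bounded_Times) (auto simp: cell_def)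
  let ?f = "\<lambda>z :: (real^'d) \<times> (real^'m). indicator (\<Omega> \<times> cell) z * (\<psi> (fst z) * e (snd z))"
  have "?f \<in> borel_measurable (borel \<Otimes>\<^sub>M borel)"
    using e(1) \<psi>(1) D_sets[folded borel_prod] by measurable
  then have fm: "?f \<in> borel_measurable borel" by (simp add: borel_prod)
  have "square_integrable lborel ?f"
  proof (rule square_integrable_bound[of _ "\<lambda>z. indicator (\<Omega> \<times> cell) z * (K * B)"])
    show "square_integrable lborel (\<lambda>z. indicator (\<Omega> \<times> (cell :: (real^'m) set)) z * (K * B))"
      by (rule square_integrable_indicator[OF D_sets fin])
    show "AE z in lborel. \<bar>?f z\<bar> \<le> \<bar>indicator (\<Omega> \<times> cell) z * (K * B)\<bar>"
    proof (intro AE_I2)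
      fix z :: "(real^'d) \<times> (real^'m)"
      show "\<bar>?f z\<bar> \<le> \<bar>indicator (\<Omega> \<times> cell) z * (K * B)\<bar>"
      proof (cases "z \<in> \<Omega> \<times> cell")
        case True
        then have "\<bar>\<psi> (fst z)\<bar> * \<bar>e (snd z)\<bar> \<le> K * B"
          using \<psi>(2)[of "fst z"] e(2)[of "snd z"] by (intro mult_mono) auto
        then have "\<bar>\<psi> (fst z) * e (snd z)\<bar> \<le> \<bar>K * B\<bar>" unfolding abs_mult[of "\<psi> (fst z)"] by linarith
        then show ?thesis using True by simp
      qed simp
    qed
  qed (use fm in simp)
  from square_integrable_mult[OF w_square this]
  show ?thesis
    by (rule Bochner_Integration.integrable_cong[THEN iffD1, rotated 2]) (use w_zero in \<open>auto simp: indicator_def\<close>)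
qed

lemma cell_coeff_borel:
  assumes [measurable]: "e \<in> borel_measurable borel"
  shows "cell_coeff w e \<in> borel_measurable borel"
  unfolding cell_coeff_def[abs_def] by measurable

lemma cell_coeff_zero: "x \<notin> \<Omega> \<Longrightarrow> cell_coeff w e x = 0"
  using w_zero unfolding cell_coeff_def by simp

lemma cell_coeff_square_integrable:
  assumes e: "e \<in> borel_measurable borel" "\<And>y. \<bar>e y\<bar> \<le> B"
  shows "square_integrable (lebesgue_on \<Omega>) (cell_coeff w e)"
proof -
  note cb = cell_coeff_borel[OF e(1)]
  have si: "square_integrable lborel (\<lambda>y. indicator cell y * e y)"
  proof (rule square_integrable_bound[of _ "\<lambda>y. indicator cell y * B"])
    show "square_integrable lborel (\<lambda>y. indicator (cell :: (real^'m) set) y * B)"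
      by (rule square_integrable_indicator) (simp_all add: emeasure_cell)
    show "AE y in lborel. \<bar>indicator cell y * e y\<bar> \<le> \<bar>indicator cell y * B\<bar>"
      using e(2) by (intro AE_I2) (auto simp: indicator_def intro: order.trans[OF _ abs_ge_self])
  qed (use e(1) in simp)
  define E where "E = (\<integral>y. (indicator cell y * e y)\<^sup>2 \<partial>lborel)"
  have w2: "integrable (lborel \<Otimes>\<^sub>M lborel) (\<lambda>z. (w z)\<^sup>2)"
    using w_square by (simp add: square_integrable_def lborel_prod)
  have int: "integrable lborel (\<lambda>x. \<integral>y. (w (x, y))\<^sup>2 \<partial>lborel)" by (rule lborel_pair.integrable_fst'[OF w2])
  have "integrable lborel (\<lambda>x. (cell_coeff w e x)\<^sup>2)"
  proof (rule Bochner_Integration.integrable_bound[OF integrable_mult_right[OF int, of E]])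
    show "AE x in lborel. norm ((cell_coeff w e x)\<^sup>2) \<le> norm (E * (\<integral>y. (w (x, y))\<^sup>2 \<partial>lborel))"
      using section_square_integrable
    proof eventually_elim
      case (elim x)
      have "cell_coeff w e x = (\<integral>y. w (x, y) * (indicator cell y * e y) \<partial>lborel)"
        unfolding cell_coeff_def by (rule Bochner_Integration.integral_cong) (use w_zero in \<open>auto simp: indicator_def\<close>)
      then have "(cell_coeff w e x)\<^sup>2 \<le> (\<integral>y. (w (x, y))\<^sup>2 \<partial>lborel) * E"
        using Cauchy_Schwarz_integral[OF elim si] by (simp add: E_def)
      also have "\<dots> \<le> norm (E * (\<integral>y. (w (x, y))\<^sup>2 \<partial>lborel))" by (simp add: mult.commute)
      finally show ?case by simp
    qed
  qed (use cb in simp)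
  then show ?thesis
    using lebesgue_on_borel_integral(1)[OF dom_sets(1), of "\<lambda>x. (cell_coeff w e x)\<^sup>2"] cb cell_coeff_zero
    by (intro square_integrableI borel_measurable_lebesgue_on[OF cb]) auto
qed

lemma integral_against_product:
  assumes e: "e \<in> borel_measurable borel" "\<And>y. \<bar>e y\<bar> \<le> B" and \<psi>: "\<psi> \<in> borel_measurable borel" "\<And>x. x \<in> \<Omega> \<Longrightarrow> \<bar>\<psi> x\<bar> \<le> K"
  shows "(\<integral>z. w z * (\<psi> (fst z) * e (snd z)) \<partial>lebesgue_on (\<Omega> \<times> cell)) = (\<integral>x. cell_coeff w e x * \<psi> x \<partial>lebesgue_on \<Omega>)"
proof -
  note int = w_integrable_mult[OF e \<psi>]
  have "(\<integral>z. w z * (\<psi> (fst z) * e (snd z)) \<partial>lebesgue_on (\<Omega> \<times> cell)) = (\<integral>z. w z * (\<psi> (fst z) * e (snd z)) \<partial>lborel)"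
    using int w_zero by (intro lebesgue_on_borel_integral(2)[OF D_sets]) (auto dest: borel_measurable_integrable)
  also have "\<dots> = (\<integral>x. \<integral>y. w (x, y) * (\<psi> x * e y) \<partial>lborel \<partial>lborel)"
    using lborel_pair.integral_fst'[of "\<lambda>z. w z * (\<psi> (fst z) * e (snd z))"] int by (simp add: lborel_prod)
  also have "\<dots> = (\<integral>x. cell_coeff w e x * \<psi> x \<partial>lborel)"
  proof (rule Bochner_Integration.integral_cong[OF refl])
    fix x
    have "(\<integral>y. w (x, y) * (\<psi> x * e y) \<partial>lborel) = (\<integral>y. \<psi> x * (w (x, y) * e y) \<partial>lborel)"
      by (simp add: mult_ac)
    then show "(\<integral>y. w (x, y) * (\<psi> x * e y) \<partial>lborel) = cell_coeff w e x * \<psi> x"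
      by (simp add: cell_coeff_def mult.commute)
  qed
  also have "\<dots> = (\<integral>x. cell_coeff w e x * \<psi> x \<partial>lebesgue_on \<Omega>)"
    using cell_coeff_borel[OF e(1)] \<psi>(1) cell_coeff_zero
    by (intro lebesgue_on_borel_integral(2)[OF dom_sets(1), symmetric]) auto
  finally show ?thesis .
qed

lemma section_on_cell:
  assumes "square_integrable lborel (\<lambda>y. w (x, y))"
    and f: "\<And>y. y \<in> cell \<Longrightarrow> f y = w (x, y)"
  shows "square_integrable (lebesgue_on cell) f"
    and "e \<in> borel_measurable borel \<Longrightarrow> (\<integral>y. f y * e y \<partial>lebesgue_on cell) = cell_coeff w e x"
proof -
  let ?s = "\<lambda>y. w (x, y)"
  have sb: "?s \<in> borel_measurable borel" using assms(1) by (simp add: square_integrable_def)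
  have z: "y \<notin> cell \<Longrightarrow> ?s y = 0" for y using w_zero by simp
  have s: "square_integrable (lebesgue_on cell) ?s"
    using assms(1) lebesgue_on_borel_integral(1)[OF cell_borel, of "\<lambda>y. (w (x, y))\<^sup>2"] sb z
    by (intro square_integrableI borel_measurable_lebesgue_on[OF sb]) (auto simp: square_integrable_def)
  have "f \<in> borel_measurable (lebesgue_on cell)"
    using measurable_cong[of "lebesgue_on cell" f ?s borel] f square_integrableD(1)[OF s] by simp
  then show "square_integrable (lebesgue_on cell) f"
    by (rule square_integrable_bound[OF s]) (use f in \<open>auto intro!: AE_I2\<close>)
  assume e: "e \<in> borel_measurable borel"
  have "(\<integral>y. f y * e y \<partial>lebesgue_on cell) = (\<integral>y. ?s y * e y \<partial>lebesgue_on cell)"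
    by (rule Bochner_Integration.integral_cong) (auto simp: f)
  also have "\<dots> = cell_coeff w e x"
    unfolding cell_coeff_def using sb e z by (intro lebesgue_on_borel_integral(2)[OF cell_borel]) auto
  finally show "(\<integral>y. f y * e y \<partial>lebesgue_on cell) = cell_coeff w e x" .
qed

end

text \<open>Real test functions determine the complex coefficient: \<open>exp(-\<i>\<theta>) = cos \<theta> - \<i> cos(\<theta> - \<pi>/2)\<close>.\<close>

lemma fourier_coeff_waves:
  fixes f :: "real^'m \<Rightarrow> real"
  assumes f: "integrable (lebesgue_on cell) f"
  shows "fourier_coeff f k = Complex (\<integral>y. f y * apply_bcontfun (wave k 0) y \<partial>lebesgue_on cell)
    (- (\<integral>y. f y * apply_bcontfun (wave k (- (pi/2))) y \<partial>lebesgue_on cell))"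
proof -
  let ?F = "\<lambda>y. complex_of_real (f y) * cis (- 2 * pi * (real_vec k \<bullet> y))"
  have cm: "(\<lambda>y. cis (- 2 * pi * (real_vec k \<bullet> y))) \<in> borel_measurable (lebesgue_on cell)"
    by (intro borel_measurable_lebesgue_on borel_measurable_continuous_onI continuous_intros)
  have i: "integrable (lebesgue_on cell) ?F"
    by (rule Bochner_Integration.integrable_bound[OF f])
      (use f cm in \<open>auto simp: norm_mult intro!: borel_measurable_times borel_measurable_of_real\<close>)
  have "Re (fourier_coeff f k) = (\<integral>y. Re (?F y) \<partial>lebesgue_on cell)"
    unfolding fourier_coeff_def by (rule integral_Re[OF i, symmetric])
  moreover have "Im (fourier_coeff f k) = (\<integral>y. Im (?F y) \<partial>lebesgue_on cell)"
    unfolding fourier_coeff_def by (rule integral_Im[OF i, symmetric])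
  ultimately show ?thesis
    by (simp add: complex_eq_iff cos_diff del: Bochner_Integration.integral_minus flip: Bochner_Integration.integral_minus)
qed


section \<open>Passing to the two-scale limit in the divergence\<close>

lemma L2_on_real_iff: "f \<in> L2_on S \<longleftrightarrow> square_integrable (lebesgue_on S) (f :: 'a::euclidean_space \<Rightarrow> real)"
  by (simp add: L2_on_def square_integrable_def)

lemma norm_square_vec: "(norm (v :: real^'n))\<^sup>2 = (\<Sum>j\<in>UNIV. (v $ j)\<^sup>2)"
  unfolding power2_norm_eq_inner inner_vec_def by (simp add: power2_eq_square)

lemma axis_expansion: "(\<Sum>j\<in>UNIV. (v $ j) *\<^sub>R (axis j 1 :: real^'n)) = v"
  using basis_expansion[of v] by (simp only: scalar_mult_eq_scaleR)

lemma L2_on_component: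
  fixes u :: "'a::euclidean_space \<Rightarrow> real^'n"
  assumes u: "u \<in> L2_on S"
  shows "square_integrable (lebesgue_on S) (\<lambda>x. u x $ j)"
    and "(\<integral>x. (u x $ j)\<^sup>2 \<partial>lebesgue_on S) \<le> (\<integral>x. (norm (u x))\<^sup>2 \<partial>lebesgue_on S)"
proof -
  have um: "u \<in> borel_measurable (lebesgue_on S)" and u2: "integrable (lebesgue_on S) (\<lambda>x. (norm (u x))\<^sup>2)"
    using u by (auto simp: L2_on_def)
  have m: "(\<lambda>x. u x $ j) \<in> borel_measurable (lebesgue_on S)"
    by (rule measurable_compose[OF um]) (intro borel_measurable_continuous_onI continuous_intros)
  have le: "(u x $ j)\<^sup>2 \<le> (norm (u x))\<^sup>2" for x
    unfolding norm_square_vec by (rule member_le_sum) auto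
  show s: "square_integrable (lebesgue_on S) (\<lambda>x. u x $ j)"
    by (rule square_integrableI[OF m], rule Bochner_Integration.integrable_bound[OF u2])
      (use borel_measurable_power[OF m] le in auto)
  show "(\<integral>x. (u x $ j)\<^sup>2 \<partial>lebesgue_on S) \<le> (\<integral>x. (norm (u x))\<^sup>2 \<partial>lebesgue_on S)"
    by (rule integral_mono[OF square_integrableD(2)[OF s] u2 le])
qed

lemma L2_on_vecI:
  fixes u :: "'a::euclidean_space \<Rightarrow> real^'n"
  assumes u: "\<And>j. square_integrable (lebesgue_on S) (\<lambda>x. u x $ j)"
  shows "u \<in> L2_on S"
proof -
  have m: "(\<lambda>x. \<Sum>j\<in>UNIV. (u x $ j) *\<^sub>R (axis j 1 :: real^'n)) \<in> borel_measurable (lebesgue_on S)"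
    using u by (intro borel_measurable_sum borel_measurable_scaleR) (auto simp: square_integrable_def)
  have e: "(\<lambda>x. \<Sum>j\<in>UNIV. (u x $ j) *\<^sub>R (axis j 1 :: real^'n)) = u"
    by (simp add: axis_expansion)
  note m[unfolded e]
  moreover have "integrable (lebesgue_on S) (\<lambda>x. (norm (u x))\<^sup>2)"
    unfolding norm_square_vec using u by (intro Bochner_Integration.integrable_sum) (auto simp: square_integrable_def)
  ultimately show ?thesis by (simp add: L2_on_def)
qed

lemma integral_vec_component:
  fixes f :: "'a \<Rightarrow> real^'n"
  assumes "\<And>j. integrable M (\<lambda>x. f x $ j)"
  shows "(\<integral>x. f x \<partial>M) $ j = (\<integral>x. f x $ j \<partial>M)"
proof -
  have i: "integrable M (\<lambda>x. \<Sum>j\<in>UNIV. (f x $ j) *\<^sub>R (axis j 1 :: real^'n))"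
    using assms by (intro Bochner_Integration.integrable_sum integrable_scaleR_left)
  have e: "(\<lambda>x. \<Sum>j\<in>UNIV. (f x $ j) *\<^sub>R (axis j 1 :: real^'n)) = f"
    by (simp add: axis_expansion)
  show ?thesis
    by (rule integral_bounded_linear[OF bounded_linear_vec_nth i[unfolded e], symmetric])
qed

lemma L2_on_AE_cong:
  fixes f :: "'a::euclidean_space \<Rightarrow> 'b::real_normed_vector"
  assumes S: "S \<in> sets lebesgue" and f: "f \<in> L2_on S" and ae: "AE x in lebesgue_on S. f x = h x"
  shows "h \<in> L2_on S"
proof -
  interpret complete_measure "lebesgue_on S" by (rule complete_measure_lebesgue_on[OF S])
  have fm: "f \<in> borel_measurable (lebesgue_on S)" and f2: "integrable (lebesgue_on S) (\<lambda>x. (norm (f x))\<^sup>2)"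
    using f by (auto simp: L2_on_def)
  have hm: "h \<in> borel_measurable (lebesgue_on S)" by (rule borel_measurable_AE_eq[OF fm ae])
  have "(\<lambda>x. (norm (h x))\<^sup>2) \<in> borel_measurable (lebesgue_on S)"
    by (rule measurable_compose[OF hm]) (intro borel_measurable_continuous_onI continuous_intros)
  then have "integrable (lebesgue_on S) (\<lambda>x. (norm (h x))\<^sup>2)"
    by (rule integrable_cong_AE_imp[OF f2]) (use ae in eventually_elim, simp)
  with hm show ?thesis by (simp add: L2_on_def)
qed

lemma weak_div_in_L2: "u \<in> H_div \<Omega> \<Longrightarrow> weak_div \<Omega> u \<in> L2_on \<Omega>"
  and has_weak_div_weak_div: "u \<in> H_div \<Omega> \<Longrightarrow> has_weak_div \<Omega> u (weak_div \<Omega> u)"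
  using someI_ex[of "\<lambda>g. g \<in> L2_on \<Omega> \<and> has_weak_div \<Omega> u g"] by (auto simp: H_div_def weak_div_def)

lemma test_functionD:
  assumes "\<psi> \<in> test_functions \<Omega>"
  shows "continuous_on UNIV \<psi>" and "\<psi> differentiable at x"
    and "continuous_on UNIV (\<lambda>x. grad \<psi> x $ j)"
proof -
  have t: "times_continuously_differentiable n \<psi>" for n using assms by (simp add: test_functions_def)
  show "continuous_on UNIV \<psi>" using t[of 0] by simp
  show "\<psi> differentiable at x" using t[of 1] by simp
  show "continuous_on UNIV (\<lambda>x. grad \<psi> x $ j)" using t[of 1] by (simp add: grad_def)
qed

lemma bounded_on_domain:
  fixes f :: "real^'n \<Rightarrow> real"
  assumes "continuous_on UNIV f" "bounded \<Omega>"
  obtains K where "\<And>x. x \<in> \<Omega> \<Longrightarrow> \<bar>f x\<bar> \<le> K"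
proof -
  have "compact (f ` closure \<Omega>)"
    using assms by (intro compact_continuous_image) (auto intro: continuous_on_subset simp: compact_closure)
  then have "bounded (f ` closure \<Omega>)" by (rule compact_imp_bounded)
  then obtain K where "\<And>x. x \<in> closure \<Omega> \<Longrightarrow> \<bar>f x\<bar> \<le> K" by (auto simp: bounded_iff)
  then show ?thesis using that closure_subset by blast
qed

lemma square_integrable_continuous:
  fixes f :: "real^'n \<Rightarrow> real"
  assumes f: "continuous_on UNIV f" and \<Omega>: "open \<Omega>" "bounded \<Omega>"
  shows "square_integrable (lebesgue_on \<Omega>) f"
proof -
  obtain K where K: "\<And>x. x \<in> \<Omega> \<Longrightarrow> \<bar>f x\<bar> \<le> K" using bounded_on_domain[OF f \<Omega>(2)] by blast
  show ?thesis
    by (rule square_integrable_bounded_function[OF _ borel_measurable_lebesgue_on K])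
      (use \<Omega> f in \<open>auto intro: lmeasurable_open borel_measurable_continuous_onI\<close>)
qed

text \<open>The first factor keeps the support compact in \<open>\<Omega>\<close>, and the derivative of the second contributes the
  vector \<open>a\<close>, which will be of order \<open>1/\<eta>\<close>.\<close>

lemma modulated_test_function:
  fixes \<psi> :: "real^'n \<Rightarrow> real"
  assumes \<psi>: "\<psi> \<in> test_functions \<Omega>" "\<psi> \<in> smooth_class"
  shows "(\<lambda>x. \<psi> x * cos (a \<bullet> x + b)) \<in> test_functions \<Omega>"
    and "grad (\<lambda>x. \<psi> x * cos (a \<bullet> x + b)) x $ j
      = grad \<psi> x $ j * cos (a \<bullet> x + b) + a $ j * (\<psi> x * cos (a \<bullet> x + (b + pi/2)))"
proof -
  let ?\<chi> = "\<lambda>x. \<psi> x * cos (a \<bullet> x + b)"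
  have s: "?\<chi> \<in> smooth_class" by (intro smooth_class.intros \<psi>)
  have c: "closure {x. ?\<chi> x \<noteq> 0} \<subseteq> closure {x. \<psi> x \<noteq> 0}" by (intro closure_mono) auto
  show "?\<chi> \<in> test_functions \<Omega>"
  proof -
    have "compact (closure {x. \<psi> x \<noteq> 0})" "closure {x. \<psi> x \<noteq> 0} \<subseteq> \<Omega>"
      using \<psi>(1) by (auto simp: test_functions_def)
    then have "compact (closure {x. ?\<chi> x \<noteq> 0})" "closure {x. ?\<chi> x \<noteq> 0} \<subseteq> \<Omega>"
      using c by (auto simp: compact_eq_bounded_closed intro: bounded_subset)
    then show ?thesis
      using smooth_class_times_differentiable[OF s] unfolding test_functions_def by blast
  qed
  have d: "(\<psi> has_derivative frechet_derivative \<psi> (at x)) (at x)"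
    using test_functionD(2)[OF \<psi>(1)] by (simp add: frechet_derivative_works)
  have sc: "sin (a \<bullet> x + b) = - cos (a \<bullet> x + (b + pi/2))"
    using minus_sin_cos_eq[of "a \<bullet> x + b"] by (simp add: add.assoc)
  have "(?\<chi> has_derivative (\<lambda>h. \<psi> x * (- (a \<bullet> h) * sin (a \<bullet> x + b)) + frechet_derivative \<psi> (at x) h * cos (a \<bullet> x + b))) (at x)"
    by (rule has_derivative_mult[OF d]) (auto intro!: derivative_eq_intros)
  from fun_cong[OF frechet_derivative_at[OF this], of "axis j 1"]
  have "frechet_derivative ?\<chi> (at x) (axis j 1)
      = \<psi> x * (- (a \<bullet> axis j 1) * sin (a \<bullet> x + b)) + frechet_derivative \<psi> (at x) (axis j 1) * cos (a \<bullet> x + b)"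
    by (rule sym)
  then show "grad ?\<chi> x $ j = grad \<psi> x $ j * cos (a \<bullet> x + b) + a $ j * (\<psi> x * cos (a \<bullet> x + (b + pi/2)))"
    by (simp add: grad_def sc inner_axis)
qed

lemma has_weak_div_unique:
  fixes \<Omega> :: "(real^'n) set"
  assumes \<Omega>: "open \<Omega>" "bounded \<Omega>"
    and g: "square_integrable (lebesgue_on \<Omega>) g" "has_weak_div \<Omega> u g"
    and h: "square_integrable (lebesgue_on \<Omega>) h" "has_weak_div \<Omega> u h"
  shows "AE x in lebesgue_on \<Omega>. g x = h x"
proof -
  have "AE x in lebesgue_on \<Omega>. g x - h x = 0"
  proof (rule fundamental_lemma_variations[OF \<Omega> square_integrable_diff[OF g(1) h(1)]])
    fix \<psi> assume \<psi>: "\<psi> \<in> test_functions \<Omega>"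
    have s: "square_integrable (lebesgue_on \<Omega>) \<psi>"
      by (rule square_integrable_continuous[OF test_functionD(1)[OF \<psi>] \<Omega>])
    show "(\<integral>x. (g x - h x) * \<psi> x \<partial>lebesgue_on \<Omega>) = 0"
      using g(2) h(2) \<psi> square_integrable_mult[OF g(1) s] square_integrable_mult[OF h(1) s]
      by (simp add: left_diff_distrib has_weak_div_def)
  qed
  then show ?thesis by simp
qed

lemma has_weak_div_cong:
  assumes "has_weak_div \<Omega> u g" "AE x in lebesgue_on \<Omega>. u x = v x"
    and "u \<in> borel_measurable (lebesgue_on \<Omega>)" "v \<in> borel_measurable (lebesgue_on \<Omega>)"
  shows "has_weak_div \<Omega> v g"
  unfolding has_weak_div_def
proof
  fix \<psi> assume \<psi>: "\<psi> \<in> test_functions \<Omega>"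
  have "continuous_on UNIV (grad \<psi>)"
    using test_functionD(3)[OF \<psi>] continuous_on_vec_lambda[of UNIV "\<lambda>j x. grad \<psi> x $ j"] by simp
  then have "grad \<psi> \<in> borel_measurable (lebesgue_on \<Omega>)"
    by (intro borel_measurable_lebesgue_on borel_measurable_continuous_onI)
  then have "(\<integral>x. v x \<bullet> grad \<psi> x \<partial>lebesgue_on \<Omega>) = (\<integral>x. u x \<bullet> grad \<psi> x \<partial>lebesgue_on \<Omega>)"
    using assms by (intro integral_cong_AE borel_measurable_inner) (auto elim: eventually_mono)
  then show "(\<integral>x. v x \<bullet> grad \<psi> x \<partial>lebesgue_on \<Omega>) = - (\<integral>x. g x * \<psi> x \<partial>lebesgue_on \<Omega>)"
    using assms(1) \<psi> by (simp add: has_weak_div_def)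
qed

lemma two_scale_limit_product:
  fixes \<Omega> :: "(real^'d) set" and R :: "real^'d^'m"
  assumes \<Omega>: "open \<Omega>" "bounded \<Omega>" and lim: "two_scale_limit \<Omega> R s v w"
    and \<psi>: "continuous_on UNIV \<psi>" and t: "t \<in> C_per"
  shows "(\<lambda>n. \<integral>x. v n x * (\<psi> x * apply_bcontfun t ((1 / s n) *\<^sub>R (R *v x))) \<partial>lebesgue_on \<Omega>)
    \<longlonglongrightarrow> (\<integral>x. cell_coeff w (apply_bcontfun t) x * \<psi> x \<partial>lebesgue_on \<Omega>)"
proof -
  interpret section_function \<Omega> w using \<Omega> lim by unfold_locales (auto simp: two_scale_limit_def)
  obtain K where K: "\<And>x. x \<in> \<Omega> \<Longrightarrow> \<bar>\<psi> x\<bar> \<le> K" using bounded_on_domain[OF \<psi> \<Omega>(2)] by blast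
  have "(\<lambda>x. \<psi> x *\<^sub>R t) \<in> L2_on \<Omega>"
  proof -
    have "continuous_on UNIV (\<lambda>x. \<psi> x *\<^sub>R t)" using \<psi> by (intro continuous_intros)
    then have "(\<lambda>x. \<psi> x *\<^sub>R t) \<in> borel_measurable (lebesgue_on \<Omega>)"
      by (intro borel_measurable_lebesgue_on borel_measurable_continuous_onI)
    moreover have "integrable (lebesgue_on \<Omega>) (\<lambda>x. (norm t)\<^sup>2 * (\<psi> x)\<^sup>2)"
      using square_integrable_continuous[OF \<psi> \<Omega>] by (simp add: square_integrable_def)
    ultimately show ?thesis by (simp add: L2_on_def power_mult_distrib mult.commute)
  qed
  moreover have "AE x in lebesgue_on \<Omega>. \<psi> x *\<^sub>R t \<in> C_per" using t by (intro AE_I2 C_per_scaleR)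
  ultimately have "(\<lambda>n. \<integral>x. v n x * apply_bcontfun (\<psi> x *\<^sub>R t) ((1 / s n) *\<^sub>R (R *v x)) \<partial>lebesgue_on \<Omega>)
      \<longlonglongrightarrow> (\<integral>z. w z * apply_bcontfun (\<psi> (fst z) *\<^sub>R t) (snd z) \<partial>lebesgue_on (\<Omega> \<times> cell))"
    using lim unfolding two_scale_limit_def by blast
  moreover have "(\<integral>z. w z * (\<psi> (fst z) * apply_bcontfun t (snd z)) \<partial>lebesgue_on (\<Omega> \<times> cell))
      = (\<integral>x. cell_coeff w (apply_bcontfun t) x * \<psi> x \<partial>lebesgue_on \<Omega>)"
    by (rule integral_against_product[OF bcontfun_borel abs_bcontfun_le borel_measurable_continuous_onI[OF \<psi>] K])
  ultimately show ?thesis by simp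
qed

locale two_scale_divergence =
  fixes \<Omega> :: "(real^'d) set" and R :: "real^'d^'m" and s :: "nat \<Rightarrow> real"
    and u :: "nat \<Rightarrow> real^'d \<Rightarrow> real^'d" and g :: "nat \<Rightarrow> real^'d \<Rightarrow> real"
    and W :: "'d \<Rightarrow> (real^'d) \<times> (real^'m) \<Rightarrow> real" and G :: "(real^'d) \<times> (real^'m) \<Rightarrow> real"
  assumes \<Omega>: "open \<Omega>" "bounded \<Omega>" and s: "\<And>n. s n > 0" "s \<longlonglongrightarrow> 0"
    and u: "\<And>n. u n \<in> L2_on \<Omega>" and g: "\<And>n. square_integrable (lebesgue_on \<Omega>) (g n)"
    and div: "\<And>n. has_weak_div \<Omega> (u n) (g n)"
    and W: "\<And>j. two_scale_limit \<Omega> R s (\<lambda>n x. u n x $ j) (W j)"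
    and G: "two_scale_limit \<Omega> R s g G"
begin

lemma section_W: "section_function \<Omega> (W j)"
  using \<Omega> W[of j] by unfold_locales (auto simp: two_scale_limit_def)

lemma section_G: "section_function \<Omega> G"
  using \<Omega> G by unfold_locales (auto simp: two_scale_limit_def)

abbreviation W_coeff :: "'d \<Rightarrow> ((real^'m) \<Rightarrow>\<^sub>C real) \<Rightarrow> real^'d \<Rightarrow> real" where
  "W_coeff j t \<equiv> cell_coeff (W j) (apply_bcontfun t)"

lemma W_coeff_square_integrable: "square_integrable (lebesgue_on \<Omega>) (W_coeff j t)"
  by (rule section_function.cell_coeff_square_integrable[OF section_W bcontfun_borel abs_bcontfun_le])

text \<open>With \<open>\<psi>(x) cos(2 \<pi> k \<bullet> R x / s + c)\<close> as test function, the weak divergence identity contains the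
  term \<open>(2 \<pi> / s) \<Sum>\<^sub>j (R\<^sup>T k)\<^sub>j \<integral> u\<^sub>j \<psi> wave k b\<close>, while all other terms converge. Multiplication by
  \<open>s\<close> shows that the sum tends to \<open>0\<close>; its two-scale limit is the asserted combination tested
  with \<open>\<psi>\<close>.\<close>

lemma orthogonal_to_waves:
  "AE x in lebesgue_on \<Omega>. (\<Sum>j\<in>UNIV. (transpose R *v real_vec k) $ j * W_coeff j (wave k b) x) = 0"
proof (rule fundamental_lemma_variations[OF \<Omega>])
  define \<kappa> where "\<kappa> = transpose R *v real_vec k"
  have sum_si: "square_integrable (lebesgue_on \<Omega>) (\<lambda>x. \<Sum>j\<in>J. \<kappa> $ j * W_coeff j (wave k b) x)" if "finite J" for J
    using that
  proof (induction J rule: finite_induct)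
    case empty
    then show ?case by (simp add: square_integrable_def)
  next
    case (insert j J)
    then show ?case
      using square_integrable_add[OF square_integrable_scale[OF W_coeff_square_integrable]] by (simp del: apply_wave)
  qed
  then show "square_integrable (lebesgue_on \<Omega>) (\<lambda>x. \<Sum>j\<in>UNIV. (transpose R *v real_vec k) $ j * W_coeff j (wave k b) x)"
    by (simp add: \<kappa>_def)
  fix \<psi> assume \<psi>: "\<psi> \<in> test_functions \<Omega>" "\<psi> \<in> smooth_class"
  note \<psi>c = test_functionD(1)[OF \<psi>(1)] and \<psi>g = test_functionD(3)[OF \<psi>(1)]
  \<comment> \<open>The derivative of the cosine advances its phase by \<open>\<pi>/2\<close> and has to produce the phase \<open>b\<close>.\<close>
  define c where "c = b - pi/2"
  define y where "y n x = (1 / s n) *\<^sub>R (R *v x)" for n x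
  define X where "X j n = (\<integral>x. u n x $ j * (grad \<psi> x $ j * apply_bcontfun (wave k c) (y n x)) \<partial>lebesgue_on \<Omega>)" for j n
  define Y where "Y j n = (\<integral>x. u n x $ j * (\<psi> x * apply_bcontfun (wave k b) (y n x)) \<partial>lebesgue_on \<Omega>)" for j n
  define Z where "Z n = (\<integral>x. g n x * (\<psi> x * apply_bcontfun (wave k c) (y n x)) \<partial>lebesgue_on \<Omega>)" for n
  have limX: "X j \<longlonglongrightarrow> (\<integral>x. W_coeff j (wave k c) x * grad \<psi> x $ j \<partial>lebesgue_on \<Omega>)" for j
    using two_scale_limit_product[OF \<Omega> W \<psi>g wave_in_C_per] by (simp add: X_def[abs_def] y_def)
  have limY: "Y j \<longlonglongrightarrow> (\<integral>x. W_coeff j (wave k b) x * \<psi> x \<partial>lebesgue_on \<Omega>)" for j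
    using two_scale_limit_product[OF \<Omega> W \<psi>c wave_in_C_per] by (simp add: Y_def[abs_def] y_def)
  have limZ: "Z \<longlonglongrightarrow> (\<integral>x. cell_coeff G (apply_bcontfun (wave k c)) x * \<psi> x \<partial>lebesgue_on \<Omega>)"
    using two_scale_limit_product[OF \<Omega> G \<psi>c wave_in_C_per] by (simp add: Z_def[abs_def] y_def)
  have key: "(\<Sum>j\<in>UNIV. \<kappa> $ j * Y j n) = - (s n / (2 * pi)) * (Z n + (\<Sum>j\<in>UNIV. X j n))" for n
  proof -
    define a where "a = (2 * pi / s n) *\<^sub>R \<kappa>"
    have wave: "apply_bcontfun (wave k q) (y n x) = cos (a \<bullet> x + q)" for x q
      by (simp add: a_def \<kappa>_def y_def dot_lmul_matrix[symmetric] vector_transpose_matrix inner_commute)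
    let ?\<chi> = "\<lambda>x. \<psi> x * cos (a \<bullet> x + c)"
    note \<chi> = modulated_test_function[OF \<psi>, of a c]
    have cb: "c + pi/2 = b" by (simp add: c_def)
    have contX: "continuous_on UNIV (\<lambda>x. grad \<psi> x $ j * cos (a \<bullet> x + c))" for j
      by (intro continuous_intros \<psi>g)
    have contY: "continuous_on UNIV (\<lambda>x. \<psi> x * cos (a \<bullet> x + b))"
      by (intro continuous_intros \<psi>c)
    have iX: "integrable (lebesgue_on \<Omega>) (\<lambda>x. u n x $ j * (grad \<psi> x $ j * cos (a \<bullet> x + c)))" for j
      by (rule square_integrable_mult[OF L2_on_component(1)[OF u] square_integrable_continuous[OF contX \<Omega>]])
    have iY: "integrable (lebesgue_on \<Omega>) (\<lambda>x. u n x $ j * (\<psi> x * cos (a \<bullet> x + b)))" for j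
      by (rule square_integrable_mult[OF L2_on_component(1)[OF u] square_integrable_continuous[OF contY \<Omega>]])
    have "- Z n = (\<integral>x. u n x \<bullet> grad ?\<chi> x \<partial>lebesgue_on \<Omega>)"
      using div[of n] \<chi>(1) unfolding has_weak_div_def Z_def wave by simp
    also have "\<dots> = (\<integral>x. (\<Sum>j\<in>UNIV. u n x $ j * (grad \<psi> x $ j * cos (a \<bullet> x + c)) + a $ j * (u n x $ j * (\<psi> x * cos (a \<bullet> x + b)))) \<partial>lebesgue_on \<Omega>)"
    proof (rule Bochner_Integration.integral_cong[OF refl])
      fix x
      show "u n x \<bullet> grad ?\<chi> x
          = (\<Sum>j\<in>UNIV. u n x $ j * (grad \<psi> x $ j * cos (a \<bullet> x + c)) + a $ j * (u n x $ j * (\<psi> x * cos (a \<bullet> x + b))))"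
        unfolding inner_vec_def[of "u n x" "grad ?\<chi> x"] inner_real_def \<chi>(2) cb
        by (intro sum.cong refl) (simp only: distrib_left mult_ac)
    qed
    also have "\<dots> = (\<Sum>j\<in>UNIV. X j n + a $ j * Y j n)"
      unfolding X_def Y_def wave using iX iY by (subst Bochner_Integration.integral_sum) auto
    also have "\<dots> = (\<Sum>j\<in>UNIV. X j n) + (2 * pi / s n) * (\<Sum>j\<in>UNIV. \<kappa> $ j * Y j n)"
      by (simp add: a_def sum.distrib sum_distrib_left mult.assoc)
    finally have "(2 * pi / s n) * (\<Sum>j\<in>UNIV. \<kappa> $ j * Y j n) = - (Z n + (\<Sum>j\<in>UNIV. X j n))" by simp
    note eq = this
    have "(\<Sum>j\<in>UNIV. \<kappa> $ j * Y j n) = (s n / (2 * pi)) * ((2 * pi / s n) * (\<Sum>j\<in>UNIV. \<kappa> $ j * Y j n))"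
      using s(1)[of n] by simp
    also have "\<dots> = - (s n / (2 * pi)) * (Z n + (\<Sum>j\<in>UNIV. X j n))"
      unfolding eq by (simp only: mult_minus_left mult_minus_right)
    finally show ?thesis .
  qed
  have "(\<lambda>n. - (s n / (2 * pi)) * (Z n + (\<Sum>j\<in>UNIV. X j n))) \<longlonglongrightarrow> - (0 / (2 * pi)) *
      ((\<integral>x. cell_coeff G (apply_bcontfun (wave k c)) x * \<psi> x \<partial>lebesgue_on \<Omega>)
       + (\<Sum>j\<in>UNIV. \<integral>x. W_coeff j (wave k c) x * grad \<psi> x $ j \<partial>lebesgue_on \<Omega>))"
    by (intro tendsto_intros s(2) limX limZ) simp
  then have "(\<lambda>n. \<Sum>j\<in>UNIV. \<kappa> $ j * Y j n) \<longlonglongrightarrow> 0" by (simp add: key)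
  moreover have "(\<lambda>n. \<Sum>j\<in>UNIV. \<kappa> $ j * Y j n) \<longlonglongrightarrow> (\<Sum>j\<in>UNIV. \<kappa> $ j * (\<integral>x. W_coeff j (wave k b) x * \<psi> x \<partial>lebesgue_on \<Omega>))"
    by (intro tendsto_intros limY)
  ultimately have "(\<Sum>j\<in>UNIV. \<kappa> $ j * (\<integral>x. W_coeff j (wave k b) x * \<psi> x \<partial>lebesgue_on \<Omega>)) = 0"
    by (rule LIMSEQ_unique[rotated])
  moreover have "(\<integral>x. (\<Sum>j\<in>UNIV. \<kappa> $ j * W_coeff j (wave k b) x) * \<psi> x \<partial>lebesgue_on \<Omega>)
      = (\<Sum>j\<in>UNIV. \<kappa> $ j * (\<integral>x. W_coeff j (wave k b) x * \<psi> x \<partial>lebesgue_on \<Omega>))"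
    using square_integrable_mult[OF W_coeff_square_integrable square_integrable_continuous[OF \<psi>c \<Omega>]]
    by (simp add: sum_distrib_right mult.assoc)
  ultimately show "(\<integral>x. (\<Sum>j\<in>UNIV. (transpose R *v real_vec k) $ j * W_coeff j (wave k b) x) * \<psi> x \<partial>lebesgue_on \<Omega>) = 0"
    by (simp add: \<kappa>_def)
qed

definition mean_field :: "real^'d \<Rightarrow> real^'d" where
  "mean_field x = (\<chi> j. W_coeff j (wave 0 0) x)"

definition mean_div :: "real^'d \<Rightarrow> real" where
  "mean_div = cell_coeff G (apply_bcontfun (wave 0 0))"

lemma mean_div_square_integrable: "square_integrable (lebesgue_on \<Omega>) mean_div"
  unfolding mean_div_def
  by (rule section_function.cell_coeff_square_integrable[OF section_G bcontfun_borel abs_bcontfun_le])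

lemma mean_field_L2: "mean_field \<in> L2_on \<Omega>"
  by (rule L2_on_vecI) (simp add: mean_field_def W_coeff_square_integrable)

text \<open>The divergence identity for test functions of the slow variable alone involves no derivative of an
  oscillating factor and passes to the limit term by term.\<close>

lemma mean_field_has_weak_div: "has_weak_div \<Omega> mean_field mean_div"
  unfolding has_weak_div_def
proof
  fix \<psi> assume \<psi>: "\<psi> \<in> test_functions \<Omega>"
  note \<psi>c = test_functionD(1)[OF \<psi>] and \<psi>g = test_functionD(3)[OF \<psi>]
  have i: "integrable (lebesgue_on \<Omega>) (\<lambda>x. u n x $ j * grad \<psi> x $ j)" for n j
    by (rule square_integrable_mult[OF L2_on_component(1)[OF u] square_integrable_continuous[OF \<psi>g \<Omega>]])
  have i': "integrable (lebesgue_on \<Omega>) (\<lambda>x. W_coeff j (wave 0 0) x * grad \<psi> x $ j)" for j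
    by (rule square_integrable_mult[OF W_coeff_square_integrable square_integrable_continuous[OF \<psi>g \<Omega>]])
  have "(\<lambda>n. \<integral>x. u n x $ j * grad \<psi> x $ j \<partial>lebesgue_on \<Omega>)
      \<longlonglongrightarrow> (\<integral>x. W_coeff j (wave 0 0) x * grad \<psi> x $ j \<partial>lebesgue_on \<Omega>)" for j
    using two_scale_limit_product[OF \<Omega> W \<psi>g wave_in_C_per[of 0 0]] by simp
  then have "(\<lambda>n. \<Sum>j\<in>UNIV. \<integral>x. u n x $ j * grad \<psi> x $ j \<partial>lebesgue_on \<Omega>)
      \<longlonglongrightarrow> (\<Sum>j\<in>UNIV. \<integral>x. W_coeff j (wave 0 0) x * grad \<psi> x $ j \<partial>lebesgue_on \<Omega>)"
    by (intro tendsto_sum)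
  moreover have "(\<Sum>j\<in>UNIV. \<integral>x. u n x $ j * grad \<psi> x $ j \<partial>lebesgue_on \<Omega>) = - (\<integral>x. g n x * \<psi> x \<partial>lebesgue_on \<Omega>)" for n
  proof -
    have "(\<Sum>j\<in>UNIV. \<integral>x. u n x $ j * grad \<psi> x $ j \<partial>lebesgue_on \<Omega>)
        = (\<integral>x. (\<Sum>j\<in>UNIV. u n x $ j * grad \<psi> x $ j) \<partial>lebesgue_on \<Omega>)"
      by (rule Bochner_Integration.integral_sum[symmetric, OF i])
    also have "\<dots> = (\<integral>x. u n x \<bullet> grad \<psi> x \<partial>lebesgue_on \<Omega>)" by (simp add: inner_vec_def)
    finally show ?thesis using div[of n] \<psi> by (simp add: has_weak_div_def)
  qed
  moreover have "(\<Sum>j\<in>UNIV. \<integral>x. W_coeff j (wave 0 0) x * grad \<psi> x $ j \<partial>lebesgue_on \<Omega>)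
      = (\<integral>x. mean_field x \<bullet> grad \<psi> x \<partial>lebesgue_on \<Omega>)"
    unfolding mean_field_def inner_vec_def inner_real_def vec_lambda_beta
    by (rule Bochner_Integration.integral_sum[symmetric, OF i'])
  ultimately have "(\<lambda>n. - (\<integral>x. g n x * \<psi> x \<partial>lebesgue_on \<Omega>)) \<longlonglongrightarrow> (\<integral>x. mean_field x \<bullet> grad \<psi> x \<partial>lebesgue_on \<Omega>)"
    by simp
  moreover have "(\<lambda>n. - (\<integral>x. g n x * \<psi> x \<partial>lebesgue_on \<Omega>)) \<longlonglongrightarrow> - (\<integral>x. mean_div x * \<psi> x \<partial>lebesgue_on \<Omega>)"
    using tendsto_minus[OF two_scale_limit_product[OF \<Omega> G \<psi>c wave_in_C_per[of 0 0]]] by (simp add: mean_div_def)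
  ultimately show "(\<integral>x. mean_field x \<bullet> grad \<psi> x \<partial>lebesgue_on \<Omega>) = - (\<integral>x. mean_div x * \<psi> x \<partial>lebesgue_on \<Omega>)"
    by (rule LIMSEQ_unique)
qed

end


theorem proposition6:
  fixes \<Omega> :: "(real^3) set"
    and R :: "real^3^'m"
    and \<eta> :: "nat \<Rightarrow> real"
    and u :: "nat \<Rightarrow> real^3 \<Rightarrow> real^3"
  assumes "open \<Omega>" and "bounded \<Omega>" and "lipschitz_boundary \<Omega>"
    and "CARD('m) > 3"
    and "\<And>k::int^'m. k \<noteq> 0 \<Longrightarrow> transpose R *v real_vec k \<noteq> 0"
    and "\<And>n. \<eta> n > 0" and "\<eta> \<longlonglongrightarrow> 0"
    and "\<And>n. u n \<in> H_div \<Omega>"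
    and "bdd_above (range (\<lambda>n. H_div_norm \<Omega> (u n)))"
  shows "\<exists>(r :: nat \<Rightarrow> nat) (u0 :: real^3 \<Rightarrow> real^'m \<Rightarrow> real^3)
            (u1 :: real^3 \<Rightarrow> int^'m \<Rightarrow> complex^3) (divR_u1 :: real^3 \<Rightarrow> real^'m \<Rightarrow> real).
           strict_mono r \<and>
           u0 \<in> H_div_valued \<Omega> R \<and>
           divR_u1 \<in> L2_valued \<Omega> L2_per \<and>
           (AE x in lebesgue_on \<Omega>. has_div_R R (u1 x) (divR_u1 x)) \<and>
           weak_two_scale_vec \<Omega> R (\<eta> \<circ> r) (u \<circ> r) u0 \<and>
           weak_two_scale \<Omega> R (\<eta> \<circ> r) (\<lambda>n. weak_div \<Omega> (u (r n)))
             (\<lambda>x y. weak_div \<Omega> (cell_mean u0) x + divR_u1 x y)"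
proof -
  note \<Omega> = assms(1,2) and nonres = assms(5)
  have \<Omega>b: "\<Omega> \<in> sets borel" and \<Omega>m: "\<Omega> \<in> lmeasurable" using \<Omega> by (auto intro: lmeasurable_open)
  have uL2: "u n \<in> L2_on \<Omega>" for n using assms(8) by (simp add: H_div_def)
  define g where "g n = weak_div \<Omega> (u n)" for n
  have g: "square_integrable (lebesgue_on \<Omega>) (g n)" for n
    using weak_div_in_L2[OF assms(8)] by (simp add: g_def L2_on_real_iff)
  obtain K where K: "\<And>n. H_div_norm \<Omega> (u n) \<le> K" using assms(9) by (auto simp: bdd_above_def)
  have bound: "(\<integral>x. (norm (u n x))\<^sup>2 \<partial>lebesgue_on \<Omega>) \<le> K\<^sup>2" "(\<integral>x. (g n x)\<^sup>2 \<partial>lebesgue_on \<Omega>) \<le> K\<^sup>2" for n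
  proof -
    define a b where "a = (\<integral>x. (norm (u n x))\<^sup>2 \<partial>lebesgue_on \<Omega>)" and "b = (\<integral>x. (g n x)\<^sup>2 \<partial>lebesgue_on \<Omega>)"
    have ab: "a \<ge> 0" "b \<ge> 0" by (simp_all add: a_def b_def)
    have "sqrt (a + b) \<le> K" using K[of n] by (simp add: H_div_norm_def a_def b_def g_def)
    then have "(sqrt (a + b))\<^sup>2 \<le> K\<^sup>2" using ab by (intro power_mono) auto
    then have "a + b \<le> K\<^sup>2" using ab by simp
    then show "(\<integral>x. (norm (u n x))\<^sup>2 \<partial>lebesgue_on \<Omega>) \<le> K\<^sup>2" "(\<integral>x. (g n x)\<^sup>2 \<partial>lebesgue_on \<Omega>) \<le> K\<^sup>2"
      using ab unfolding a_def b_def by linarith+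
  qed
  \<comment> \<open>One index type for the three components and the divergence gives a common subsequence.\<close>
  define v where "v i n x = (case i of None \<Rightarrow> g n x | Some j \<Rightarrow> u n x $ j)" for i n x
  have v_simps: "v None = g" "v (Some j) = (\<lambda>n x. u n x $ j)" for j by (auto simp: v_def fun_eq_iff)
  have v: "square_integrable (lebesgue_on \<Omega>) (v i n)" "(\<integral>x. (v i n x)\<^sup>2 \<partial>lebesgue_on \<Omega>) \<le> K\<^sup>2" for i n
    using g[of n] bound[of n] L2_on_component[OF uL2[of n]]
    by (cases i; auto simp: v_simps intro: order.trans)+
  obtain r :: "nat \<Rightarrow> nat" where r: "strict_mono r"
    "\<And>i. \<exists>w. two_scale_limit \<Omega> R (\<lambda>n. \<eta> (r n)) (\<lambda>n. v i (r n)) w"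
    using two_scale_compactness_finite[where v = v, OF finite[of UNIV] \<Omega> nonres assms(6,7) v] by auto
  define s where "s n = \<eta> (r n)" for n
  have s: "s n > 0" "s \<longlonglongrightarrow> 0" for n
    using assms(6) LIMSEQ_subseq_LIMSEQ[OF assms(7) r(1)] by (auto simp: s_def[abs_def] comp_def)
  obtain G where G: "two_scale_limit \<Omega> R s (\<lambda>n. g (r n)) G"
    using r(2)[of None] unfolding v_simps s_def[abs_def] by blast
  have "\<forall>j. \<exists>w. two_scale_limit \<Omega> R s (\<lambda>n x. u (r n) x $ j) w"
    using r(2)[of "Some _"] unfolding v_simps s_def[abs_def] by blast
  then obtain W where W: "\<And>j. two_scale_limit \<Omega> R s (\<lambda>n x. u (r n) x $ j) (W j)" by metis
  interpret two_scale_divergence \<Omega> R s "\<lambda>n. u (r n)" "\<lambda>n. g (r n)" W G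
    using \<Omega> s uL2 g W G has_weak_div_weak_div[OF assms(8)] by unfold_locales (auto simp: g_def)
  let ?D = "\<Omega> \<times> (cell :: (real^'m) set)"
  let ?M = "lebesgue_on ?D"
  have Db: "?D \<in> sets borel" using \<Omega>b by (intro borel_Times) auto
  have Wz: "z \<notin> ?D \<Longrightarrow> W j z = 0" and Wb: "W j \<in> borel_measurable borel" and W2: "square_integrable lborel (W j)"
    and Gz: "z \<notin> ?D \<Longrightarrow> G z = 0" and Gb: "G \<in> borel_measurable borel" and G2: "square_integrable lborel G" for j z
    using W[of j] G unfolding two_scale_limit_def by blast+
  \<comment> \<open>The limits are determined on the cell only; they are extended periodically.\<close>
  define u0 where "u0 x y = (\<chi> j. W j (x, frac_vec y))" for x y
  define g0 where "g0 x y = G (x, frac_vec y)" for x y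
  have u0: "u0 x y $ j = W j (x, y)" and g0: "g0 x y = G (x, y)" if "y \<in> cell" for x y j
    using that by (simp_all add: u0_def g0_def frac_vec_cell)
  have restrict: "square_integrable ?M f" if "f \<in> borel_measurable borel" "\<And>z. z \<notin> ?D \<Longrightarrow> f z = 0" "square_integrable lborel f" for f
    using that lebesgue_on_borel_integral(1)[OF Db, of "\<lambda>z. (f z)\<^sup>2"]
    by (intro square_integrableI borel_measurable_lebesgue_on) (auto simp: square_integrable_def)
  have si_cong: "square_integrable ?M f" if "square_integrable ?M h" "\<And>z. z \<in> ?D \<Longrightarrow> f z = h z" for f h
    using that measurable_cong[of ?M f h borel]
    by (intro square_integrable_bound[OF that(1)]) (auto simp: square_integrable_def)
  have u0_si: "square_integrable ?M (\<lambda>(x, y). u0 x y $ j)" for j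
    by (rule si_cong[OF restrict[OF Wb Wz W2]]) (auto simp: u0)
  have g0_si: "square_integrable ?M (\<lambda>(x, y). g0 x y)"
    by (rule si_cong[OF restrict[OF Gb Gz G2]]) (auto simp: g0)
  have aeW: "AE x in lebesgue_on \<Omega>. \<forall>j. square_integrable lborel (\<lambda>y. W j (x, y))"
    unfolding AE_all_countable
    using AE_lebesgue_on_lborel[OF \<Omega>b section_function.section_square_integrable[OF section_W]]
    by blast
  have aeG: "AE x in lebesgue_on \<Omega>. square_integrable lborel (\<lambda>y. G (x, y))"
    by (rule AE_lebesgue_on_lborel[OF \<Omega>b section_function.section_square_integrable[OF section_G]])
  have one_si: "square_integrable (lebesgue_on (cell :: (real^'m) set)) (\<lambda>y. c)" for c
    by (rule square_integrable_bounded_function[OF cell_lmeasurable, where B = "\<bar>c\<bar>"]) auto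
  have cell_int: "integrable (lebesgue_on cell) f" if "square_integrable (lebesgue_on cell) f" for f :: "real^'m \<Rightarrow> real"
    using square_integrable_mult[OF that one_si[of 1]] by simp
  have secW: "square_integrable (lebesgue_on cell) (\<lambda>y. u0 x y $ j)"
    "(\<integral>y. u0 x y $ j * apply_bcontfun t y \<partial>lebesgue_on cell) = W_coeff j t x"
    if "\<forall>j. square_integrable lborel (\<lambda>y. W j (x, y))" for x j t
    using section_function.section_on_cell[OF section_W, of j x "\<lambda>y. u0 x y $ j"] that u0 by auto
  have secG: "square_integrable (lebesgue_on cell) (g0 x)"
    "(\<integral>y. g0 x y * apply_bcontfun t y \<partial>lebesgue_on cell) = cell_coeff G (apply_bcontfun t) x"
    if "square_integrable lborel (\<lambda>y. G (x, y))" for x t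
    using section_function.section_on_cell[OF section_G, of x "g0 x"] that g0 by auto
  have perW: "periodic (u0 x)" and perG: "periodic (\<lambda>y. g0 x y - c)" for x c
    using periodic_frac_vec[of "\<lambda>y. \<chi> j. W j (x, y)"] periodic_frac_vec[of "\<lambda>y. G (x, y) - c"]
    by (simp_all add: u0_def[abs_def] g0_def[abs_def])

  have meanE: "cell_mean u0 x = mean_field x" if x: "\<forall>j. square_integrable lborel (\<lambda>y. W j (x, y))" for x
  proof -
    have "cell_mean u0 x $ j = mean_field x $ j" for j
      unfolding cell_mean_def using secW(2)[OF x, of j "wave 0 0"] integral_vec_component[OF cell_int[OF secW(1)[OF x]], of j]
      by (simp add: mean_field_def)
    then show ?thesis by (simp add: vec_eq_iff)
  qed
  have mean_ae: "AE x in lebesgue_on \<Omega>. mean_field x = cell_mean u0 x"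
    using aeW by eventually_elim (simp add: meanE)
  have mean_L2: "cell_mean u0 \<in> L2_on \<Omega>"
    by (rule L2_on_AE_cong[OF _ mean_field_L2 mean_ae]) (use \<Omega>b in simp)
  have "has_weak_div \<Omega> (cell_mean u0) mean_div"
    by (rule has_weak_div_cong[OF mean_field_has_weak_div mean_ae])
      (use mean_L2 mean_field_L2 in \<open>auto simp: L2_on_def\<close>)
  moreover from this have mean_H: "cell_mean u0 \<in> H_div \<Omega>"
    using mean_L2 mean_div_square_integrable by (auto simp: H_div_def L2_on_real_iff)
  moreover define q where "q = weak_div \<Omega> (cell_mean u0)"
  ultimately have q: "square_integrable (lebesgue_on \<Omega>) q" "AE x in lebesgue_on \<Omega>. q x = mean_div x"
    using weak_div_in_L2[OF mean_H] has_weak_div_unique[OF \<Omega> _ has_weak_div_weak_div[OF mean_H] mean_div_square_integrable]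
    by (auto simp: L2_on_real_iff)
  define \<kappa> where "\<kappa> k = transpose R *v real_vec k" for k :: "int^'m"
  have orth: "AE x in lebesgue_on \<Omega>. \<forall>k. (\<Sum>j\<in>UNIV. \<kappa> k $ j * W_coeff j (wave k 0) x) = 0 \<and>
      (\<Sum>j\<in>UNIV. \<kappa> k $ j * W_coeff j (wave k (- (pi/2))) x) = 0"
    unfolding AE_all_countable \<kappa>_def using orthogonal_to_waves AE_conjI by blast
  have "AE x in lebesgue_on \<Omega>. u0 x \<in> H_per_div_R0 R"
    using aeW orth
  proof eventually_elim
    case (elim x)
    have "u0 x \<in> L2_on cell" by (rule L2_on_vecI) (rule secW(1)[OF elim(1)])
    moreover have "has_div_R R (fourier_coeff_vec (u0 x)) (\<lambda>y. 0)"
      unfolding has_div_R_def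
    proof
      fix k :: "int^'m"
      have "fourier_coeff_vec (u0 x) k $ j = Complex (W_coeff j (wave k 0) x) (- W_coeff j (wave k (- (pi/2))) x)" for j
        unfolding fourier_coeff_vec_def vec_lambda_beta fourier_coeff_waves[OF cell_int[OF secW(1)[OF elim(1)]]] secW(2)[OF elim(1)] ..
      then have "(\<Sum>j\<in>UNIV. complex_of_real (\<kappa> k $ j) * fourier_coeff_vec (u0 x) k $ j)
          = Complex (\<Sum>j\<in>UNIV. \<kappa> k $ j * W_coeff j (wave k 0) x) (- (\<Sum>j\<in>UNIV. \<kappa> k $ j * W_coeff j (wave k (- (pi/2))) x))"
        by (simp add: complex_eq_iff sum_negf del: apply_wave)
      also have "\<dots> = 0" using elim(2) by (simp add: complex_eq_iff del: apply_wave)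
      finally show "fourier_coeff (\<lambda>y. 0) k = 2 * complex_of_real pi * \<i> *
          (\<Sum>j\<in>UNIV. complex_of_real ((transpose R *v real_vec k) $ j) * fourier_coeff_vec (u0 x) k $ j)"
        by (simp add: fourier_coeff_def \<kappa>_def)
    qed
    ultimately show ?case using perW by (simp add: H_per_div_R0_def L2_per_def)
  qed
  moreover have u0_L2: "(\<lambda>(x, y). u0 x y) \<in> L2_on ?D"
    by (rule L2_on_vecI) (use u0_si in \<open>simp add: case_prod_unfold\<close>)
  ultimately have u0_H: "u0 \<in> H_div_valued \<Omega> R"
    using mean_H by (simp add: H_div_valued_def L2_valued_def)
  \<comment> \<open>The oscillating part of the limit divergence has mean zero, so it is a divergence in the fast variable.\<close>
  define dv where "dv x y = g0 x y - q x" for x y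
  have qint: "integrable (lebesgue_on \<Omega>) q" "integrable (lebesgue_on \<Omega>) (\<lambda>x. (q x)\<^sup>2)"
    using square_integrable_mult[OF q(1) square_integrable_bounded_function[OF \<Omega>m, where B = 1 and f = "\<lambda>x. 1"]] q(1)
    by (auto simp: square_integrable_def)
  have q_si: "square_integrable ?M (\<lambda>z. q (fst z))"
    by (rule square_integrableI[OF integral_lebesgue_on_fst(1)[OF \<Omega>b qint(1)] integral_lebesgue_on_fst(2)[OF \<Omega>b qint(2)]])
  have dv_si: "square_integrable ?M (\<lambda>(x, y). dv x y)"
    using square_integrable_diff[OF g0_si q_si] by (simp add: dv_def case_prod_unfold)
  have dv_cell: "square_integrable (lebesgue_on cell) (dv x)" if "square_integrable lborel (\<lambda>y. G (x, y))" for x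
    using square_integrable_diff[OF secG(1)[OF that] one_si[of "q x"]] by (simp add: dv_def[abs_def])
  have "AE x in lebesgue_on \<Omega>. dv x \<in> L2_per"
    using aeG by eventually_elim (use perG dv_cell in \<open>simp add: L2_per_def L2_on_real_iff dv_def[abs_def]\<close>)
  then have dv_L2: "dv \<in> L2_valued \<Omega> L2_per"
    using dv_si by (simp add: L2_valued_def L2_on_real_iff)
  \<comment> \<open>The solution of \<open>2 \<pi> \<i> \<kappa>\<^sub>k \<bullet> v\<^sub>k = c\<^sub>k\<close> parallel to \<open>\<kappa>\<^sub>k\<close>; at \<open>k = 0\<close> both sides vanish.\<close>
  define u1 where "u1 x k = (if k = 0 then 0 else
      \<chi> j. fourier_coeff (dv x) k / (2 * complex_of_real pi * \<i> * complex_of_real ((norm (\<kappa> k))\<^sup>2)) * complex_of_real (\<kappa> k $ j))"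
    for x k
  have u1: "AE x in lebesgue_on \<Omega>. has_div_R R (u1 x) (dv x)"
    using aeG q(2)
  proof eventually_elim
    case (elim x)
    note di = cell_int[OF dv_cell[OF elim(1)]]
    show ?case
      unfolding has_div_R_def
    proof
      fix k :: "int^'m"
      show "fourier_coeff (dv x) k = 2 * complex_of_real pi * \<i> *
          (\<Sum>j\<in>UNIV. complex_of_real ((transpose R *v real_vec k) $ j) * u1 x k $ j)"
      proof (cases "k = 0")
        case True
        have "(\<integral>y. g0 x y \<partial>lebesgue_on cell) = mean_div x"
          using secG(2)[OF elim(1), of "wave 0 0"] by (simp add: mean_div_def)
        moreover have "measure (lebesgue_on (cell :: (real^'m) set)) cell = 1"
          using measure_cell[where 'm = 'm] cell_lmeasurable
          by (subst measure_restrict_space) (auto simp: measure_completion)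
        ultimately have "(\<integral>y. dv x y \<partial>lebesgue_on cell) = 0"
          using cell_int[OF secG(1)[OF elim(1)]] cell_int[OF one_si] elim(2) by (simp add: dv_def[abs_def])
        then show ?thesis using fourier_coeff_waves[OF di, of 0] by (simp add: True u1_def complex_eq_iff)
      next
        case False
        then have n: "(norm (\<kappa> k))\<^sup>2 \<noteq> 0" using nonres[of k] by (simp add: \<kappa>_def)
        define c where "c = fourier_coeff (dv x) k / (2 * complex_of_real pi * \<i> * complex_of_real ((norm (\<kappa> k))\<^sup>2))"
        have "(\<Sum>j\<in>UNIV. complex_of_real (\<kappa> k $ j) * u1 x k $ j) = (\<Sum>j\<in>UNIV. c * complex_of_real ((\<kappa> k $ j)\<^sup>2))"
          by (intro sum.cong refl) (simp add: u1_def False c_def power2_eq_square)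
        also have "\<dots> = c * complex_of_real ((norm (\<kappa> k))\<^sup>2)"
          by (simp only: norm_square_vec of_real_sum sum_distrib_left)
        finally have "2 * complex_of_real pi * \<i> * (\<Sum>j\<in>UNIV. complex_of_real (\<kappa> k $ j) * u1 x k $ j)
            = (2 * complex_of_real pi * \<i> * complex_of_real ((norm (\<kappa> k))\<^sup>2)) * c" by (simp only: mult_ac)
        also have "\<dots> = fourier_coeff (dv x) k" using n by (simp add: c_def)
        finally show ?thesis by (simp add: \<kappa>_def)
      qed
    qed
  qed
  have lim: "(\<lambda>n. \<integral>x. f n x * apply_bcontfun (\<phi> x) ((1 / (\<eta> \<circ> r) n) *\<^sub>R (R *v x)) \<partial>lebesgue_on \<Omega>)
      \<longlonglongrightarrow> (LINT (x, y)|?M. h x y * apply_bcontfun (\<phi> x) y)"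
    if "two_scale_limit \<Omega> R s f w" "\<And>x y. y \<in> cell \<Longrightarrow> h x y = w (x, y)"
      and \<phi>: "\<phi> \<in> L2_on \<Omega>" "AE x in lebesgue_on \<Omega>. \<phi> x \<in> C_per"
    for f w h and \<phi> :: "real^3 \<Rightarrow> ((real^'m) \<Rightarrow>\<^sub>C real)"
  proof -
    have "(LINT (x, y)|?M. h x y * apply_bcontfun (\<phi> x) y) = (\<integral>z. w z * apply_bcontfun (\<phi> (fst z)) (snd z) \<partial>?M)"
      by (rule Bochner_Integration.integral_cong) (auto simp: that(2))
    then show ?thesis using that(1) \<phi> by (simp add: two_scale_limit_def s_def)
  qed
  have "weak_two_scale_vec \<Omega> R (\<eta> \<circ> r) (u \<circ> r) u0"
    unfolding weak_two_scale_vec_def weak_two_scale_def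
  proof (intro allI conjI impI)
    fix j n and \<phi> :: "real^3 \<Rightarrow> ((real^'m) \<Rightarrow>\<^sub>C real)"
    show "(\<lambda>x. (u \<circ> r) n x $ j) \<in> L2_on \<Omega>" using L2_on_component(1)[OF uL2] by (simp add: L2_on_real_iff)
    show "(\<lambda>(x, y). u0 x y $ j) \<in> L2_on ?D" using u0_si by (simp add: L2_on_real_iff)
    assume "\<phi> \<in> L2_on \<Omega>" "AE x in lebesgue_on \<Omega>. \<phi> x \<in> C_per"
    from lim[OF W[of j] u0 this]
    show "(\<lambda>n. \<integral>x. (u \<circ> r) n x $ j * apply_bcontfun (\<phi> x) ((1 / (\<eta> \<circ> r) n) *\<^sub>R (R *v x)) \<partial>lebesgue_on \<Omega>)
        \<longlonglongrightarrow> (LINT (x, y)|?M. u0 x y $ j * apply_bcontfun (\<phi> x) y)" by simp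
  qed
  moreover have "weak_two_scale \<Omega> R (\<eta> \<circ> r) (\<lambda>n. weak_div \<Omega> (u (r n)))
      (\<lambda>x y. weak_div \<Omega> (cell_mean u0) x + dv x y)"
    unfolding weak_two_scale_def
  proof (intro allI conjI impI)
    fix n and \<phi> :: "real^3 \<Rightarrow> ((real^'m) \<Rightarrow>\<^sub>C real)"
    have e: "weak_div \<Omega> (cell_mean u0) x + dv x y = g0 x y" for x y by (simp add: dv_def q_def)
    show "weak_div \<Omega> (u (r n)) \<in> L2_on \<Omega>" by (rule weak_div_in_L2[OF assms(8)])
    show "(\<lambda>(x, y). weak_div \<Omega> (cell_mean u0) x + dv x y) \<in> L2_on ?D"
      unfolding e L2_on_real_iff by (rule g0_si)
    assume "\<phi> \<in> L2_on \<Omega>" "AE x in lebesgue_on \<Omega>. \<phi> x \<in> C_per"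
    from lim[OF G g0 this]
    show "(\<lambda>n. \<integral>x. weak_div \<Omega> (u (r n)) x * apply_bcontfun (\<phi> x) ((1 / (\<eta> \<circ> r) n) *\<^sub>R (R *v x)) \<partial>lebesgue_on \<Omega>)
        \<longlonglongrightarrow> (LINT (x, y)|?M. (weak_div \<Omega> (cell_mean u0) x + dv x y) * apply_bcontfun (\<phi> x) y)"
      unfolding e by (simp add: g_def)
  qed
  ultimately show ?thesis using r(1) u0_H dv_L2 u1 by blast
qed


end
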